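(* Let $T=S^1$ and let $M=M_1\times\cdots\times M_m$ be a product of compact connected manifolds such that, for each $i$, the ring $H^*(M_i;\mathbb{C})$ is generated by the class of a closed two-form $x_i$. Suppose each $M_i$ carries a circle action with isolated fixed points and a moment map $\mu_i$ for $x_i$, that $M$ carries the diagonal action, and that $\mu=\sum_{i=1}^m\mu_i$ is a (formal) moment map on $M$ having $0$ as a regular value (all as specified in the context). With $\theta_{ij}$, $\mathcal{L}$, $\mathcal{S}$, minimal coverings, and the ideals $\bar K_+,\bar K_-\subset\mathbb{C}[t,\tilde x_1,\ldots,\tilde x_m]$ as defined in the context, the following hold. (i) The family of all elements $$\prod_{1\le i\le m}\ \prod_{j_i\in\mathcal{A}_i}\bigl(\tilde x_i-\theta_{ij_i}t\bigr),$$ where $\{\mathcal{A}_i\}_{1\le i\le m}$ ranges over all minimal coverings of $\mathcal{L}$, is contained in $\bar K_+$ and generates $\bar K_+$ as an ideal. (ii) The family of all elements $$\prod_{1\le i\le m}\ \prod_{j_i\in\mathcal{A}_i}\bigl(\tilde x_i-\theta_{ij_i}t\bigr),$$ where $\{\mathcal{A}_i\}_{1\le i\le m}$ ranges over all minimal coverings of $\mathcal{S}$, is contained in $\bar K_-$ and generates $\bar K_-$ as an ideal.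
   Context: Setting. Cohomology has complex coefficients, and $H_T^*(\mathrm{point})=\mathbb{C}[t]$ with $T=S^1$. For each $i$, $M_i$ is a compact connected manifold with a circle action whose fixed points are isolated. The form $x_i$ is a $T$-invariant closed two-form on $M_i$ whose class in $H^2(M_i)$ generates the ring $H^*(M_i)$. The function $\mu_i:M_i\to\mathbb{R}$ is a moment map for $x_i$, i.e. $\iota_\xi x_i=d\mu_i$ for the vector field $\xi$ generating the action. The forms $x_i$ and functions $\mu_i$ are pulled back to $M$ by the projections, and $\mu=\sum_i\mu_i$. The circle acts diagonally on $M$. The action is formally Hamiltonian: $\mu$ is a Morse-Bott function whose critical points are exactly the fixed points of the action on $M$. (This includes the case of symplectic $M_i$ with Hamiltonian actions.) The value $0$ is a regular value of $\mu$, so $\mu$ does not vanish at any fixed point. Let $\tilde x_i=x_i+t\mu_i$ be the equivariantly closed extension of $x_i$ (with the sign convention for the equivariant differential that makes it closed). At a fixed point $p$ of $M$ it restricts to $\mu_i(p)\,t\in\mathbb{C}[t]$. Fixed point data. For each $i$, let $\theta_{i1},\ldots,\theta_{in_i}$ be the distinct values of $\mu_i$ on the fixed points of $M_i$, and let $F_{ij}$ be the set of fixed points of $M_i$ at which $\mu_i=\theta_{ij}$. Put $N_i=\{1,\ldots,n_i\}$ and $\mathcal{A}=N_1\times\cdots\times N_m$. For $J=(j_1,\ldots,j_m)\in\mathcal{A}$ put $\mathbf{F}(J)=(F_{1j_1},\ldots,F_{mj_m})$, i.e. the set of fixed points $F_{1j_1}\times\cdots\times F_{mj_m}$ of $M$.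 On it $\mu$ has the value $\mu(\mathbf{F}(J))=\sum_{i=1}^m\theta_{ij_i}$. Define $$\mathcal{L}=\{J\in\mathcal{A}:\mu(\mathbf{F}(J))>0\},\qquad \mathcal{S}=\{J\in\mathcal{A}:\mu(\mathbf{F}(J))<0\}.$$ Coverings. Let $P_i:\mathcal{A}\to N_i$ be the projection to the $i$-th coordinate. A collection $\{\mathcal{A}_i\}_{1\le i\le m}$ of (possibly empty) subsets $\mathcal{A}_i\subset N_i$ is a covering of $\mathcal{L}$ (respectively $\mathcal{S}$) if $\mathcal{L}\subset\bigcup_{i=1}^m P_i^{-1}(\mathcal{A}_i)$ (respectively $\mathcal{S}\subset\bigcup_{i=1}^m P_i^{-1}(\mathcal{A}_i)$). It is minimal if, whenever one element is dropped from one of the $\mathcal{A}_i$, it is no longer a covering. Empty products equal $1$. The ideals. Let $K_+\subset H_T^*(M;\mathbb{C})$ (respectively $K_-$) be the ideal of classes whose restriction to every fixed point $p$ with $\mu(p)>0$ (respectively $\mu(p)<0$) vanishes. Let $\eta:\mathbb{C}[t,\tilde x_1,\ldots,\tilde x_m]\to H_T^*(M;\mathbb{C})$ be the ring homomorphism from the polynomial ring in $m+1$ variables sending each variable to the class of the same name. Then $\bar K_\pm=\eta^{-1}(K_\pm)$. *)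

theory Defs
  imports
    "HOL-Analysis.Analysis"
    "HOL-Algebra.UnivPoly"
    "HOL-Algebra.QuotRing"
    "HOL-Algebra.Generated_Rings"
    "HOL-Library.Poly_Mapping"
    "HOL-Computational_Algebra.Polynomial"
begin

section \<open>Smooth manifolds\<close>

text \<open>
  Dimensions vary inside the statement, so the Euclidean space of dimension \<open>card K\<close> is
  \<^term>\<open>powertop_real K\<close>, i.e. the extensional functions from the finite index set \<open>K\<close> to the reals.
  A chart is a pair \<open>(U, \<phi>)\<close> with \<open>\<phi>\<close> defined on the open set \<open>U\<close>.
\<close>

type_synonym ('a, 'k) chart = "'a set \<times> ('a \<Rightarrow> 'k \<Rightarrow> real)"

record ('a, 'k) manifold =
  mtop :: "'a topology"
  coords :: "'k set"
  atlas :: "('a, 'k) chart set"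

abbreviation points :: "('a, 'k) manifold \<Rightarrow> 'a set"
  where "points M \<equiv> topspace (mtop M)"

definition partial :: "'k \<Rightarrow> (('k \<Rightarrow> real) \<Rightarrow> real) \<Rightarrow> ('k \<Rightarrow> real) \<Rightarrow> real"
  where "partial k g y = deriv (\<lambda>s. g (y(k := s))) (y k)"

text \<open>\<open>V\<close> is meant to be open in \<^term>\<open>powertop_real K\<close>.\<close>

primrec Ck_on :: "'k set \<Rightarrow> nat \<Rightarrow> ('k \<Rightarrow> real) set \<Rightarrow> (('k \<Rightarrow> real) \<Rightarrow> real) \<Rightarrow> bool"
  where
    "Ck_on K 0 V g \<longleftrightarrow> continuous_map (subtopology (powertop_real K) V) euclideanreal g"
  | "Ck_on K (Suc r) V g \<longleftrightarrow>
       continuous_map (subtopology (powertop_real K) V) euclideanreal g \<and>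
       (\<forall>k\<in>K. (\<forall>y\<in>V. (\<lambda>s. g (y(k := s))) differentiable (at (y k))) \<and>
               Ck_on K r V (partial k g))"

definition Cinf_on :: "'k set \<Rightarrow> ('k \<Rightarrow> real) set \<Rightarrow> (('k \<Rightarrow> real) \<Rightarrow> real) \<Rightarrow> bool"
  where "Cinf_on K V g \<longleftrightarrow> (\<forall>r. Ck_on K r V g)"

definition is_chart :: "('a, 'k) manifold \<Rightarrow> ('a, 'k) chart \<Rightarrow> bool"
  where "is_chart M = (\<lambda>(U, \<phi>).
    openin (mtop M) U \<and> openin (powertop_real (coords M)) (\<phi> ` U) \<and>
    homeomorphic_map (subtopology (mtop M) U)
      (subtopology (powertop_real (coords M)) (\<phi> ` U)) \<phi>)"

definition smooth_transition :: "'k set \<Rightarrow> ('a, 'k) chart \<Rightarrow> ('a, 'k) chart \<Rightarrow> bool"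
  where "smooth_transition K = (\<lambda>(U, \<phi>) (V, \<psi>).
    \<forall>k\<in>K. Cinf_on K (\<phi> ` (U \<inter> V)) (\<lambda>y. \<psi> (inv_into U \<phi> y) k))"

definition smooth_manifold :: "('a, 'k) manifold \<Rightarrow> bool"
  where "smooth_manifold M \<longleftrightarrow>
    finite (coords M) \<and> Hausdorff_space (mtop M) \<and> second_countable (mtop M) \<and>
    (\<forall>c\<in>atlas M. is_chart M c) \<and> points M = (\<Union>c\<in>atlas M. fst c) \<and>
    (\<forall>c\<in>atlas M. \<forall>c'\<in>atlas M. smooth_transition (coords M) c c')"

text \<open>The charts of the smooth structure, i.e. of the maximal atlas.\<close>

definition admissible_chart :: "('a, 'k) manifold \<Rightarrow> ('a, 'k) chart \<Rightarrow> bool"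
  where "admissible_chart M c \<longleftrightarrow> is_chart M c \<and>
    (\<forall>c'\<in>atlas M. smooth_transition (coords M) c c' \<and> smooth_transition (coords M) c' c)"

definition smooth_fun_on :: "('a, 'k) manifold \<Rightarrow> 'a set \<Rightarrow> ('a \<Rightarrow> real) \<Rightarrow> bool"
  where "smooth_fun_on M W f \<longleftrightarrow>
    (\<forall>(U, \<phi>)\<in>atlas M. Cinf_on (coords M) (\<phi> ` (U \<inter> W)) (\<lambda>y. f (inv_into U \<phi> y)))"

definition smooth_near :: "('a, 'k) manifold \<Rightarrow> 'a \<Rightarrow> ('a \<Rightarrow> real) \<Rightarrow> bool"
  where "smooth_near M p f \<longleftrightarrow> (\<exists>W. openin (mtop M) W \<and> p \<in> W \<and> smooth_fun_on M W f)"

definition smooth_map :: "('a, 'k) manifold \<Rightarrow> ('b, 'l) manifold \<Rightarrow> ('a \<Rightarrow> 'b) \<Rightarrow> bool"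
  where "smooth_map M N F \<longleftrightarrow> continuous_map (mtop M) (mtop N) F \<and>
    (\<forall>p\<in>points M. \<forall>f. smooth_near N (F p) f \<longrightarrow> smooth_near M p (\<lambda>q. f (F q)))"

definition real_line :: "(real, unit) manifold"
  where "real_line = \<lparr>mtop = euclideanreal, coords = UNIV, atlas = {(UNIV, \<lambda>s _. s)}\<rparr>"

definition mfd_times ::
    "('a, 'k) manifold \<Rightarrow> ('b, 'l) manifold \<Rightarrow> ('a \<times> 'b, 'k + 'l) manifold"
  where "mfd_times M N =
    \<lparr>mtop = prod_topology (mtop M) (mtop N),
     coords = coords M <+> coords N,
     atlas = {(U \<times> V, \<lambda>(x, y). restrict (case_sum (\<phi> x) (\<psi> y)) (coords M <+> coords N)) |
              U \<phi> V \<psi>. (U, \<phi>) \<in> atlas M \<and> (V, \<psi>) \<in> atlas N}\<rparr>"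

definition mfd_prod ::
    "'i set \<Rightarrow> ('i \<Rightarrow> ('a, 'k) manifold) \<Rightarrow> ('i \<Rightarrow> 'a, 'i \<times> 'k) manifold"
  where "mfd_prod I M =
    \<lparr>mtop = product_topology (\<lambda>i. mtop (M i)) I,
     coords = (SIGMA i:I. coords (M i)),
     atlas = {(PiE I U, \<lambda>x. \<lambda>(i, k)\<in>(SIGMA i:I. coords (M i)). \<phi> i (x i) k) |
              U \<phi>. \<forall>i\<in>I. (U i, \<phi> i) \<in> atlas (M i)}\<rparr>"


section \<open>Tangent vectors and differential forms\<close>

text \<open>
  Tangent vectors at \<open>p\<close> are derivations on germs at \<open>p\<close> of smooth functions.  They are extended
  by \<open>0\<close> to functions that are not smooth near \<open>p\<close>, so that equality of tangent vectors is equality.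
\<close>

type_synonym 'a tvec = "('a \<Rightarrow> real) \<Rightarrow> real"

definition tangent :: "('a, 'k) manifold \<Rightarrow> 'a \<Rightarrow> 'a tvec set"
  where "tangent M p = {v.
    (\<forall>f g. smooth_near M p f \<longrightarrow> smooth_near M p g \<longrightarrow>
       v (\<lambda>q. f q + g q) = v f + v g \<and>
       v (\<lambda>q. f q * g q) = f p * v g + g p * v f) \<and>
    (\<forall>f c. smooth_near M p f \<longrightarrow> v (\<lambda>q. c * f q) = c * v f) \<and>
    (\<forall>f g W. smooth_near M p f \<longrightarrow> openin (mtop M) W \<longrightarrow> p \<in> W \<longrightarrow> (\<forall>q\<in>W. f q = g q) \<longrightarrow>
       v f = v g) \<and>
    (\<forall>f. \<not> smooth_near M p f \<longrightarrow> v f = 0)}"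

definition tvec_complex :: "'a tvec \<Rightarrow> ('a \<Rightarrow> complex) \<Rightarrow> complex"
  where "tvec_complex v f = Complex (v (\<lambda>q. Re (f q))) (v (\<lambda>q. Im (f q)))"

definition coord_vec :: "('a, 'k) manifold \<Rightarrow> ('a, 'k) chart \<Rightarrow> 'a \<Rightarrow> 'k \<Rightarrow> 'a tvec"
  where "coord_vec M c p k = (\<lambda>f. if smooth_near M p f
    then partial k (\<lambda>y. f (inv_into (fst c) (snd c) y)) (snd c p) else 0)"

definition tangent_map ::
    "('a, 'k) manifold \<Rightarrow> ('b, 'l) manifold \<Rightarrow> ('a \<Rightarrow> 'b) \<Rightarrow> 'a \<Rightarrow> 'a tvec \<Rightarrow> 'b tvec"
  where "tangent_map M N F p v =
    (\<lambda>f. if smooth_near N (F p) f then v (\<lambda>q. f (F q)) else 0)"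

text \<open>
  A (complex-valued, inhomogeneous) form maps a point and a list of tangent vectors at that point to
  a number; its component of degree \<open>r\<close> is its restriction to lists of length \<open>r\<close>.  It is \<open>0\<close>
  outside this domain.  Components above the dimension vanish because forms are alternating, so the
  forms are the direct sum of the spaces of \<open>r\<close>-forms.
\<close>

type_synonym 'a form = "'a \<Rightarrow> 'a tvec list \<Rightarrow> complex"

definition forms :: "('a, 'k) manifold \<Rightarrow> 'a form set"
  where "forms M = {\<omega>.
    (\<forall>p vs. \<not> (p \<in> points M \<and> set vs \<subseteq> tangent M p) \<longrightarrow> \<omega> p vs = 0) \<and>
    (\<forall>p\<in>points M. \<forall>us ws. \<forall>v\<in>tangent M p. \<forall>w\<in>tangent M p. \<forall>a b.
       set us \<subseteq> tangent M p \<longrightarrow> set ws \<subseteq> tangent M p \<longrightarrow>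
       \<omega> p (us @ (\<lambda>f. a * v f + b * w f) # ws) =
         of_real a * \<omega> p (us @ v # ws) + of_real b * \<omega> p (us @ w # ws)) \<and>
    (\<forall>p us v vs ws. \<omega> p (us @ v # vs @ v # ws) = 0) \<and>
    (\<forall>c\<in>atlas M. \<forall>ks\<in>lists (coords M).
       smooth_fun_on M (fst c) (\<lambda>q. Re (\<omega> q (map (coord_vec M c q) ks))) \<and>
       smooth_fun_on M (fst c) (\<lambda>q. Im (\<omega> q (map (coord_vec M c q) ks))))}"

definition homogeneous_form :: "nat \<Rightarrow> 'a form \<Rightarrow> bool"
  where "homogeneous_form r \<omega> \<longleftrightarrow> (\<forall>p vs. length vs \<noteq> r \<longrightarrow> \<omega> p vs = 0)"

definition real_form :: "'a form \<Rightarrow> bool"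
  where "real_form \<omega> \<longleftrightarrow> (\<forall>p vs. \<omega> p vs \<in> \<real>)"

definition zero_form :: "('a, 'k) manifold \<Rightarrow> ('a \<Rightarrow> complex) \<Rightarrow> 'a form"
  where "zero_form M f = (\<lambda>p vs. if p \<in> points M \<and> vs = [] then f p else 0)"

text \<open>
  The wedge product is the sum over shuffles (no factorials); the shuffle that lists \<open>S\<close> first and
  then its complement has as inversions the pairs \<open>(i, j)\<close> below.
\<close>

definition wedge :: "'a form \<Rightarrow> 'a form \<Rightarrow> 'a form"
  where "wedge \<alpha> \<beta> = (\<lambda>p vs. \<Sum>S\<in>Pow {..<length vs}.
    (-1) ^ card {(i, j). i \<in> S \<and> j \<in> {..<length vs} - S \<and> j < i} *
    \<alpha> p (nths vs S) * \<beta> p (nths vs (- S)))"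

definition form_ring :: "('a, 'k) manifold \<Rightarrow> 'a form ring"
  where "form_ring M =
    \<lparr>carrier = forms M, mult = wedge, one = zero_form M (\<lambda>_. 1),
     zero = (\<lambda>_ _. 0), add = (\<lambda>\<alpha> \<beta> p vs. \<alpha> p vs + \<beta> p vs)\<rparr>"

text \<open>
  \<open>has_ext_deriv M \<omega> \<eta>\<close> says \<open>d \<omega> = \<eta>\<close>, for forms \<open>\<omega>\<close> and \<open>\<eta>\<close>.  In local coordinates
  \<open>(d\<omega>)(\<partial>\<^sub>k\<^sub>0,\<dots>,\<partial>\<^sub>k\<^sub>r) = \<Sum>\<^sub>j (-1)^j \<partial>\<^sub>k\<^sub>j (\<omega>(\<partial>\<^sub>k\<^sub>0,\<dots>,\<partial>\<^sub>k\<^sub>r))\<close> with the \<open>j\<close>-th argument omitted on the right.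
\<close>

definition has_ext_deriv :: "('a, 'k) manifold \<Rightarrow> 'a form \<Rightarrow> 'a form \<Rightarrow> bool"
  where "has_ext_deriv M \<omega> \<eta> \<longleftrightarrow>
    (\<forall>c\<in>atlas M. \<forall>p\<in>fst c. \<forall>ks\<in>lists (coords M).
       \<eta> p (map (coord_vec M c p) ks) =
         (\<Sum>j<length ks. (-1) ^ j * tvec_complex (coord_vec M c p (ks ! j))
            (\<lambda>q. \<omega> q (map (coord_vec M c q) (nths ks (- {j}))))))"

definition interior :: "('a \<Rightarrow> 'a tvec) \<Rightarrow> 'a form \<Rightarrow> 'a form"
  where "interior X \<omega> = (\<lambda>p vs. \<omega> p (X p # vs))"

definition pullback ::
    "('a, 'k) manifold \<Rightarrow> ('b, 'l) manifold \<Rightarrow> ('a \<Rightarrow> 'b) \<Rightarrow> 'b form \<Rightarrow> 'a form"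
  where "pullback M N F \<omega> = (\<lambda>p vs. if p \<in> points M \<and> set vs \<subseteq> tangent M p
    then \<omega> (F p) (map (tangent_map M N F p) vs) else 0)"


section \<open>Cohomology rings\<close>

text \<open>
  The relation \<open>D a b\<close> expresses \<open>d a = b\<close> for the differential \<open>d\<close> on the ring \<open>R\<close>.
\<close>

definition cocycle_ring ::
    "('b, 'm) ring_scheme \<Rightarrow> ('b \<Rightarrow> 'b \<Rightarrow> bool) \<Rightarrow> ('b, 'm) ring_scheme"
  where "cocycle_ring R D = R\<lparr>carrier := {a \<in> carrier R. D a \<zero>\<^bsub>R\<^esub>}\<rparr>"

definition coboundaries :: "('b, 'm) ring_scheme \<Rightarrow> ('b \<Rightarrow> 'b \<Rightarrow> bool) \<Rightarrow> 'b set"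
  where "coboundaries R D = {b \<in> carrier R. \<exists>a\<in>carrier R. D a b}"

definition cohomology_ring ::
    "('b, 'm) ring_scheme \<Rightarrow> ('b \<Rightarrow> 'b \<Rightarrow> bool) \<Rightarrow> 'b set ring"
  where "cohomology_ring R D = cocycle_ring R D Quot coboundaries R D"

definition cohomology_class ::
    "('b, 'm) ring_scheme \<Rightarrow> ('b \<Rightarrow> 'b \<Rightarrow> bool) \<Rightarrow> 'b \<Rightarrow> 'b set"
  where "cohomology_class R D a = coboundaries R D +>\<^bsub>cocycle_ring R D\<^esub> a"

abbreviation de_rham_ring :: "('a, 'k) manifold \<Rightarrow> 'a form set ring"
  where "de_rham_ring M \<equiv> cohomology_ring (form_ring M) (has_ext_deriv M)"

abbreviation de_rham_class :: "('a, 'k) manifold \<Rightarrow> 'a form \<Rightarrow> 'a form set"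
  where "de_rham_class M \<equiv> cohomology_class (form_ring M) (has_ext_deriv M)"

text \<open>
  Generation is as a complex algebra; the classes of constants are adjoined because
  \<^const>\<open>generate_ring\<close> alone yields only integer polynomials in the class of \<open>x\<close>.
\<close>

definition cohomology_generated_by :: "('a, 'k) manifold \<Rightarrow> 'a form \<Rightarrow> bool"
  where "cohomology_generated_by M x \<longleftrightarrow>
    generate_ring (de_rham_ring M)
      (insert (de_rham_class M x) (range (\<lambda>c. de_rham_class M (zero_form M (\<lambda>_. c))))) =
    carrier (de_rham_ring M)"


section \<open>Circle actions and equivariant cohomology\<close>

text \<open>
  The circle is the unit circle in the complex plane.  Its smooth structure is that of the quotient
  of the real line under \<^const>\<open>cis\<close>, so smoothness of the action map may be tested on
  \<^term>\<open>mfd_times real_line M\<close>.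
\<close>

definition circle_action :: "('a, 'k) manifold \<Rightarrow> (complex \<Rightarrow> 'a \<Rightarrow> 'a) \<Rightarrow> bool"
  where "circle_action M a \<longleftrightarrow>
    (\<forall>z\<in>sphere 0 1. \<forall>p\<in>points M. a z p \<in> points M) \<and>
    (\<forall>p\<in>points M. a 1 p = p) \<and>
    (\<forall>z\<in>sphere 0 1. \<forall>w\<in>sphere 0 1. \<forall>p\<in>points M. a (z * w) p = a z (a w p)) \<and>
    smooth_map (mfd_times real_line M) M (\<lambda>(s, p). a (cis s) p)"

definition fixed_points :: "('a, 'k) manifold \<Rightarrow> (complex \<Rightarrow> 'a \<Rightarrow> 'a) \<Rightarrow> 'a set"
  where "fixed_points M a = {p \<in> points M. \<forall>z\<in>sphere 0 1. a z p = p}"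

definition isolated_fixed_points ::
    "('a, 'k) manifold \<Rightarrow> (complex \<Rightarrow> 'a \<Rightarrow> 'a) \<Rightarrow> bool"
  where "isolated_fixed_points M a \<longleftrightarrow>
    subtopology (mtop M) (fixed_points M a) = discrete_topology (fixed_points M a)"

definition generating_field ::
    "('a, 'k) manifold \<Rightarrow> (complex \<Rightarrow> 'a \<Rightarrow> 'a) \<Rightarrow> 'a \<Rightarrow> 'a tvec"
  where "generating_field M a p =
    (\<lambda>f. if smooth_near M p f then deriv (\<lambda>s. f (a (cis s) p)) 0 else 0)"

definition diagonal_action ::
    "'i set \<Rightarrow> ('i \<Rightarrow> complex \<Rightarrow> 'a \<Rightarrow> 'a) \<Rightarrow> complex \<Rightarrow> ('i \<Rightarrow> 'a) \<Rightarrow> 'i \<Rightarrow> 'a"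
  where "diagonal_action I a = (\<lambda>z x. \<lambda>i\<in>I. a i z (x i))"

definition invariant_forms ::
    "('a, 'k) manifold \<Rightarrow> (complex \<Rightarrow> 'a \<Rightarrow> 'a) \<Rightarrow> 'a form set"
  where "invariant_forms M a = {\<omega> \<in> forms M. \<forall>z\<in>sphere 0 1. pullback M M (a z) \<omega> = \<omega>}"

definition moment_map ::
    "('a, 'k) manifold \<Rightarrow> (complex \<Rightarrow> 'a \<Rightarrow> 'a) \<Rightarrow> 'a form \<Rightarrow> ('a \<Rightarrow> real) \<Rightarrow> bool"
  where "moment_map M a x \<mu> \<longleftrightarrow> smooth_fun_on M (points M) \<mu> \<and>
    has_ext_deriv M (zero_form M (\<lambda>p. of_real (\<mu> p))) (interior (generating_field M a) x)"

text \<open>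
  Cartan model: polynomials in \<open>t\<close> over the invariant forms, with the differential
  \<open>d - t \<iota>\<^sub>\<xi>\<close>, for which \<open>x + t \<mu>\<close> is closed if \<open>d x = 0\<close> and \<open>\<iota>\<^sub>\<xi> x = d \<mu>\<close>.  The relation
  \<open>cartan_deriv M a \<alpha> \<beta>\<close> spells out \<open>d \<alpha>\<^sub>n = \<beta>\<^sub>n + \<iota>\<^sub>\<xi> \<alpha>\<^sub>n\<^sub>-\<^sub>1\<close> for all coefficients.
\<close>

definition cartan_ring ::
    "('a, 'k) manifold \<Rightarrow> (complex \<Rightarrow> 'a \<Rightarrow> 'a) \<Rightarrow> ('a form, nat \<Rightarrow> 'a form) up_ring"
  where "cartan_ring M a = UP ((form_ring M)\<lparr>carrier := invariant_forms M a\<rparr>)"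

definition cartan_deriv ::
    "('a, 'k) manifold \<Rightarrow> (complex \<Rightarrow> 'a \<Rightarrow> 'a) \<Rightarrow>
     (nat \<Rightarrow> 'a form) \<Rightarrow> (nat \<Rightarrow> 'a form) \<Rightarrow> bool"
  where "cartan_deriv M a \<alpha> \<beta> \<longleftrightarrow>
    has_ext_deriv M (\<alpha> 0) (\<beta> 0) \<and>
    (\<forall>n. has_ext_deriv M (\<alpha> (Suc n))
       (\<lambda>p vs. \<beta> (Suc n) p vs + interior (generating_field M a) (\<alpha> n) p vs))"

abbreviation equiv_cohomology ::
    "('a, 'k) manifold \<Rightarrow> (complex \<Rightarrow> 'a \<Rightarrow> 'a) \<Rightarrow> (nat \<Rightarrow> 'a form) set ring"
  where "equiv_cohomology M a \<equiv> cohomology_ring (cartan_ring M a) (cartan_deriv M a)"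

abbreviation equiv_class ::
    "('a, 'k) manifold \<Rightarrow> (complex \<Rightarrow> 'a \<Rightarrow> 'a) \<Rightarrow> (nat \<Rightarrow> 'a form) \<Rightarrow> (nat \<Rightarrow> 'a form) set"
  where "equiv_class M a \<equiv> cohomology_class (cartan_ring M a) (cartan_deriv M a)"

text \<open>
  Restriction to a fixed point, with values in the polynomials in \<open>t\<close>; only components of form
  degree \<open>0\<close> survive.  Equivariantly exact forms restrict to \<open>0\<close>, so all representatives of
  a class have the same restriction.
\<close>

definition restrict_form :: "'a \<Rightarrow> (nat \<Rightarrow> 'a form) \<Rightarrow> complex poly"
  where "restrict_form p \<alpha> = (\<Sum>n | \<alpha> n p [] \<noteq> 0. Polynomial.monom (\<alpha> n p []) n)"

definition restrict_class :: "'a \<Rightarrow> (nat \<Rightarrow> 'a form) set \<Rightarrow> complex poly"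
  where "restrict_class p c = the_elem (restrict_form p ` c)"

definition vanishing_ideal ::
    "('a, 'k) manifold \<Rightarrow> (complex \<Rightarrow> 'a \<Rightarrow> 'a) \<Rightarrow> 'a set \<Rightarrow> (nat \<Rightarrow> 'a form) set set"
  where "vanishing_ideal M a S =
    {c \<in> carrier (equiv_cohomology M a). \<forall>p\<in>fixed_points M a \<inter> S. restrict_class p c = 0}"


section \<open>Morse-Bott functions\<close>

definition critical_points :: "('a, 'k) manifold \<Rightarrow> ('a \<Rightarrow> real) \<Rightarrow> 'a set"
  where "critical_points M f = {p \<in> points M. \<forall>v\<in>tangent M p. v f = 0}"

definition regular_value :: "('a, 'k) manifold \<Rightarrow> ('a \<Rightarrow> real) \<Rightarrow> real \<Rightarrow> bool"
  where "regular_value M f c \<longleftrightarrow> (\<forall>p\<in>points M. f p = c \<longrightarrow> p \<notin> critical_points M f)"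

text \<open>
  Around each critical point the critical set is a submanifold, i.e. given by fixing
  the coordinates in some \<open>L\<close> (possibly all) of a suitable chart, and the Hessian is nondegenerate in the
  normal directions, i.e. those of the coordinates in \<open>L\<close>.
\<close>

definition morse_bott :: "('a, 'k) manifold \<Rightarrow> ('a \<Rightarrow> real) \<Rightarrow> bool"
  where "morse_bott M f \<longleftrightarrow> smooth_fun_on M (points M) f \<and>
    (\<forall>p\<in>critical_points M f. \<exists>U \<phi> L.
       admissible_chart M (U, \<phi>) \<and> p \<in> U \<and> L \<subseteq> coords M \<and>
       critical_points M f \<inter> U = {q \<in> U. \<forall>k\<in>L. \<phi> q k = \<phi> p k} \<and>
       (\<forall>v. (\<forall>k\<in>L. (\<Sum>l\<in>L. partial k (partial l (\<lambda>y. f (inv_into U \<phi> y))) (\<phi> p) * v l) = 0)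
            \<longrightarrow> (\<forall>l\<in>L. v l = 0)))"


section \<open>The polynomial ring and its evaluation\<close>

text \<open>
  Polynomials are finitely supported maps from monomials to coefficients.  Variable \<open>0\<close>
  is \<open>t\<close>, and the variables \<open>1, \<dots>, m\<close> are the \<open>x\<^sub>i\<close> (with tilde).
\<close>

type_synonym mpolynomial = "(nat \<Rightarrow>\<^sub>0 nat) \<Rightarrow>\<^sub>0 complex"

definition mvar :: "nat \<Rightarrow> mpolynomial"
  where "mvar i = Poly_Mapping.single (Poly_Mapping.single i 1) 1"

definition mconst :: "complex \<Rightarrow> mpolynomial"
  where "mconst c = Poly_Mapping.single 0 c"

definition poly_ring :: "nat \<Rightarrow> mpolynomial ring"
  where "poly_ring m =
    \<lparr>carrier = {f. \<forall>e\<in>Poly_Mapping.keys f. Poly_Mapping.keys e \<subseteq> {0..m}},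
     mult = (*), one = 1, zero = 0, add = (+)\<rparr>"

text \<open>
  Evaluation at ring elements \<open>v 0, \<dots>, v m\<close> with scalars embedded by \<open>s\<close>.  The product is
  written as an ordered one because the ring of all forms is only graded commutative.
\<close>

definition mpoly_eval ::
    "('b, 'm) ring_scheme \<Rightarrow> (complex \<Rightarrow> 'b) \<Rightarrow> (nat \<Rightarrow> 'b) \<Rightarrow> nat \<Rightarrow> mpolynomial \<Rightarrow> 'b"
  where "mpoly_eval R s v m f =
    (\<Oplus>\<^bsub>R\<^esub>e\<in>Poly_Mapping.keys f. s (Poly_Mapping.lookup f e) \<otimes>\<^bsub>R\<^esub>
       foldr (\<lambda>i r. (v i [^]\<^bsub>R\<^esub> Poly_Mapping.lookup e i) \<otimes>\<^bsub>R\<^esub> r) [0..<Suc m] \<one>\<^bsub>R\<^esub>)"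

definition cartan_const ::
    "('a, 'k) manifold \<Rightarrow> (complex \<Rightarrow> 'a \<Rightarrow> 'a) \<Rightarrow> complex \<Rightarrow> nat \<Rightarrow> 'a form"
  where "cartan_const M a c = up_ring.monom (cartan_ring M a) (zero_form M (\<lambda>_. c)) 0"

definition cartan_t ::
    "('a, 'k) manifold \<Rightarrow> (complex \<Rightarrow> 'a \<Rightarrow> 'a) \<Rightarrow> nat \<Rightarrow> 'a form"
  where "cartan_t M a = up_ring.monom (cartan_ring M a) (zero_form M (\<lambda>_. 1)) 1"

definition equiv_extension ::
    "('a, 'k) manifold \<Rightarrow> (complex \<Rightarrow> 'a \<Rightarrow> 'a) \<Rightarrow> 'a form \<Rightarrow> ('a \<Rightarrow> real) \<Rightarrow> nat \<Rightarrow> 'a form"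
  where "equiv_extension M a x \<mu> =
    up_ring.monom (cartan_ring M a) x 0 \<oplus>\<^bsub>cartan_ring M a\<^esub>
    up_ring.monom (cartan_ring M a) (zero_form M (\<lambda>p. of_real (\<mu> p))) 1"

text \<open>
  The ring homomorphism from the polynomial ring to equivariant cohomology that sends \<open>t\<close> to the
  class of \<open>t\<close> and the \<open>i\<close>-th variable to the class of \<open>x\<^sub>i + t \<mu>\<^sub>i\<close>: the class of the polynomial
  evaluated at these cocycles.
\<close>

definition eta ::
    "('a, 'k) manifold \<Rightarrow> (complex \<Rightarrow> 'a \<Rightarrow> 'a) \<Rightarrow> (nat \<Rightarrow> 'a form) \<Rightarrow> (nat \<Rightarrow> 'a \<Rightarrow> real) \<Rightarrow>
     nat \<Rightarrow> mpolynomial \<Rightarrow> (nat \<Rightarrow> 'a form) set"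
  where "eta M a x \<mu> m f = equiv_class M a
    (mpoly_eval (cocycle_ring (cartan_ring M a) (cartan_deriv M a)) (cartan_const M a)
       (\<lambda>i. if i = 0 then cartan_t M a else equiv_extension M a (x i) (\<mu> i)) m f)"


section \<open>Coverings\<close>

definition index_set :: "nat \<Rightarrow> (nat \<Rightarrow> nat) \<Rightarrow> (nat \<Rightarrow> nat) set"
  where "index_set m n = (\<Pi>\<^sub>E i\<in>{1..m}. {1..n i})"

definition large_set :: "nat \<Rightarrow> (nat \<Rightarrow> nat) \<Rightarrow> (nat \<Rightarrow> nat \<Rightarrow> real) \<Rightarrow> (nat \<Rightarrow> nat) set"
  where "large_set m n \<theta> = {J \<in> index_set m n. (\<Sum>i\<in>{1..m}. \<theta> i (J i)) > 0}"

definition small_set :: "nat \<Rightarrow> (nat \<Rightarrow> nat) \<Rightarrow> (nat \<Rightarrow> nat \<Rightarrow> real) \<Rightarrow> (nat \<Rightarrow> nat) set"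
  where "small_set m n \<theta> = {J \<in> index_set m n. (\<Sum>i\<in>{1..m}. \<theta> i (J i)) < 0}"

definition covering ::
    "nat \<Rightarrow> (nat \<Rightarrow> nat) \<Rightarrow> (nat \<Rightarrow> nat) set \<Rightarrow> (nat \<Rightarrow> nat set) \<Rightarrow> bool"
  where "covering m n S A \<longleftrightarrow> (\<forall>i\<in>{1..m}. A i \<subseteq> {1..n i}) \<and>
    S \<subseteq> (\<Union>i\<in>{1..m}. {J \<in> index_set m n. J i \<in> A i})"

definition minimal_covering ::
    "nat \<Rightarrow> (nat \<Rightarrow> nat) \<Rightarrow> (nat \<Rightarrow> nat) set \<Rightarrow> (nat \<Rightarrow> nat set) \<Rightarrow> bool"
  where "minimal_covering m n S A \<longleftrightarrow> covering m n S A \<and>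
    (\<forall>i\<in>{1..m}. \<forall>j\<in>A i. \<not> covering m n S (A(i := A i - {j})))"

definition covering_poly ::
    "nat \<Rightarrow> (nat \<Rightarrow> nat \<Rightarrow> real) \<Rightarrow> (nat \<Rightarrow> nat set) \<Rightarrow> mpolynomial"
  where "covering_poly m \<theta> A =
    (\<Prod>i\<in>{1..m}. \<Prod>j\<in>A i. mvar i - mconst (of_real (\<theta> i j)) * mvar 0)"

end

theory Submission
  imports Defs
begin

text \<open>
  The invariant forms \<open>x\<^sub>i + t \<mu>\<^sub>i\<close> are equivariant cocycles on the product, and a class restricts to a fixed
  point through its components of form degree \<open>0\<close>. Hence restricting \<open>\<eta>(f)\<close> to \<open>F(J)\<close> means evaluating
  \<open>f\<close> on the line spanned by \<open>(1, \<theta>\<^sub>1\<^sub>,\<^sub>j\<^sub>1, \<dots>, \<theta>\<^sub>m\<^sub>,\<^sub>j\<^sub>m)\<close>, and the preimage of \<open>K\<^sub>+\<close> (of \<open>K\<^sub>-\<close>) is the ideal of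
  polynomials that vanish on the lines of \<open>\<L>\<close> (of \<open>\<S>\<close>). These index sets are upper sets once each coordinate is ordered by
  \<open>\<theta>\<^sub>i\<close> (by \<open>-\<theta>\<^sub>i\<close>). For an upper set, the products over tuples of upper sets of the coordinates
  form a Newton basis: a product belonging to a covering lies in the ideal generated by the minimal
  coverings, and the others are triangular with respect to evaluation on the lines, so a vanishing
  polynomial has no components along them.
\<close>

section \<open>Calculus in coordinates\<close>

text \<open>\<open>eta f\<close> is a class in equivariant cohomology only if the evaluated
  polynomial is a cocycle, and most of the work goes into that. \<open>has_ext_deriv\<close>
  prescribes d only on coordinate vectors, and the product atlas consists of product charts; so
  wedge, d and pullback are computed on lists of coordinate indices, by recursions that peel off the
  first argument. These make d and contraction antiderivations with the same sign, so cocycles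
  multiply. Invariance of \<mu>_i, which puts t \<mu>_i into the Cartan model, comes from x_i(X, X)
  = 0 along orbits. On the algebraic side, the index sets are upper sets because the sum of the
  \<theta> values is monotone. This is used twice. For a tuple A of segments that is not a covering,
  the coordinatewise greatest indices outside A form a tuple in the index set, so they label a line
  on which the given polynomial vanishes. Adjoining such an index to A gives segments again, so
  multiplication by x_i stays among the Newton polynomials: x_i N_A is the polynomial of the
  enlarged tuple plus \<theta> t N_A.\<close>

lemma openin_powertop_box:
  assumes "finite K" "openin (powertop_real K) V" "y \<in> V"
  obtains d where "d > 0" "\<And>z. z \<in> extensional K \<Longrightarrow> (\<And>k. k \<in> K \<Longrightarrow> \<bar>z k - y k\<bar> < d) \<Longrightarrow> z \<in> V"
proof -
  obtain X where X: "finite {i \<in> K. X i \<noteq> UNIV}" "\<And>i. i \<in> K \<Longrightarrow> open (X i)" "y \<in> Pi\<^sub>E K X" "Pi\<^sub>E K X \<subseteq> V"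
    using assms(2,3) unfolding openin_product_topology_alt by auto
  have "\<exists>d>0. \<forall>s. \<bar>s - y k\<bar> < d \<longrightarrow> s \<in> X k" if "k \<in> K" for k
  proof -
    have "y k \<in> X k" using X(3) that by auto
    then show ?thesis using X(2)[OF that] unfolding open_dist dist_real_def by auto
  qed
  then obtain d where d: "\<And>k. k \<in> K \<Longrightarrow> d k > 0" "\<And>k s. k \<in> K \<Longrightarrow> \<bar>s - y k\<bar> < d k \<Longrightarrow> s \<in> X k"
    by metis
  \<comment> \<open>Inserting 1 keeps the minimum defined when \<open>K\<close> is empty.\<close>
  define e where "e = Min (insert 1 (d ` K))"
  have "e > 0" unfolding e_def using assms(1) d(1) by auto
  moreover have "z \<in> V" if z: "z \<in> extensional K" "\<And>k. k \<in> K \<Longrightarrow> \<bar>z k - y k\<bar> < e" for z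
  proof -
    have "e \<le> d k" if "k \<in> K" for k unfolding e_def using assms(1) that by auto
    then have "z k \<in> X k" if "k \<in> K" for k using z(2)[OF that] d(2)[OF that] that by fastforce
    then have "z \<in> Pi\<^sub>E K X" using z(1) by (simp add: PiE_iff)
    then show ?thesis using X(4) by blast
  qed
  ultimately show ?thesis using that by blast
qed

lemma openin_powertop_extensional: "openin (powertop_real K) V \<Longrightarrow> y \<in> V \<Longrightarrow> y \<in> extensional K"
  using openin_subset by (fastforce simp: PiE_iff)

text \<open>Makes \<open>partial\<close> local: near \<open>y k\<close> the coordinate line through
  \<open>y\<close> stays in the open set, so only values on that set matter.\<close>

lemma eventually_fun_upd_mem:
  assumes "finite K" "openin (powertop_real K) V" "y \<in> V" "k \<in> K"
  shows "\<forall>\<^sub>F s in nhds (y k). y(k := s) \<in> V"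
proof -
  obtain d where d: "d > 0" "\<And>z. z \<in> extensional K \<Longrightarrow> (\<And>k. k \<in> K \<Longrightarrow> \<bar>z k - y k\<bar> < d) \<Longrightarrow> z \<in> V"
    using openin_powertop_box[OF assms(1-3)] by blast
  have "y \<in> extensional K" using assms openin_powertop_extensional by blast
  then have "y(k := s) \<in> V" if "dist s (y k) < d" for s
    using d that assms(4) by (intro d(2)) (auto simp: extensional_def dist_real_def)
  then show ?thesis using d(1) unfolding eventually_nhds_metric by blast
qed

lemma partial_cong:
  assumes "finite K" "openin (powertop_real K) V" "y \<in> V" "k \<in> K" "\<And>z. z \<in> V \<Longrightarrow> f z = g z"
  shows "partial k f y = partial k g y"
  unfolding partial_def
  by (rule deriv_cong_ev) (use eventually_mono[OF eventually_fun_upd_mem[OF assms(1-4)]] assms(5) in auto)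

lemma differentiable_cong_ev:
  fixes f g :: "real \<Rightarrow> real"
  assumes "\<forall>\<^sub>F s in nhds t. f s = g s" "f differentiable at t"
  shows "g differentiable at t"
proof -
  obtain D where "(f has_real_derivative D) (at t)" using assms(2) real_differentiable_def by blast
  then have "(g has_real_derivative D) (at t)" using assms(1) DERIV_cong_ev[of t t f g D D] by simp
  then show ?thesis using real_differentiable_def by blast
qed

lemma Ck_on_continuous:
  "Ck_on K r V g \<Longrightarrow> continuous_map (subtopology (powertop_real K) V) euclideanreal g"
  by (cases r) auto

lemma Ck_on_cong:
  assumes "finite K" "openin (powertop_real K) V" "\<And>z. z \<in> V \<Longrightarrow> f z = g z" "Ck_on K r V f"
  shows "Ck_on K r V g"
  using assms(3,4)
proof (induction r arbitrary: f g)
  case 0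
  then show ?case using continuous_map_eq[of "subtopology (powertop_real K) V" euclideanreal f g] by auto
next
  case (Suc r)
  have "(\<lambda>s. g (y(k := s))) differentiable (at (y k))" if "y \<in> V" "k \<in> K" for y k
  proof (rule differentiable_cong_ev)
    show "\<forall>\<^sub>F s in nhds (y k). f (y(k := s)) = g (y(k := s))"
      using eventually_fun_upd_mem[OF assms(1,2) that] by eventually_elim (rule Suc.prems(1))
    show "(\<lambda>s. f (y(k := s))) differentiable (at (y k))" using Suc.prems(2) that by simp
  qed
  moreover have "Ck_on K r V (partial k g)" if "k \<in> K" for k
    using Suc.prems(2) that Suc.IH[of "partial k f" "partial k g"]
      partial_cong[OF assms(1,2) _ that Suc.prems(1), of _] by simp
  moreover have "continuous_map (subtopology (powertop_real K) V) euclideanreal g"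
    using Suc.prems continuous_map_eq[of "subtopology (powertop_real K) V" euclideanreal f g] by auto
  ultimately show ?case by simp
qed

lemma Ck_on_Suc_imp: "Ck_on K (Suc r) V g \<Longrightarrow> Ck_on K r V g"
  by (induction r arbitrary: g) auto

lemma Ck_on_subset: "V' \<subseteq> V \<Longrightarrow> Ck_on K r V g \<Longrightarrow> Ck_on K r V' g"
  by (induction r arbitrary: g) (auto dest: continuous_map_from_subtopology_mono)

lemma partial_const: "partial k (\<lambda>_. c) y = 0"
  by (simp add: partial_def)

lemma Ck_on_const: "Ck_on K r V (\<lambda>_. c)"
proof (induction r arbitrary: c)
  case (Suc r)
  have "partial k (\<lambda>_. c) = (\<lambda>_. 0)" for k :: 'a by (rule ext) (simp add: partial_const)
  then show ?case using Suc by simp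
qed simp

lemma Ck_on_coord: 
  assumes "k \<in> K" shows "Ck_on K r V (\<lambda>y. y k)"
proof -
  have c: "continuous_map (subtopology (powertop_real K) V) euclideanreal (\<lambda>y. y k)"
    using assms by (intro continuous_map_from_subtopology continuous_map_product_projection)
  have p: "partial l (\<lambda>y. y k) = (\<lambda>_. if l = k then 1 else 0)" for l
    by (rule ext) (simp add: partial_def)
  have d: "(\<lambda>s. (y(l := s)) k) differentiable (at (y l))" for y :: "'a \<Rightarrow> real" and l
    by (cases "l = k") auto
  show ?thesis
    by (cases r) (simp_all add: c p Ck_on_const d del: fun_upd_apply)
qed

lemma
  assumes "finite K" "openin (powertop_real K) V" "Ck_on K (Suc 0) V f" "Ck_on K (Suc 0) V g" "y \<in> V" "k \<in> K"
  shows partial_add: "partial k (\<lambda>z. f z + g z) y = partial k f y + partial k g y"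
    and partial_mult: "partial k (\<lambda>z. f z * g z) y = f y * partial k g y + g y * partial k f y"
proof -
  have d: "((\<lambda>s. f (y(k:=s))) has_real_derivative partial k f y) (at (y k))"
     "((\<lambda>s. g (y(k:=s))) has_real_derivative partial k g y) (at (y k))"
    using assms unfolding partial_def by (auto simp: DERIV_deriv_iff_real_differentiable)
  show "partial k (\<lambda>z. f z + g z) y = partial k f y + partial k g y"
    unfolding partial_def[of k "\<lambda>z. f z + g z"] by (rule DERIV_imp_deriv) (rule DERIV_add[OF d])
  show "partial k (\<lambda>z. f z * g z) y = f y * partial k g y + g y * partial k f y"
    unfolding partial_def[of k "\<lambda>z. f z * g z"] by (rule DERIV_imp_deriv) (use DERIV_mult[OF d] in \<open>simp add: algebra_simps\<close>)
qed

lemma Ck_on_add: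
  assumes K: "finite K" "openin (powertop_real K) V" and "Ck_on K r V f" "Ck_on K r V g"
  shows "Ck_on K r V (\<lambda>y. f y + g y)"
  using assms(3,4)
proof (induction r arbitrary: f g)
  case (Suc r)
  have *: "Ck_on K (Suc 0) V f" "Ck_on K (Suc 0) V g" using Suc.prems by (auto simp: Ck_on_continuous)
  have "Ck_on K r V (partial k (\<lambda>y. f y + g y))" if "k \<in> K" for k
    by (rule Ck_on_cong[OF K, of "\<lambda>y. partial k f y + partial k g y"])
      (use Suc that partial_add[OF K * _ that] in auto)
  then show ?case using Suc.prems by (auto intro: continuous_map_add)
qed (auto intro: continuous_map_add)

lemma Ck_on_mult:
  assumes K: "finite K" "openin (powertop_real K) V" and "Ck_on K r V f" "Ck_on K r V g"
  shows "Ck_on K r V (\<lambda>y. f y * g y)"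
  using assms(3,4)
proof (induction r arbitrary: f g)
  case (Suc r)
  have *: "Ck_on K (Suc 0) V f" "Ck_on K (Suc 0) V g" using Suc.prems by (auto simp: Ck_on_continuous)
  have **: "Ck_on K r V f" "Ck_on K r V g" using Suc.prems Ck_on_Suc_imp by blast+
  have "Ck_on K r V (partial k (\<lambda>y. f y * g y))" if "k \<in> K" for k
    by (rule Ck_on_cong[OF K, of "\<lambda>y. f y * partial k g y + g y * partial k f y"])
      (use Suc that partial_mult[OF K * _ that] ** in \<open>auto intro!: Ck_on_add[OF K]\<close>)
  then show ?case using Suc.prems by (auto intro: continuous_map_real_mult)
qed (auto intro: continuous_map_real_mult)

text \<open>The two orders of the endpoints and the case u = v are merged, because the increment of
  a coordinate along a curve can have either sign or be zero.\<close>

lemma MVT_abs: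
  fixes f f' :: "real \<Rightarrow> real"
  assumes "\<And>r. \<bar>r - u\<bar> \<le> \<bar>v - u\<bar> \<Longrightarrow> (f has_real_derivative f' r) (at r)"
  obtains z where "\<bar>z - u\<bar> \<le> \<bar>v - u\<bar>" "f v - f u = (v - u) * f' z"
proof (cases u v rule: linorder_cases)
  case less
  then obtain z where "u < z" "z < v" "f v - f u = (v - u) * f' z"
    using MVT2[OF less, of f f'] assms by auto
  then show ?thesis using that[of z] less by auto
next
  case greater
  then obtain z where "v < z" "z < u" "f u - f v = (u - v) * f' z"
    using MVT2[OF greater, of f f'] assms by auto
  then show ?thesis using that[of z] greater by (auto simp: algebra_simps)
qed (use that in auto)

text \<open>The coordinates are switched on one at a time, and the mean value theorem is applied to each.\<close>

lemma DERIV_along_curve: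
  fixes \<gamma> :: "real \<Rightarrow> 'k \<Rightarrow> real"
  assumes K: "finite K" "openin (powertop_real K) V" and V: "\<gamma> t \<in> V"
    and g: "Ck_on K (Suc 0) V g"
    and \<gamma>: "\<And>k. k \<in> K \<Longrightarrow> ((\<lambda>s. \<gamma> s k) has_real_derivative c k) (at t)"
    and ext: "\<forall>\<^sub>F s in nhds t. \<gamma> s \<in> extensional K"
  shows "((\<lambda>s. g (\<gamma> s)) has_real_derivative (\<Sum>k\<in>K. c k * partial k g (\<gamma> t))) (at t)"
proof -
  define u where "u = (\<lambda>L s. \<lambda>k\<in>K. if k \<in> L then \<gamma> s k else \<gamma> t k)"
  have yext: "\<gamma> t \<in> extensional K" using V K openin_powertop_extensional by blast
  have u0: "u L t = \<gamma> t" for L using yext by (auto simp: u_def extensional_def fun_eq_iff)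
  have near: "\<forall>\<^sub>F s in nhds t. \<forall>k\<in>K. \<bar>\<gamma> s k - \<gamma> t k\<bar> < d" if "d > 0" for d
  proof (rule eventually_ball_finite[OF K(1)], rule ballI)
    fix k assume k: "k \<in> K"
    have "((\<lambda>s. \<gamma> s k) \<longlongrightarrow> \<gamma> t k) (nhds t)" 
      using DERIV_isCont[OF \<gamma>[OF k]] isCont_def tendsto_at_iff_tendsto_nhds by blast
    then show "\<forall>\<^sub>F s in nhds t. \<bar>\<gamma> s k - \<gamma> t k\<bar> < d" using tendstoD[OF _ that] by (fastforce simp: dist_real_def)
  qed
  have "((\<lambda>s. g (u L s)) has_real_derivative (\<Sum>k\<in>L. c k * partial k g (\<gamma> t))) (at t)" if "L \<subseteq> K" for L
    using finite_subset[OF that K(1)] that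
  proof (induction L rule: finite_induct)
    case empty
    then show ?case by (simp add: u_def)
  next
    case (insert k L)
    then have k: "k \<in> K" "k \<notin> L" by auto
    obtain d where d: "d > 0" "\<And>z. z \<in> extensional K \<Longrightarrow> (\<And>k. k \<in> K \<Longrightarrow> \<bar>z k - \<gamma> t k\<bar> < d) \<Longrightarrow> z \<in> V"
      using openin_powertop_box[OF K V] by blast
    have uk: "(u L s)(k := \<gamma> s k) = u (insert k L) s" "(u L s)(k := \<gamma> t k) = u L s" for s
      using k by (auto simp: u_def)
    have gd: "((\<lambda>r. g (z(k:=r))) has_real_derivative partial k g (z(k:=r))) (at r)" if "z(k := r) \<in> V" for z r
      using g that k(1) unfolding partial_def by (auto simp: DERIV_deriv_iff_real_differentiable dest!: bspec[where x="z(k:=r)"])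
    have mem: "(u L s)(k := r) \<in> extensional K" for s r using k by (auto simp: u_def extensional_def)
    have ex: "\<exists>\<xi>. \<bar>\<xi> - \<gamma> t k\<bar> \<le> \<bar>\<gamma> s k - \<gamma> t k\<bar> \<and>
      g (u (insert k L) s) - g (u L s) = (\<gamma> s k - \<gamma> t k) * partial k g ((u L s)(k := \<xi>))"
      if s: "\<forall>k\<in>K. \<bar>\<gamma> s k - \<gamma> t k\<bar> < d" for s
    proof -
      have "(u L s)(k := r) \<in> V" if "\<bar>r - \<gamma> t k\<bar> \<le> \<bar>\<gamma> s k - \<gamma> t k\<bar>" for r
        by (rule d(2)[OF mem]) (use that s k d(1) in \<open>auto simp: u_def\<close>)
      then show ?thesis
        using MVT_abs[of "\<gamma> t k" "\<gamma> s k" "\<lambda>r. g ((u L s)(k := r))" "\<lambda>r. partial k g ((u L s)(k := r))"] gd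
        unfolding uk by metis
    qed
    then obtain \<xi> where \<xi>: "\<And>s. \<forall>k\<in>K. \<bar>\<gamma> s k - \<gamma> t k\<bar> < d \<Longrightarrow> \<bar>\<xi> s - \<gamma> t k\<bar> \<le> \<bar>\<gamma> s k - \<gamma> t k\<bar> \<and>
      g (u (insert k L) s) - g (u L s) = (\<gamma> s k - \<gamma> t k) * partial k g ((u L s)(k := \<xi> s))"
      by metis
    \<comment> \<open>The partial derivative at the intermediate point. That point lies in any given
      cube around \<open>\<gamma> t\<close> once \<open>s\<close> is close to \<open>t\<close>, so
      \<open>h\<close> is continuous at \<open>t\<close> although \<open>\<xi>\<close> is merely
      chosen pointwise.\<close>
    define h where "h = (\<lambda>s. partial k g ((u L s)(k := \<xi> s)))"
    have ht: "h t = partial k g (\<gamma> t)" using \<xi>[of t] d(1) yext by (simp add: h_def u0)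
    have "(h \<longlongrightarrow> partial k g (\<gamma> t)) (nhds t)"
    proof (rule tendstoI)
      fix e :: real assume e: "e > 0"
      have "continuous_map (subtopology (powertop_real K) V) euclideanreal (partial k g)" using g k by simp
      then have "openin (subtopology (powertop_real K) V) 
          {z \<in> topspace (subtopology (powertop_real K) V). partial k g z \<in> ball (partial k g (\<gamma> t)) e}"
        by (rule openin_continuous_map_preimage) simp
      then have "openin (powertop_real K) {z \<in> topspace (subtopology (powertop_real K) V). partial k g z \<in> ball (partial k g (\<gamma> t)) e}"
        using K(2) openin_trans_full by blast
      moreover have "\<gamma> t \<in> {z \<in> topspace (subtopology (powertop_real K) V). partial k g z \<in> ball (partial k g (\<gamma> t)) e}"
        using V e yext by (auto simp: PiE_iff)
      ultimately obtain d' where d': "d' > 0" "\<And>z. z \<in> extensional K \<Longrightarrow> (\<And>k. k \<in> K \<Longrightarrow> \<bar>z k - \<gamma> t k\<bar> < d') \<Longrightarrow> 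
          dist (partial k g (\<gamma> t)) (partial k g z) < e"
        using openin_powertop_box[OF K(1)] by (metis (no_types, lifting) mem_Collect_eq mem_ball)
      have "dist (h s) (partial k g (\<gamma> t)) < e" if s: "\<forall>k\<in>K. \<bar>\<gamma> s k - \<gamma> t k\<bar> < min d d'" for s
      proof -
        have "\<bar>\<xi> s - \<gamma> t k\<bar> < d'" using \<xi>[of s] s k by fastforce
        then have "dist (partial k g (\<gamma> t)) (partial k g ((u L s)(k := \<xi> s))) < e"
          using d'(1) s by (intro d'(2)[OF mem]) (auto simp: u_def)
        then show ?thesis by (simp add: h_def dist_commute)
      qed
      then show "\<forall>\<^sub>F s in nhds t. dist (h s) (partial k g (\<gamma> t)) < e"
        using near[of "min d d'"] d d' by (auto elim: eventually_mono)
    qed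
    then have hc: "isCont h t" using ht unfolding isCont_def tendsto_at_iff_tendsto_nhds by simp
    \<comment> \<open>In Caratheodory's form the increment is \<open>q s * h s * (s - t)\<close>
      with a factor continuous at \<open>t\<close>, so its derivative is the value of that factor at
      \<open>t\<close>.\<close>
    obtain q where q: "\<And>s. \<gamma> s k - \<gamma> t k = q s * (s - t)" "isCont q t" "q t = c k"
      using \<gamma>[OF k(1)] unfolding CARAT_DERIV by blast
    have "((\<lambda>s. q s * h s * (s - t)) has_real_derivative c k * partial k g (\<gamma> t)) (at t)"
      unfolding CARAT_DERIV by (rule exI[of _ "\<lambda>s. q s * h s"]) (use q hc ht in \<open>auto intro!: continuous_intros\<close>)
    moreover have "\<forall>\<^sub>F s in nhds t. q s * h s * (s - t) = g (u (insert k L) s) - g (u L s)"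
      using near[OF d(1)]
    proof (rule eventually_mono)
      fix s assume "\<forall>k\<in>K. \<bar>\<gamma> s k - \<gamma> t k\<bar> < d"
      then have "g (u (insert k L) s) - g (u L s) = (\<gamma> s k - \<gamma> t k) * h s"
        using \<xi>[of s] by (simp add: h_def)
      then show "q s * h s * (s - t) = g (u (insert k L) s) - g (u L s)" using q(1)[of s] by simp
    qed
    ultimately have "((\<lambda>s. g (u (insert k L) s) - g (u L s)) has_real_derivative c k * partial k g (\<gamma> t)) (at t)"
      using DERIV_cong_ev[of t t "\<lambda>s. q s * h s * (s - t)" "\<lambda>s. g (u (insert k L) s) - g (u L s)"] by auto
    from DERIV_add[OF this insert.IH] show ?case using insert by simp
  qed
  from this[of K] have "((\<lambda>s. g (u K s)) has_real_derivative (\<Sum>k\<in>K. c k * partial k g (\<gamma> t))) (at t)" by simp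
  \<comment> \<open>\<open>u K s\<close> is \<open>\<gamma> s\<close> cut down to \<open>K\<close>;
    near \<open>t\<close> the curve is extensional, so the two agree.\<close>
  moreover have "\<forall>\<^sub>F s in nhds t. g (u K s) = g (\<gamma> s)"
    using ext by eventually_elim (auto simp: u_def extensional_def intro!: arg_cong[where f=g])
  ultimately show ?thesis
    using DERIV_cong_ev[of t t "\<lambda>s. g (u K s)" "\<lambda>s. g (\<gamma> s)"] by auto
qed

section \<open>The chain rule and locality for functions of class C^r\<close>

lemma Ck_on_sum:
  assumes "finite K" "openin (powertop_real K) V" "finite A" "\<And>i. i \<in> A \<Longrightarrow> Ck_on K r V (f i)"
  shows "Ck_on K r V (\<lambda>y. \<Sum>i\<in>A. f i y)"
  using assms(3,4) by (induction A rule: finite_induct) (auto intro: Ck_on_const Ck_on_add[OF assms(1,2)])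

text \<open>Induction on the order works because the chain rule writes each partial derivative of
  the composite as a sum of products of partial derivatives of \<open>h\<close> with composites of
  partial derivatives of \<open>g\<close>, all of order one less.\<close>

lemma Ck_on_compose:
  assumes K: "finite K" "openin (powertop_real K) V" and L: "finite L" "openin (powertop_real L) W"
    and h: "h ` V \<subseteq> W" "\<And>l. l \<in> L \<Longrightarrow> Ck_on K r V (\<lambda>y. h y l)" and g: "Ck_on L r W g"
  shows "Ck_on K r V (\<lambda>y. g (h y))"
  using h(2) g
proof (induction r arbitrary: g)
  have cont: "continuous_map (subtopology (powertop_real K) V) euclideanreal (\<lambda>y. g (h y))"
    if "\<And>l. l \<in> L \<Longrightarrow> Ck_on K r V (\<lambda>y. h y l)" "Ck_on L r W g" for r and g
  proof -
    have "continuous_map (subtopology (powertop_real K) V) (powertop_real L) h"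
      unfolding continuous_map_componentwise
      using h(1) openin_powertop_extensional[OF L(2)] Ck_on_continuous[OF that(1)] by auto
    then have "continuous_map (subtopology (powertop_real K) V) (subtopology (powertop_real L) W) h"
      using h(1) by (auto simp: continuous_map_in_subtopology)
    then show ?thesis using continuous_map_compose[OF _ Ck_on_continuous[OF that(2)]] by (auto simp: o_def)
  qed
  {
    case 0
    then show ?case using cont[of 0] by simp
  next
    case (Suc r)
    have D: "((\<lambda>s. g (h (y(k := s)))) has_real_derivative (\<Sum>l\<in>L. partial k (\<lambda>y. h y l) y * partial l g (h y))) (at (y k))"
      if "y \<in> V" "k \<in> K" for y k
    proof -
      have "((\<lambda>s. h (y(k := s)) l) has_real_derivative partial k (\<lambda>y. h y l) y) (at (y k))" if "l \<in> L" for l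
        using Suc.prems(1)[OF that] \<open>y \<in> V\<close> \<open>k \<in> K\<close> unfolding partial_def
        by (auto simp: DERIV_deriv_iff_real_differentiable)
      moreover have "\<forall>\<^sub>F s in nhds (y k). h (y(k := s)) \<in> extensional L"
        using eventually_fun_upd_mem[OF K that]
        by (rule eventually_mono) (use h(1) openin_powertop_extensional[OF L(2)] in blast)
      moreover have "Ck_on L (Suc 0) W g" using Suc.prems(2) by (auto simp: Ck_on_continuous)
      ultimately show ?thesis
        using DERIV_along_curve[OF L, of "\<lambda>s. h (y(k := s))" "y k" g "\<lambda>l. partial k (\<lambda>y. h y l) y"] h(1) that by auto
    qed
    have "Ck_on K r V (partial k (\<lambda>y. g (h y)))" if k: "k \<in> K" for k
    proof (rule Ck_on_cong[OF K, of "\<lambda>y. \<Sum>l\<in>L. partial k (\<lambda>y. h y l) y * partial l g (h y)"])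
      show "(\<Sum>l\<in>L. partial k (\<lambda>y. h y l) y * partial l g (h y)) = partial k (\<lambda>y. g (h y)) y" if "y \<in> V" for y
        using DERIV_imp_deriv[OF D[OF that k]] by (simp add: partial_def)
      have "Ck_on K r V (\<lambda>y. partial l g (h y))" if "l \<in> L" for l
      proof (rule Suc.IH)
        show "Ck_on K r V (\<lambda>y. h y l)" if "l \<in> L" for l by (rule Ck_on_Suc_imp[OF Suc.prems(1)[OF that]])
        show "Ck_on L r W (partial l g)" using Suc.prems(2) that by simp
      qed
      then show "Ck_on K r V (\<lambda>y. \<Sum>l\<in>L. partial k (\<lambda>y. h y l) y * partial l g (h y))"
        using Suc.prems(1) k by (intro Ck_on_sum[OF K L(1)] Ck_on_mult[OF K]) auto
    qed
    moreover have "(\<lambda>s. g (h (y(k := s)))) differentiable (at (y k))" if "y \<in> V" "k \<in> K" for y k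
      using D[OF that] real_differentiable_def by blast
    ultimately show ?case using cont[OF Suc.prems] by simp
  }
qed

text \<open>Lets smoothness on an open set be checked as \<open>smooth_near\<close> at each of its
  points, which is the form that transfers along maps.\<close>

lemma Ck_on_local:
  assumes "\<And>y. y \<in> V \<Longrightarrow> \<exists>V'. openin (powertop_real K) V' \<and> y \<in> V' \<and> V' \<subseteq> V \<and> Ck_on K r V' g"
  shows "Ck_on K r V g"
  using assms
proof (induction r arbitrary: g)
  have cont: "continuous_map (subtopology (powertop_real K) V) euclideanreal g" 
    if *: "\<And>y. y \<in> V \<Longrightarrow> \<exists>V'. openin (powertop_real K) V' \<and> y \<in> V' \<and> V' \<subseteq> V \<and> Ck_on K r V' g" for r g
  proof -
    obtain N where N: "\<And>y. y \<in> V \<Longrightarrow> openin (powertop_real K) (N y) \<and> y \<in> N y \<and> N y \<subseteq> V \<and> Ck_on K r (N y) g"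
      using * by metis
    show ?thesis
    proof (rule pasting_lemma[of V _ N _ "\<lambda>_. g"])
      fix y assume y: "y \<in> V"
      show "openin (subtopology (powertop_real K) V) (N y)"
        using N[OF y] openin_subset_topspace_eq by (metis openin_subtopology inf.orderE)
      show "continuous_map (subtopology (subtopology (powertop_real K) V) (N y)) euclideanreal g"
        using N[OF y] Ck_on_continuous[of K r "N y" g] by (simp add: subtopology_subtopology inf.absorb2)
    qed (use N in auto)
  qed
  {
    case 0
    then show ?case using cont[of 0] by auto
  next
    case (Suc r)
    have "Ck_on K r V (partial k g)" if "k \<in> K" for k
    proof (rule Suc.IH)
      fix y assume "y \<in> V"
      from Suc.prems[OF this] that
      show "\<exists>V'. openin (powertop_real K) V' \<and> y \<in> V' \<and> V' \<subseteq> V \<and> Ck_on K r V' (partial k g)"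
        by auto
    qed
    moreover have "(\<lambda>s. g (y(k := s))) differentiable (at (y k))" if "y \<in> V" "k \<in> K" for y k
      using Suc.prems[OF that(1)] that by auto
    moreover have "continuous_map (subtopology (powertop_real K) V) euclideanreal g"
      using cont[of "Suc r"] Suc.prems by blast
    ultimately show ?case by simp
  }
qed

section \<open>Smooth functions on manifolds\<close>

lemma Cinf_on_cong:
  "finite K \<Longrightarrow> openin (powertop_real K) V \<Longrightarrow> (\<And>z. z \<in> V \<Longrightarrow> f z = g z) \<Longrightarrow> Cinf_on K V f \<Longrightarrow> Cinf_on K V g"
  using Ck_on_cong unfolding Cinf_on_def by blast

lemma Cinf_on_subset: "V' \<subseteq> V \<Longrightarrow> Cinf_on K V g \<Longrightarrow> Cinf_on K V' g"
  using Ck_on_subset unfolding Cinf_on_def by blast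

text \<open>The conditions of \<open>smooth_manifold\<close> that concern single charts. They are
  the ones verified for products, and the calculus of forms below rests on them.\<close>

definition charted :: "('a, 'k) manifold \<Rightarrow> bool"
  where "charted M \<longleftrightarrow> finite (coords M) \<and> (\<forall>c\<in>atlas M. is_chart M c) \<and> points M = (\<Union>c\<in>atlas M. fst c)"

lemma smooth_manifold_charted: "smooth_manifold M \<Longrightarrow> charted M"
  by (simp add: smooth_manifold_def charted_def)

lemma charted_finite: "charted M \<Longrightarrow> finite (coords M)"
  and charted_chart: "charted M \<Longrightarrow> c \<in> atlas M \<Longrightarrow> is_chart M c"
  by (auto simp: charted_def)

lemma charted_cover:
  assumes "charted M" "p \<in> points M"
  obtains U \<phi> where "(U, \<phi>) \<in> atlas M" "p \<in> U"
  using assms unfolding charted_def by (metis UN_E prod.collapse)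

lemma
  assumes "is_chart M (U, \<phi>)"
  shows chart_open: "openin (mtop M) U"
    and chart_inj: "inj_on \<phi> U"
    and chart_continuous: "continuous_map (subtopology (mtop M) U) (subtopology (powertop_real (coords M)) (\<phi> ` U)) \<phi>"
    and chart_inv_continuous: "continuous_map (subtopology (powertop_real (coords M)) (\<phi> ` U)) (subtopology (mtop M) U) (inv_into U \<phi>)"
    and chart_image_open: "\<And>W. openin (mtop M) W \<Longrightarrow> openin (powertop_real (coords M)) (\<phi> ` (U \<inter> W))"
proof -
  have o: "openin (mtop M) U" "openin (powertop_real (coords M)) (\<phi> ` U)"
    and h: "homeomorphic_map (subtopology (mtop M) U) (subtopology (powertop_real (coords M)) (\<phi> ` U)) \<phi>"
    using assms by (auto simp: is_chart_def)
  have top: "topspace (subtopology (mtop M) U) = U" "topspace (subtopology (powertop_real (coords M)) (\<phi> ` U)) = \<phi> ` U"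
    using o by (meson topspace_subtopology_subset openin_subset)+
  show "openin (mtop M) U" by (rule o)
  show inj: "inj_on \<phi> U" using homeomorphic_imp_injective_map[OF h] top by simp
  show "continuous_map (subtopology (mtop M) U) (subtopology (powertop_real (coords M)) (\<phi> ` U)) \<phi>"
    by (rule homeomorphic_imp_continuous_map[OF h])
  obtain g where g: "homeomorphic_maps (subtopology (mtop M) U) (subtopology (powertop_real (coords M)) (\<phi> ` U)) \<phi> g"
    using h homeomorphic_map_maps by blast
  have "continuous_map (subtopology (powertop_real (coords M)) (\<phi> ` U)) (subtopology (mtop M) U) g"
    using g by (simp add: homeomorphic_maps_def)
  moreover have "g y = inv_into U \<phi> y" if "y \<in> topspace (subtopology (powertop_real (coords M)) (\<phi> ` U))" for y
    using g that inj unfolding homeomorphic_maps_def top by (auto simp: inv_into_f_f)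
  ultimately show "continuous_map (subtopology (powertop_real (coords M)) (\<phi> ` U)) (subtopology (mtop M) U) (inv_into U \<phi>)"
    by (rule continuous_map_eq)
  show "openin (powertop_real (coords M)) (\<phi> ` (U \<inter> W))" if "openin (mtop M) W" for W
  proof -
    have "openin (subtopology (mtop M) U) (U \<inter> W)" using that by (simp add: openin_subtopology_Int2)
    then have "openin (subtopology (powertop_real (coords M)) (\<phi> ` U)) (\<phi> ` (U \<inter> W))"
      using homeomorphic_imp_open_map[OF h] by (simp add: open_map_def)
    then show ?thesis using o(2) openin_trans_full by blast
  qed
qed

lemma chart_coord_continuous:
  assumes "is_chart M (U, \<phi>)" "k \<in> coords M"
  shows "continuous_map (subtopology (mtop M) U) euclideanreal (\<lambda>x. \<phi> x k)"
proof -
  have "continuous_map (subtopology (mtop M) U) (powertop_real (coords M)) \<phi>"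
    using chart_continuous[OF assms(1)] by (simp add: continuous_map_in_subtopology)
  from continuous_map_compose[OF this continuous_map_product_projection[OF assms(2)]]
  show ?thesis by (simp add: o_def)
qed

lemma chart_subset: "is_chart M (U, \<phi>) \<Longrightarrow> U \<subseteq> points M"
  using chart_open openin_subset by blast

lemma chart_extensional: "is_chart M (U, \<phi>) \<Longrightarrow> p \<in> U \<Longrightarrow> \<phi> p \<in> extensional (coords M)"
  using chart_image_open[of M U \<phi> "topspace (mtop M)"] chart_subset[of M U \<phi>] openin_powertop_extensional
  by (metis Int_absorb2 image_eqI openin_topspace)

lemma smooth_fun_on_subset: "W' \<subseteq> W \<Longrightarrow> smooth_fun_on M W f \<Longrightarrow> smooth_fun_on M W' f"
  unfolding smooth_fun_on_def
  by (clarify, drule bspec, assumption) (auto elim!: Cinf_on_subset[rotated])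

lemma smooth_fun_on_cong:
  assumes "charted M" "openin (mtop M) W" "\<And>q. q \<in> W \<Longrightarrow> f q = g q" "smooth_fun_on M W f"
  shows "smooth_fun_on M W g"
  unfolding smooth_fun_on_def
proof clarify
  fix U \<phi> assume c: "(U, \<phi>) \<in> atlas M"
  note ch = charted_chart[OF assms(1) c]
  show "Cinf_on (coords M) (\<phi> ` (U \<inter> W)) (\<lambda>y. g (inv_into U \<phi> y))"
    by (rule Cinf_on_cong[OF charted_finite[OF assms(1)] chart_image_open[OF ch assms(2)], of "\<lambda>y. f (inv_into U \<phi> y)"])
      (use assms(3,4) c chart_inj[OF ch] in \<open>auto simp: smooth_fun_on_def inv_into_f_f\<close>)
qed

lemma smooth_fun_on_const: "smooth_fun_on M W (\<lambda>_. c)"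
  by (simp add: smooth_fun_on_def Cinf_on_def Ck_on_const)

lemma 
  assumes "charted M" "openin (mtop M) W" "smooth_fun_on M W f" "smooth_fun_on M W g"
  shows smooth_fun_on_add: "smooth_fun_on M W (\<lambda>q. f q + g q)"
    and smooth_fun_on_mult: "smooth_fun_on M W (\<lambda>q. f q * g q)"
  using assms charted_finite[OF assms(1)] chart_image_open[OF charted_chart[OF assms(1)] assms(2)]
  by (auto simp: smooth_fun_on_def Cinf_on_def intro!: Ck_on_add Ck_on_mult)

lemma smooth_near_openin: "openin (mtop M) W \<Longrightarrow> p \<in> W \<Longrightarrow> smooth_fun_on M W f \<Longrightarrow> smooth_near M p f"
  by (auto simp: smooth_near_def)

lemma smooth_near_points: "smooth_near M p f \<Longrightarrow> p \<in> points M"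
  using openin_subset by (fastforce simp: smooth_near_def)

lemma smooth_near_const: "p \<in> points M \<Longrightarrow> smooth_near M p (\<lambda>_. c)"
  by (rule smooth_near_openin[OF openin_topspace]) (auto simp: smooth_fun_on_const)

lemma smooth_near_cong:
  assumes "charted M" "openin (mtop M) W" "p \<in> W" "\<And>q. q \<in> W \<Longrightarrow> f q = g q" "smooth_near M p f"
  shows "smooth_near M p g"
proof -
  obtain W' where W': "openin (mtop M) W'" "p \<in> W'" "smooth_fun_on M W' f"
    using assms(5) by (auto simp: smooth_near_def)
  have "smooth_fun_on M (W \<inter> W') g"
    using smooth_fun_on_subset[OF _ W'(3), of "W \<inter> W'"] assms W'
    by (intro smooth_fun_on_cong[of M _ f g]) auto
  then show ?thesis using assms W' by (intro smooth_near_openin[of M "W \<inter> W'"]) auto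
qed

lemma 
  assumes "charted M" "smooth_near M p f" "smooth_near M p g"
  shows smooth_near_add: "smooth_near M p (\<lambda>q. f q + g q)"
    and smooth_near_mult: "smooth_near M p (\<lambda>q. f q * g q)"
proof -
  obtain W W' where W: "openin (mtop M) W" "p \<in> W" "smooth_fun_on M W f"
    "openin (mtop M) W'" "p \<in> W'" "smooth_fun_on M W' g"
    using assms(2,3) by (auto simp: smooth_near_def)
  then have *: "openin (mtop M) (W \<inter> W')" "smooth_fun_on M (W \<inter> W') f" "smooth_fun_on M (W \<inter> W') g"
    using smooth_fun_on_subset[of "W \<inter> W'"] by auto
  show "smooth_near M p (\<lambda>q. f q + g q)" "smooth_near M p (\<lambda>q. f q * g q)"
    using smooth_fun_on_add[OF assms(1) *] smooth_fun_on_mult[OF assms(1) *] W *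
    by (auto intro!: smooth_near_openin[of M "W \<inter> W'"])
qed

lemma smooth_near_cmult: "charted M \<Longrightarrow> smooth_near M p f \<Longrightarrow> smooth_near M p (\<lambda>q. c * f q)"
  by (intro smooth_near_mult smooth_near_const) (auto dest: smooth_near_points)

lemma smooth_near_diff: "charted M \<Longrightarrow> smooth_near M p f \<Longrightarrow> smooth_near M p g \<Longrightarrow> smooth_near M p (\<lambda>q. f q - g q)"
  using smooth_near_add[of M p f "\<lambda>q. (-1) * g q"] smooth_near_cmult[of M p g "-1"] by simp

lemma smooth_fun_onI:
  assumes M: "charted M" and near: "\<And>p. p \<in> W \<Longrightarrow> smooth_near M p f" and W: "openin (mtop M) W"
  shows "smooth_fun_on M W f"
  unfolding smooth_fun_on_def Cinf_on_def
proof clarify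
  fix U \<phi> r assume c: "(U, \<phi>) \<in> atlas M"
  note ch = charted_chart[OF M c]
  show "Ck_on (coords M) r (\<phi> ` (U \<inter> W)) (\<lambda>y. f (inv_into U \<phi> y))"
  proof (rule Ck_on_local)
    fix y assume "y \<in> \<phi> ` (U \<inter> W)"
    then obtain p where p: "p \<in> U" "p \<in> W" "y = \<phi> p" by auto
    obtain W' where W': "openin (mtop M) W'" "p \<in> W'" "smooth_fun_on M W' f"
      using near[OF p(2)] by (auto simp: smooth_near_def)
    have "Ck_on (coords M) r (\<phi> ` (U \<inter> (W \<inter> W'))) (\<lambda>y. f (inv_into U \<phi> y))"
      by (rule Ck_on_subset[of _ "\<phi> ` (U \<inter> W')"]) (use W'(3) c in \<open>auto simp: smooth_fun_on_def Cinf_on_def\<close>)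
    moreover have "openin (powertop_real (coords M)) (\<phi> ` (U \<inter> (W \<inter> W')))"
      using chart_image_open[OF ch] W W' by blast
    ultimately show "\<exists>V'. openin (powertop_real (coords M)) V' \<and> y \<in> V' \<and> V' \<subseteq> \<phi> ` (U \<inter> W) \<and>
        Ck_on (coords M) r V' (\<lambda>y. f (inv_into U \<phi> y))"
      using p W' by (intro exI[of _ "\<phi> ` (U \<inter> (W \<inter> W'))"]) auto
  qed
qed

lemma smooth_near_chart:
  assumes M: "charted M" and c: "(U, \<phi>) \<in> atlas M" and p: "p \<in> U" and f: "smooth_near M p f"
  obtains V where "openin (powertop_real (coords M)) V" "\<phi> p \<in> V" "V \<subseteq> \<phi> ` U"
    "\<And>r. Ck_on (coords M) r V (\<lambda>y. f (inv_into U \<phi> y))"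
proof -
  obtain W where W: "openin (mtop M) W" "p \<in> W" "smooth_fun_on M W f"
    using f by (auto simp: smooth_near_def)
  show ?thesis
    by (rule that[of "\<phi> ` (U \<inter> W)"])
      (use W p c chart_image_open[OF charted_chart[OF M c] W(1)] in \<open>auto simp: smooth_fun_on_def Cinf_on_def\<close>)
qed

text \<open>Read in another chart, a coordinate function is a component of a transition map, so this
  is exactly what compatibility of charts provides.\<close>

lemma smooth_near_coord:
  assumes "smooth_manifold M" "(U, \<phi>) \<in> atlas M" "p \<in> U" "k \<in> coords M"
  shows "smooth_near M p (\<lambda>q. \<phi> q k)"
proof -
  have "smooth_fun_on M U (\<lambda>q. \<phi> q k)"
    using assms by (fastforce simp: smooth_fun_on_def smooth_manifold_def smooth_transition_def)
  then show ?thesis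
    using chart_open[of M U \<phi>] assms smooth_manifold_charted charted_chart by (blast intro: smooth_near_openin)
qed

text \<open>In charts the composite is f after the inverse of \<phi>', applied to the coordinates
  \<phi>' after F; \<open>Ck_on_compose\<close> then applies on a neighbourhood where all
  coordinates are smooth at once.\<close>

lemma smooth_near_compose:
  assumes M: "charted M" and N: "charted N" and F: "continuous_map (mtop M) (mtop N) F"
    and p: "p \<in> points M" and c': "(U', \<phi>') \<in> atlas N" "F p \<in> U'"
    and coord: "\<And>k. k \<in> coords N \<Longrightarrow> smooth_near M p (\<lambda>q. \<phi>' (F q) k)"
    and f: "smooth_near N (F p) f"
  shows "smooth_near M p (\<lambda>q. f (F q))"
proof -
  note ch' = charted_chart[OF N c'(1)]
  obtain W where W: "openin (mtop N) W" "F p \<in> W" "smooth_fun_on N W f"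
    using f by (auto simp: smooth_near_def)
  have "\<forall>k\<in>coords N. \<exists>W. openin (mtop M) W \<and> p \<in> W \<and> smooth_fun_on M W (\<lambda>q. \<phi>' (F q) k)"
    using coord by (auto simp: smooth_near_def)
  then obtain A where A: "\<And>k. k \<in> coords N \<Longrightarrow> openin (mtop M) (A k) \<and> p \<in> A k \<and> smooth_fun_on M (A k) (\<lambda>q. \<phi>' (F q) k)"
    by metis
  \<comment> \<open>Inserting \<open>points M\<close> keeps the intersection meaningful when
    \<open>N\<close> has dimension 0.\<close>
  define B where "B = {q \<in> points M. F q \<in> W \<inter> U'} \<inter> \<Inter> (insert (points M) (A ` coords N))"
  have "openin (mtop M) {q \<in> points M. F q \<in> W \<inter> U'}"
    using F W(1) chart_open[OF ch'] by (intro openin_continuous_map_preimage) auto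
  moreover have "openin (mtop M) (\<Inter> (insert (points M) (A ` coords N)))"
    by (rule openin_Inter) (use charted_finite[OF N] A in auto)
  ultimately have B: "openin (mtop M) B" by (simp add: B_def openin_Int)
  have pB: "p \<in> B" using p c' W A by (auto simp: B_def)
  have "smooth_fun_on M B (\<lambda>q. f (F q))"
    unfolding smooth_fun_on_def Cinf_on_def
  proof clarify
    fix U \<phi> r assume c: "(U, \<phi>) \<in> atlas M"
    note ch = charted_chart[OF M c]
    have o: "openin (powertop_real (coords M)) (\<phi> ` (U \<inter> B))" by (rule chart_image_open[OF ch B])
    have inv: "inv_into U \<phi> y \<in> B" if "y \<in> \<phi> ` (U \<inter> B)" for y
      using that chart_inj[OF ch] by (auto simp: inv_into_f_f)
    have "Ck_on (coords M) r (\<phi> ` (U \<inter> B)) (\<lambda>y. f (inv_into U' \<phi>' (\<phi>' (F (inv_into U \<phi> y)))))"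
    proof (rule Ck_on_compose[where g = "\<lambda>z. f (inv_into U' \<phi>' z)" and h = "\<lambda>y. \<phi>' (F (inv_into U \<phi> y))", OF charted_finite[OF M] o charted_finite[OF N] chart_image_open[OF ch' W(1)]])
      show "(\<lambda>y. \<phi>' (F (inv_into U \<phi> y))) ` (\<phi> ` (U \<inter> B)) \<subseteq> \<phi>' ` (U' \<inter> W)"
        using inv by (fastforce simp: B_def)
      show "Ck_on (coords M) r (\<phi> ` (U \<inter> B)) (\<lambda>y. \<phi>' (F (inv_into U \<phi> y)) l)" if "l \<in> coords N" for l
        by (rule Ck_on_subset[of _ "\<phi> ` (U \<inter> A l)"])
          (use A[OF that] c that in \<open>auto simp: B_def smooth_fun_on_def Cinf_on_def\<close>)
      show "Ck_on (coords N) r (\<phi>' ` (U' \<inter> W)) (\<lambda>z. f (inv_into U' \<phi>' z))"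
        using W(3) c' by (auto simp: smooth_fun_on_def Cinf_on_def)
    qed
    then show "Ck_on (coords M) r (\<phi> ` (U \<inter> B)) (\<lambda>y. f (F (inv_into U \<phi> y)))"
      by (rule Ck_on_cong[OF charted_finite[OF M] o, rotated])
        (use inv chart_inj[OF ch'] in \<open>auto simp: B_def inv_into_f_f\<close>)
  qed
  then show ?thesis using B pB by (rule smooth_near_openin[rotated 2])
qed

text \<open>\<open>smooth_map\<close> quantifies over all smooth germs on the target; the
  coordinates of a single chart around each image point are enough to test.\<close>

lemma smooth_mapI:
  assumes "charted M" "charted N" "continuous_map (mtop M) (mtop N) F"
    and "\<And>p. p \<in> points M \<Longrightarrow> \<exists>(U, \<phi>)\<in>atlas N. F p \<in> U \<and> (\<forall>k\<in>coords N. smooth_near M p (\<lambda>q. \<phi> (F q) k))"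
  shows "smooth_map M N F"
  unfolding smooth_map_def
proof (intro conjI ballI allI impI)
  fix p f assume p: "p \<in> points M" and f: "smooth_near N (F p) f"
  obtain U \<phi> where "(U, \<phi>) \<in> atlas N" "F p \<in> U" "\<And>k. k \<in> coords N \<Longrightarrow> smooth_near M p (\<lambda>q. \<phi> (F q) k)"
    using assms(4)[OF p] by auto
  then show "smooth_near M p (\<lambda>q. f (F q))"
    using smooth_near_compose[OF assms(1-3) p _ _ _ f] by blast
qed (rule assms)

lemma smooth_map_near: "smooth_map M N F \<Longrightarrow> p \<in> points M \<Longrightarrow> smooth_near N (F p) f \<Longrightarrow> smooth_near M p (\<lambda>q. f (F q))"
  and smooth_map_continuous: "smooth_map M N F \<Longrightarrow> continuous_map (mtop M) (mtop N) F"
  by (auto simp: smooth_map_def)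

lemma smooth_map_points: "smooth_map M N F \<Longrightarrow> p \<in> points M \<Longrightarrow> F p \<in> points N"
  using smooth_map_continuous continuous_map_image_subset_topspace by fast

lemma smooth_map_compose:
  assumes F: "smooth_map M N F" and G: "smooth_map N Q G"
  shows "smooth_map M Q (\<lambda>p. G (F p))"
  unfolding smooth_map_def
proof (intro conjI ballI allI impI)
  show "continuous_map (mtop M) (mtop Q) (\<lambda>p. G (F p))"
    using continuous_map_compose[OF smooth_map_continuous[OF F] smooth_map_continuous[OF G]] by (simp add: o_def)
  fix p f assume "p \<in> points M" "smooth_near Q (G (F p)) f"
  then show "smooth_near M p (\<lambda>q. f (G (F q)))"
    using smooth_map_near[OF F, of p "\<lambda>q. f (G q)"] smooth_map_near[OF G, of "F p" f] smooth_map_points[OF F] by blast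
qed

section \<open>Product manifolds\<close>

lemma mfd_prod_chart_mem:
  "(\<And>i. i \<in> I \<Longrightarrow> (U i, \<phi> i) \<in> atlas (M i)) \<Longrightarrow>
    (PiE I U, \<lambda>x. \<lambda>(i, k)\<in>(SIGMA i:I. coords (M i)). \<phi> i (x i) k) \<in> atlas (mfd_prod I M)"
  unfolding mfd_prod_def by auto

lemma mfd_prod_chartE:
  assumes "c \<in> atlas (mfd_prod I M)"
  obtains U \<phi> where "c = (PiE I U, \<lambda>x. \<lambda>(i, k)\<in>(SIGMA i:I. coords (M i)). \<phi> i (x i) k)"
    "\<And>i. i \<in> I \<Longrightarrow> (U i, \<phi> i) \<in> atlas (M i)"
  using assms unfolding mfd_prod_def manifold.simps mem_Collect_eq by blast

text \<open>The image of a product chart consists of the points whose i-th block of coordinates lies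
  in the image of the i-th chart. Openness of this image and continuity of the inverse can then be
  checked block by block.\<close>

lemma charted_mfd_prod:
  assumes I: "finite I" and M: "\<And>i. i \<in> I \<Longrightarrow> charted (M i)"
  shows "charted (mfd_prod I M)"
  unfolding charted_def
proof (intro conjI ballI)
  let ?K = "SIGMA i:I. coords (M i)"
  show "finite (coords (mfd_prod I M))" using I M by (auto simp: mfd_prod_def charted_finite)
  show "points (mfd_prod I M) = \<Union> (fst ` atlas (mfd_prod I M))"
  proof
    show "points (mfd_prod I M) \<subseteq> \<Union> (fst ` atlas (mfd_prod I M))"
    proof
      fix p assume p: "p \<in> points (mfd_prod I M)"
      then have "\<forall>i\<in>I. \<exists>c. c \<in> atlas (M i) \<and> p i \<in> fst c"
        using M by (fastforce simp: mfd_prod_def charted_def PiE_iff)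
      then obtain c where c: "\<And>i. i \<in> I \<Longrightarrow> c i \<in> atlas (M i) \<and> p i \<in> fst (c i)" by metis
      then have pU: "p \<in> PiE I (\<lambda>i. fst (c i))" using p by (auto simp: mfd_prod_def PiE_iff)
      have at: "(PiE I (\<lambda>i. fst (c i)), \<lambda>x. \<lambda>(i, k)\<in>?K. snd (c i) (x i) k) \<in> atlas (mfd_prod I M)"
        using c by (intro mfd_prod_chart_mem) simp
      show "p \<in> \<Union> (fst ` atlas (mfd_prod I M))" using UN_I[OF at, of p fst] pU by simp
    qed
    show "\<Union> (fst ` atlas (mfd_prod I M)) \<subseteq> points (mfd_prod I M)"
    proof (rule UN_least)
      fix c assume "c \<in> atlas (mfd_prod I M)"
      then obtain U \<phi> where c: "fst c = PiE I U" "\<And>i. i \<in> I \<Longrightarrow> (U i, \<phi> i) \<in> atlas (M i)"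
        by (elim mfd_prod_chartE) (metis fst_conv)
      have "U i \<subseteq> points (M i)" if "i \<in> I" for i
        using chart_subset[OF charted_chart[OF M[OF that] c(2)[OF that]]] .
      then show "fst c \<subseteq> points (mfd_prod I M)" unfolding c by (auto simp: mfd_prod_def PiE_iff)
    qed
  qed
  fix c assume "c \<in> atlas (mfd_prod I M)"
  then obtain U \<phi> where c: "c = (PiE I U, \<lambda>x. \<lambda>(i, k)\<in>?K. \<phi> i (x i) k)" 
    and U: "\<And>i. i \<in> I \<Longrightarrow> (U i, \<phi> i) \<in> atlas (M i)"
    by (rule mfd_prod_chartE) blast
  have ch: "is_chart (M i) (U i, \<phi> i)" if "i \<in> I" for i using M U that charted_chart by blast
  define \<Phi> where "\<Phi> = (\<lambda>x. \<lambda>(i, k)\<in>?K. \<phi> i (x i) k)"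
  \<comment> \<open>The i-th block of coordinates, made extensional so that it is literally the
    value of the i-th chart.\<close>
  define \<rho> where "\<rho> = (\<lambda>i y. \<lambda>k\<in>coords (M i). y (i, k) :: real)"
  have \<rho>\<Phi>: "\<rho> i (\<Phi> x) = \<phi> i (x i)" if "i \<in> I" "x \<in> PiE I U" for i x
  proof -
    have "\<phi> i (x i) \<in> extensional (coords (M i))" using chart_extensional[OF ch] that by (auto simp: PiE_iff)
    then show ?thesis using that by (auto simp: \<rho>_def \<Phi>_def extensional_def fun_eq_iff)
  qed
  have \<rho>c: "continuous_map (powertop_real ?K) (powertop_real (coords (M i))) (\<rho> i)" if "i \<in> I" for i
    unfolding continuous_map_componentwise using that
    by (auto simp: \<rho>_def intro!: continuous_map_product_projection)
  have img: "\<Phi> ` PiE I U = {y \<in> topspace (powertop_real ?K). \<forall>i\<in>I. \<rho> i y \<in> \<phi> i ` U i}" (is "_ = ?R")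
  proof
    show "\<Phi> ` PiE I U \<subseteq> ?R"
    proof
      fix y assume "y \<in> \<Phi> ` PiE I U"
      then obtain x where x: "y = \<Phi> x" "x \<in> PiE I U" by blast
      have "y \<in> topspace (powertop_real ?K)" unfolding x \<Phi>_def by (simp only: topspace_product_topology) simp
      moreover have "\<rho> i y \<in> \<phi> i ` U i" if "i \<in> I" for i
        using \<rho>\<Phi>[OF that x(2)] x that by (simp add: PiE_mem)
      ultimately show "y \<in> ?R" by simp
    qed
    show "?R \<subseteq> \<Phi> ` PiE I U"
    proof
      fix y assume y: "y \<in> ?R"
      then have "\<forall>i\<in>I. \<exists>x\<in>U i. \<rho> i y = \<phi> i x" by auto
      then obtain x where x: "\<And>i. i \<in> I \<Longrightarrow> x i \<in> U i" "\<And>i. i \<in> I \<Longrightarrow> \<rho> i y = \<phi> i (x i)" by metis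
      have "y = \<Phi> (restrict x I)"
      proof
        fix j show "y j = \<Phi> (restrict x I) j"
          using y fun_cong[OF x(2), of "fst j" "snd j"] by (cases j) (auto simp: \<Phi>_def \<rho>_def PiE_iff extensional_def)
      qed
      then show "y \<in> \<Phi> ` PiE I U" using x by auto
    qed
  qed
  have openU: "openin (product_topology (\<lambda>i. mtop (M i)) I) (PiE I U)"
    using I chart_open[OF ch] by (simp add: openin_PiE)
  have openR: "openin (powertop_real ?K) (\<Phi> ` PiE I U)"
  proof -
    have "openin (powertop_real ?K) {y \<in> topspace (powertop_real ?K). \<rho> i y \<in> \<phi> i ` U i}" if "i \<in> I" for i
      using chart_image_open[OF ch[OF that] openin_topspace] chart_subset[OF ch[OF that]]
      by (intro openin_continuous_map_preimage[OF \<rho>c[OF that]]) (simp add: Int_absorb2)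
    \<comment> \<open>Including the whole space gives the right intersection also for empty
      \<open>I\<close>.\<close>
    then have "openin (powertop_real ?K) (\<Inter> (insert (topspace (powertop_real ?K))
        ((\<lambda>i. {y \<in> topspace (powertop_real ?K). \<rho> i y \<in> \<phi> i ` U i}) ` I)))"
      using I by (intro openin_Inter) (auto simp del: topspace_product_topology)
    also have "\<Inter> (insert (topspace (powertop_real ?K))
        ((\<lambda>i. {y \<in> topspace (powertop_real ?K). \<rho> i y \<in> \<phi> i ` U i}) ` I)) = \<Phi> ` PiE I U"
      unfolding img by auto
    finally show ?thesis .
  qed
  define \<Psi> where "\<Psi> = (\<lambda>y. \<lambda>i\<in>I. inv_into (U i) (\<phi> i) (\<rho> i y))"
  let ?X = "subtopology (product_topology (\<lambda>i. mtop (M i)) I) (PiE I U)"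
  let ?Y = "subtopology (powertop_real ?K) (\<Phi> ` PiE I U)"
  have top: "topspace ?X = PiE I U" "topspace ?Y = \<Phi> ` PiE I U"
    using openin_subset[OF openU] openin_subset[OF openR] topspace_subtopology_subset by blast+
  have "homeomorphic_maps ?X ?Y \<Phi> \<Psi>"
    unfolding homeomorphic_maps_def top
  proof (intro conjI ballI)
    have proj: "continuous_map ?X (subtopology (mtop (M i)) (U i)) (\<lambda>x. x i)" if "i \<in> I" for i
      unfolding continuous_map_in_subtopology top
      using that continuous_map_product_projection[OF that, of "\<lambda>i. mtop (M i)"]
      by (auto intro: continuous_map_from_subtopology)
    show "continuous_map ?X ?Y \<Phi>"
      unfolding continuous_map_in_subtopology top
    proof
      show "continuous_map ?X (powertop_real ?K) \<Phi>"
        unfolding continuous_map_componentwise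
      proof (intro conjI ballI)
        show "\<Phi> ` topspace ?X \<subseteq> extensional ?K" by (auto simp: \<Phi>_def)
        fix j assume "j \<in> ?K"
        then obtain i k where j: "j = (i, k)" "i \<in> I" "k \<in> coords (M i)" by auto
        have "continuous_map (subtopology (mtop (M i)) (U i)) euclideanreal (\<lambda>x. \<phi> i x k)"
          by (rule chart_coord_continuous[OF ch[OF j(2)] j(3)])
        from continuous_map_compose[OF proj[OF j(2)] this]
        show "continuous_map ?X euclideanreal (\<lambda>x. \<Phi> x j)" using j by (simp add: \<Phi>_def o_def)
      qed
    qed auto
    show "continuous_map ?Y ?X \<Psi>"
      unfolding continuous_map_in_subtopology
    proof
      show "continuous_map ?Y (product_topology (\<lambda>i. mtop (M i)) I) \<Psi>"
        unfolding continuous_map_componentwise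
      proof (intro conjI ballI)
        show "\<Psi> ` topspace ?Y \<subseteq> extensional I" by (auto simp: \<Psi>_def)
        fix i assume i: "i \<in> I"
        have "continuous_map ?Y (subtopology (powertop_real (coords (M i))) (\<phi> i ` U i)) (\<rho> i)"
          unfolding continuous_map_in_subtopology top
          using i \<rho>c[OF i] by (auto intro: continuous_map_from_subtopology simp: img)
        from continuous_map_compose[OF this chart_inv_continuous[OF ch[OF i]]]
        show "continuous_map ?Y (mtop (M i)) (\<lambda>x. \<Psi> x i)"
          using i by (simp add: o_def \<Psi>_def continuous_map_in_subtopology)
      qed
      show "\<Psi> \<in> topspace ?Y \<rightarrow> PiE I U"
        unfolding top img by (auto simp: \<Psi>_def inv_into_into)
    qed
    show inv: "\<Psi> (\<Phi> x) = x" if "x \<in> PiE I U" for x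
    proof
      fix i show "\<Psi> (\<Phi> x) i = x i"
        using that \<rho>\<Phi>[OF _ that, of i] chart_inj[OF ch, of i]
        by (cases "i \<in> I") (auto simp: \<Psi>_def PiE_iff extensional_def inv_into_f_f)
    qed
    show "\<Phi> (\<Psi> y) = y" if "y \<in> \<Phi> ` PiE I U" for y
      using that inv by auto
  qed
  then have "homeomorphic_map ?X ?Y \<Phi>" using homeomorphic_map_maps by blast
  then show "is_chart (mfd_prod I M) c"
    using openU openR unfolding c is_chart_def \<Phi>_def by (simp add: mfd_prod_def)
qed


text \<open>The argument of \<open>charted_mfd_prod\<close> with the two blocks \<open>Inl\<close>
  and \<open>Inr\<close>. It is wanted for \<open>real_line\<close> as first factor, since
  smoothness of a circle action is stated on that product.\<close>

lemma charted_mfd_times: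
  fixes M :: "('a, 'k) manifold" and N :: "('b, 'l) manifold"
  assumes M: "charted M" and N: "charted N"
  shows "charted (mfd_times M N)"
  unfolding charted_def
proof (intro conjI ballI)
  let ?K = "coords M <+> coords N"
  show "finite (coords (mfd_times M N))" using M N by (auto simp: mfd_times_def charted_finite)
  show "points (mfd_times M N) = \<Union> (fst ` atlas (mfd_times M N))"
  proof
    show "points (mfd_times M N) \<subseteq> \<Union> (fst ` atlas (mfd_times M N))"
    proof
      fix p assume "p \<in> points (mfd_times M N)"
      then obtain x y where p: "p = (x, y)" "x \<in> points M" "y \<in> points N" by (auto simp: mfd_times_def)
      obtain U \<phi> where U: "(U, \<phi>) \<in> atlas M" "x \<in> U" using charted_cover[OF M p(2)] .
      obtain V \<psi> where V: "(V, \<psi>) \<in> atlas N" "y \<in> V" using charted_cover[OF N p(3)] .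
      have "(U \<times> V, \<lambda>(x, y). restrict (case_sum (\<phi> x) (\<psi> y)) ?K) \<in> atlas (mfd_times M N)"
        using U V by (auto simp: mfd_times_def)
      from UN_I[OF this, of p fst] show "p \<in> \<Union> (fst ` atlas (mfd_times M N))" using p U V by simp
    qed
    show "\<Union> (fst ` atlas (mfd_times M N)) \<subseteq> points (mfd_times M N)"
      using chart_subset[OF charted_chart[OF M]] chart_subset[OF charted_chart[OF N]]
      by (fastforce simp: mfd_times_def)
  qed
  fix c assume "c \<in> atlas (mfd_times M N)"
  then obtain U \<phi> V \<psi> where c: "c = (U \<times> V, \<lambda>(x, y). restrict (case_sum (\<phi> x) (\<psi> y)) ?K)"
    and U: "(U, \<phi>) \<in> atlas M" and V: "(V, \<psi>) \<in> atlas N"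
    by (auto simp: mfd_times_def)
  note chU = charted_chart[OF M U] and chV = charted_chart[OF N V]
  define \<Phi> where "\<Phi> = (\<lambda>(x, y). restrict (case_sum (\<phi> x) (\<psi> y)) ?K)"
  define l :: "('k + 'l \<Rightarrow> real) \<Rightarrow> 'k \<Rightarrow> real" where "l = (\<lambda>y. \<lambda>k\<in>coords M. y (Inl k) :: real)"
  define r :: "('k + 'l \<Rightarrow> real) \<Rightarrow> 'l \<Rightarrow> real" where "r = (\<lambda>y. \<lambda>k\<in>coords N. y (Inr k) :: real)"
  have l\<Phi>: "l (\<Phi> (x, y)) = \<phi> x" if "x \<in> U" for x y
    using chart_extensional[OF chU that] by (auto simp: l_def \<Phi>_def extensional_def fun_eq_iff)
  have r\<Phi>: "r (\<Phi> (x, y)) = \<psi> y" if "y \<in> V" for x y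
    using chart_extensional[OF chV that] by (auto simp: r_def \<Phi>_def extensional_def fun_eq_iff)
  have lc: "continuous_map (powertop_real ?K) (powertop_real (coords M)) l"
    unfolding continuous_map_componentwise by (auto simp: l_def intro!: continuous_map_product_projection)
  have rc: "continuous_map (powertop_real ?K) (powertop_real (coords N)) r"
    unfolding continuous_map_componentwise by (auto simp: r_def intro!: continuous_map_product_projection)
  have img: "\<Phi> ` (U \<times> V) = {y \<in> topspace (powertop_real ?K). l y \<in> \<phi> ` U} \<inter> {y \<in> topspace (powertop_real ?K). r y \<in> \<psi> ` V}" (is "_ = ?R")
  proof
    show "\<Phi> ` (U \<times> V) \<subseteq> ?R" using l\<Phi> r\<Phi> by (auto simp: \<Phi>_def)
    show "?R \<subseteq> \<Phi> ` (U \<times> V)"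
    proof
      fix y assume y: "y \<in> ?R"
      then obtain p q where pq: "p \<in> U" "q \<in> V" "l y = \<phi> p" "r y = \<psi> q" by auto
      have "y = \<Phi> (p, q)"
      proof
        fix j show "y j = \<Phi> (p, q) j"
          using y fun_cong[OF pq(3)] fun_cong[OF pq(4)]
          by (cases j) (fastforce simp: \<Phi>_def l_def r_def PiE_iff extensional_def restrict_def split: if_splits)+
      qed
      then show "y \<in> \<Phi> ` (U \<times> V)" using pq by auto
    qed
  qed
  have openU: "openin (prod_topology (mtop M) (mtop N)) (U \<times> V)"
    using chart_open[OF chU] chart_open[OF chV] by (simp add: openin_prod_Times_iff)
  have openR: "openin (powertop_real ?K) (\<Phi> ` (U \<times> V))"
    unfolding img
    using chart_image_open[OF chU openin_topspace] chart_image_open[OF chV openin_topspace]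
      chart_subset[OF chU] chart_subset[OF chV]
    by (intro openin_Int openin_continuous_map_preimage[OF lc] openin_continuous_map_preimage[OF rc]) (simp_all add: Int_absorb2)
  define \<Psi> where "\<Psi> = (\<lambda>y. (inv_into U \<phi> (l y), inv_into V \<psi> (r y)))"
  let ?X = "subtopology (prod_topology (mtop M) (mtop N)) (U \<times> V)"
  let ?Y = "subtopology (powertop_real ?K) (\<Phi> ` (U \<times> V))"
  have top: "topspace ?X = U \<times> V" "topspace ?Y = \<Phi> ` (U \<times> V)"
    using openin_subset[OF openU] openin_subset[OF openR] topspace_subtopology_subset by blast+
  have "homeomorphic_maps ?X ?Y \<Phi> \<Psi>"
    unfolding homeomorphic_maps_def top
  proof (intro conjI ballI)
    have p1: "continuous_map ?X (subtopology (mtop M) U) fst" 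
      unfolding continuous_map_in_subtopology top by (auto intro: continuous_map_from_subtopology continuous_map_fst)
    have p2: "continuous_map ?X (subtopology (mtop N) V) snd" 
      unfolding continuous_map_in_subtopology top by (auto intro: continuous_map_from_subtopology continuous_map_snd)
    show "continuous_map ?X ?Y \<Phi>"
      unfolding continuous_map_in_subtopology top
    proof
      show "continuous_map ?X (powertop_real ?K) \<Phi>"
        unfolding continuous_map_componentwise
      proof (intro conjI ballI)
        show "\<Phi> ` topspace ?X \<subseteq> extensional ?K" by (auto simp: \<Phi>_def)
        fix j assume "j \<in> ?K"
        then consider k where "j = Inl k" "k \<in> coords M" | k where "j = Inr k" "k \<in> coords N" by auto
        then show "continuous_map ?X euclideanreal (\<lambda>x. \<Phi> x j)"
        proof cases
          case (1 k)
          have "continuous_map (subtopology (mtop M) U) euclideanreal (\<lambda>x. \<phi> x k)"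
            by (rule chart_coord_continuous[OF chU 1(2)])
          from continuous_map_compose[OF p1 this] show ?thesis using 1 by (simp add: \<Phi>_def o_def case_prod_beta')
        next
          case (2 k)
          have "continuous_map (subtopology (mtop N) V) euclideanreal (\<lambda>x. \<psi> x k)"
            by (rule chart_coord_continuous[OF chV 2(2)])
          from continuous_map_compose[OF p2 this] show ?thesis using 2 by (simp add: \<Phi>_def o_def case_prod_beta')
        qed
      qed
    qed auto
    show "continuous_map ?Y ?X \<Psi>"
      unfolding continuous_map_in_subtopology
    proof
      have "continuous_map ?Y (subtopology (powertop_real (coords M)) (\<phi> ` U)) l"
        unfolding continuous_map_in_subtopology top
        using lc by (auto intro: continuous_map_from_subtopology simp: img)
      from continuous_map_compose[OF this chart_inv_continuous[OF chU]]
      have "continuous_map ?Y (mtop M) (\<lambda>y. inv_into U \<phi> (l y))"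
        by (simp add: o_def continuous_map_in_subtopology)
      moreover have "continuous_map ?Y (subtopology (powertop_real (coords N)) (\<psi> ` V)) r"
        unfolding continuous_map_in_subtopology top
        using rc by (auto intro: continuous_map_from_subtopology simp: img)
      from continuous_map_compose[OF this chart_inv_continuous[OF chV]]
      have "continuous_map ?Y (mtop N) (\<lambda>y. inv_into V \<psi> (r y))"
        by (simp add: o_def continuous_map_in_subtopology)
      ultimately show "continuous_map ?Y (prod_topology (mtop M) (mtop N)) \<Psi>"
        unfolding \<Psi>_def by (rule continuous_map_pairedI)
      show "\<Psi> \<in> topspace ?Y \<rightarrow> U \<times> V"
        unfolding top img by (auto simp: \<Psi>_def inv_into_into)
    qed
    show inv: "\<Psi> (\<Phi> x) = x" if "x \<in> U \<times> V" for x
      using that l\<Phi> r\<Phi> chart_inj[OF chU] chart_inj[OF chV] by (auto simp: \<Psi>_def inv_into_f_f)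
    show "\<Phi> (\<Psi> y) = y" if "y \<in> \<Phi> ` (U \<times> V)" for y
      using that inv by auto
  qed
  then have "homeomorphic_map ?X ?Y \<Phi>" using homeomorphic_map_maps by blast
  then show "is_chart (mfd_times M N) c"
    using openU openR unfolding c is_chart_def \<Phi>_def by (simp add: mfd_times_def)
qed

section \<open>The real line as a manifold\<close>

lemma charted_real_line: "charted real_line"
proof -
  let ?f = "\<lambda>s::real. \<lambda>_::unit. s"
  have ext: "range ?f = topspace (powertop_real UNIV)"
    by (auto simp: PiE_iff fun_eq_iff image_iff)
  have "homeomorphic_maps euclideanreal (powertop_real UNIV) ?f (\<lambda>y. y ())"
    unfolding homeomorphic_maps_def continuous_map_componentwise
    using continuous_map_product_projection[of "()" UNIV "\<lambda>_. euclideanreal"] by auto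
  then have "homeomorphic_map euclideanreal (powertop_real UNIV) ?f" using homeomorphic_map_maps by blast
  moreover have "openin (powertop_real UNIV) (range ?f)" unfolding ext by (rule openin_topspace)
  ultimately have "is_chart real_line (UNIV, ?f)"
    by (simp add: is_chart_def real_line_def ext)
  then show ?thesis by (simp add: charted_def real_line_def)
qed

text \<open>Turns smoothness of a function along an orbit into an ordinary derivative.\<close>

lemma smooth_near_real_line_differentiable:
  assumes "smooth_near real_line t f"
  shows "f differentiable (at t)"
proof -
  let ?f = "\<lambda>s::real. \<lambda>_::unit. s"
  have c: "(UNIV, ?f) \<in> atlas real_line" by (simp add: real_line_def)
  have inj: "inj ?f" by (auto simp: inj_def fun_eq_iff)
  obtain V where V: "?f t \<in> V" "Ck_on UNIV (Suc 0) V (\<lambda>y. f (inv_into UNIV ?f y))"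
  proof (rule smooth_near_chart[OF charted_real_line c UNIV_I assms])
    fix V assume "?f t \<in> V" "\<And>r. Ck_on (coords real_line) r V (\<lambda>y. f (inv_into UNIV ?f y))"
    then show thesis using that[of V] by (simp add: real_line_def del: Ck_on.simps)
  qed
  have "(?f t)(() := s) = ?f s" for s by auto
  moreover have "(\<lambda>s. f (inv_into UNIV ?f ((?f t)(() := s)))) differentiable (at (?f t ()))"
    using V by (auto simp del: fun_upd_apply)
  moreover have "inv_into UNIV ?f (?f s) = s" for s by (rule inv_f_f[OF inj])
  ultimately show ?thesis by (simp del: fun_upd_apply)
qed

lemma smooth_near_real_line_id: "smooth_near real_line t (\<lambda>s. s)"
proof -
  let ?f = "\<lambda>s::real. \<lambda>_::unit. s"
  have inj: "inj ?f" by (auto simp: inj_def fun_eq_iff)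
  have "inv_into UNIV ?f y = y ()" for y
  proof -
    have "y = ?f (y ())" by (rule ext) simp
    then show ?thesis using inv_f_f[OF inj, of "y ()"] by metis
  qed
  then have "inv_into UNIV ?f = (\<lambda>y. y ())" by (rule ext)
  then have "smooth_fun_on real_line UNIV (\<lambda>s. s)"
    by (simp add: smooth_fun_on_def real_line_def Cinf_on_def Ck_on_coord)
  then show ?thesis by (intro smooth_near_openin[of _ UNIV]) (simp_all add: real_line_def)
qed

section \<open>Tangent vectors\<close>

lemma
  assumes "v \<in> tangent M p"
  shows tangent_add: "smooth_near M p f \<Longrightarrow> smooth_near M p g \<Longrightarrow> v (\<lambda>q. f q + g q) = v f + v g"
    and tangent_mult: "smooth_near M p f \<Longrightarrow> smooth_near M p g \<Longrightarrow> v (\<lambda>q. f q * g q) = f p * v g + g p * v f"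
    and tangent_cmult: "smooth_near M p f \<Longrightarrow> v (\<lambda>q. c * f q) = c * v f"
    and tangent_cong: "smooth_near M p f \<Longrightarrow> openin (mtop M) W \<Longrightarrow> p \<in> W \<Longrightarrow> (\<And>q. q \<in> W \<Longrightarrow> f q = g q) \<Longrightarrow> v f = v g"
    and tangent_nonsmooth: "\<not> smooth_near M p f \<Longrightarrow> v f = 0"
proof -
  note * = assms[unfolded tangent_def mem_Collect_eq]
  show "smooth_near M p f \<Longrightarrow> smooth_near M p g \<Longrightarrow> v (\<lambda>q. f q + g q) = v f + v g"
    by (rule *[THEN conjunct1, rule_format, THEN conjunct1])
  show "smooth_near M p f \<Longrightarrow> smooth_near M p g \<Longrightarrow> v (\<lambda>q. f q * g q) = f p * v g + g p * v f"
    by (rule *[THEN conjunct1, rule_format, THEN conjunct2])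
  show "smooth_near M p f \<Longrightarrow> v (\<lambda>q. c * f q) = c * v f"
    by (rule *[THEN conjunct2, THEN conjunct1, rule_format])
  show "smooth_near M p f \<Longrightarrow> openin (mtop M) W \<Longrightarrow> p \<in> W \<Longrightarrow> (\<And>q. q \<in> W \<Longrightarrow> f q = g q) \<Longrightarrow> v f = v g"
    by (rule *[THEN conjunct2, THEN conjunct2, THEN conjunct1, rule_format])
  show "\<not> smooth_near M p f \<Longrightarrow> v f = 0"
    by (rule *[THEN conjunct2, THEN conjunct2, THEN conjunct2, rule_format])
qed

lemma tangentI:
  assumes "\<And>f g. smooth_near M p f \<Longrightarrow> smooth_near M p g \<Longrightarrow> v (\<lambda>q. f q + g q) = v f + v g"
    and "\<And>f g. smooth_near M p f \<Longrightarrow> smooth_near M p g \<Longrightarrow> v (\<lambda>q. f q * g q) = f p * v g + g p * v f"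
    and "\<And>f c. smooth_near M p f \<Longrightarrow> v (\<lambda>q. c * f q) = c * v f"
    and "\<And>f g W. smooth_near M p f \<Longrightarrow> openin (mtop M) W \<Longrightarrow> p \<in> W \<Longrightarrow> (\<And>q. q \<in> W \<Longrightarrow> f q = g q) \<Longrightarrow> v f = v g"
    and "\<And>f. \<not> smooth_near M p f \<Longrightarrow> v f = 0"
  shows "v \<in> tangent M p"
  unfolding tangent_def mem_Collect_eq
proof (intro conjI allI impI)
  fix f g W assume "smooth_near M p f" "openin (mtop M) W" "p \<in> W" "\<forall>q\<in>W. f q = g q"
  then show "v f = v g" by (intro assms(4)[of f W g]) auto
qed (simp_all add: assms(1-3,5))

text \<open>The Leibniz rule for 1 * 1 gives v(1) = 2 v(1).\<close>

lemma tangent_const: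
  assumes "v \<in> tangent M p" "p \<in> points M"
  shows "v (\<lambda>_. c) = 0"
proof -
  have s: "smooth_near M p (\<lambda>_. c)" for c using smooth_near_const[OF assms(2)] .
  have "v (\<lambda>_. 1) = 0" using tangent_mult[OF assms(1) s s, of 1 1] by simp
  then show ?thesis using tangent_cmult[OF assms(1) s, of c 1] by simp
qed

lemma tangent_lin:
  assumes "v \<in> tangent M p" "w \<in> tangent M p"
  shows "(\<lambda>f. a * v f + b * w f) \<in> tangent M p"
proof (rule tangentI)
  fix f g W assume "smooth_near M p f" "openin (mtop M) W" "p \<in> W" and eq: "\<And>q. q \<in> W \<Longrightarrow> f q = g q"
  then have "v f = v g" "w f = w g" using tangent_cong[OF assms(1)] tangent_cong[OF assms(2)] by blast+
  then show "a * v f + b * w f = a * v g + b * w g" by simp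
next
  fix f assume "\<not> smooth_near M p f"
  then show "a * v f + b * w f = 0" using tangent_nonsmooth[OF assms(1)] tangent_nonsmooth[OF assms(2)] by simp
next
  fix f g assume "smooth_near M p f" "smooth_near M p g"
  then show "a * v (\<lambda>q. f q + g q) + b * w (\<lambda>q. f q + g q) = a * v f + b * w f + (a * v g + b * w g)"
    using tangent_add[OF assms(1), of f g] tangent_add[OF assms(2), of f g] by (simp add: algebra_simps)
next
  fix f g assume "smooth_near M p f" "smooth_near M p g"
  then show "a * v (\<lambda>q. f q * g q) + b * w (\<lambda>q. f q * g q) = f p * (a * v g + b * w g) + g p * (a * v f + b * w f)"
    using tangent_mult[OF assms(1), of f g] tangent_mult[OF assms(2), of f g] by (simp add: algebra_simps)
next
  fix f c assume "smooth_near M p f"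
  then show "a * v (\<lambda>q. c * f q) + b * w (\<lambda>q. c * f q) = c * (a * v f + b * w f)"
    using tangent_cmult[OF assms(1), of f c] tangent_cmult[OF assms(2), of f c] by (simp add: algebra_simps)
qed

lemma zero_tangent: "(\<lambda>_. 0) \<in> tangent M p"
  by (rule tangentI) auto

lemma tangent_map_tangent:
  assumes M: "charted M" and N: "charted N" and F: "smooth_map M N F" and p: "p \<in> points M" and v: "v \<in> tangent M p"
  shows "tangent_map M N F p v \<in> tangent N (F p)"
proof (rule tangentI)
  note near = smooth_map_near[OF F p]
  fix f g assume f: "smooth_near N (F p) f" and g: "smooth_near N (F p) g"
  show "tangent_map M N F p v (\<lambda>q. f q + g q) = tangent_map M N F p v f + tangent_map M N F p v g"
    using f g tangent_add[OF v near[OF f] near[OF g]] smooth_near_add[OF N f g] by (simp add: tangent_map_def)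
  show "tangent_map M N F p v (\<lambda>q. f q * g q) = f (F p) * tangent_map M N F p v g + g (F p) * tangent_map M N F p v f"
    using f g tangent_mult[OF v near[OF f] near[OF g]] smooth_near_mult[OF N f g] by (simp add: tangent_map_def)
  fix c
  show "tangent_map M N F p v (\<lambda>q. c * f q) = c * tangent_map M N F p v f"
    using f tangent_cmult[OF v near[OF f]] smooth_near_cmult[OF N f] by (simp add: tangent_map_def)
next
  fix f g W assume f: "smooth_near N (F p) f" and W: "openin (mtop N) W" "F p \<in> W" "\<And>q. q \<in> W \<Longrightarrow> f q = g q"
  have "v (\<lambda>q. f (F q)) = v (\<lambda>q. g (F q))"
    using W p openin_continuous_map_preimage[OF smooth_map_continuous[OF F] W(1)]
    by (intro tangent_cong[OF v smooth_map_near[OF F p f], of "{x \<in> topspace (mtop M). F x \<in> W}"]) auto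
  then show "tangent_map M N F p v f = tangent_map M N F p v g"
    using f smooth_near_cong[OF N W f] by (simp add: tangent_map_def)
qed (simp add: tangent_map_def)

lemma tangent_map_compose:
  assumes F: "smooth_map M N F" and G: "smooth_map N Q G" and p: "p \<in> points M"
  shows "tangent_map N Q G (F p) (tangent_map M N F p v) = tangent_map M Q (\<lambda>q. G (F q)) p v"
  using smooth_map_near[OF G smooth_map_points[OF F p]] by (auto simp: tangent_map_def fun_eq_iff)

lemma tangent_map_lin:
  "tangent_map M N F p (\<lambda>f. a * v f + b * w f) = (\<lambda>f. a * tangent_map M N F p v f + b * tangent_map M N F p w f)"
  by (auto simp: tangent_map_def)

lemma coord_vec_tangent:
  assumes M: "charted M" and c: "(U, \<phi>) \<in> atlas M" and p: "p \<in> U" and k: "k \<in> coords M"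
  shows "coord_vec M (U, \<phi>) p k \<in> tangent M p"
proof (rule tangentI)
  note fin = charted_finite[OF M]
  note ch = charted_chart[OF M c]
  fix f g assume f: "smooth_near M p f" and g: "smooth_near M p g"
  obtain V where V: "openin (powertop_real (coords M)) V" "\<phi> p \<in> V" "\<And>r. Ck_on (coords M) r V (\<lambda>y. f (inv_into U \<phi> y))"
    using smooth_near_chart[OF M c p f] by metis
  obtain V' where V': "openin (powertop_real (coords M)) V'" "\<phi> p \<in> V'" "\<And>r. Ck_on (coords M) r V' (\<lambda>y. g (inv_into U \<phi> y))"
    using smooth_near_chart[OF M c p g] by metis
  have o: "openin (powertop_real (coords M)) (V \<inter> V')" "\<phi> p \<in> V \<inter> V'" using V V' by auto
  have fV: "Ck_on (coords M) (Suc 0) (V \<inter> V') (\<lambda>y. f (inv_into U \<phi> y))" 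
    by (rule Ck_on_subset[OF Int_lower1 V(3)])
  have gV: "Ck_on (coords M) (Suc 0) (V \<inter> V') (\<lambda>y. g (inv_into U \<phi> y))" 
    by (rule Ck_on_subset[OF Int_lower2 V'(3)])
  have inv: "inv_into U \<phi> (\<phi> p) = p" using chart_inj[OF ch] p by (simp add: inv_into_f_f)
  show "coord_vec M (U, \<phi>) p k (\<lambda>q. f q + g q) = coord_vec M (U, \<phi>) p k f + coord_vec M (U, \<phi>) p k g"
    using f g smooth_near_add[OF M f g] partial_add[OF fin o(1) fV gV o(2) k] by (simp add: coord_vec_def)
  show "coord_vec M (U, \<phi>) p k (\<lambda>q. f q * g q) = f p * coord_vec M (U, \<phi>) p k g + g p * coord_vec M (U, \<phi>) p k f"
    using f g smooth_near_mult[OF M f g] partial_mult[OF fin o(1) fV gV o(2) k] inv by (simp add: coord_vec_def)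
  fix d
  show "coord_vec M (U, \<phi>) p k (\<lambda>q. d * f q) = d * coord_vec M (U, \<phi>) p k f"
    using f smooth_near_cmult[OF M f] partial_mult[OF fin o(1) Ck_on_const fV o(2) k, of d] 
    by (simp add: coord_vec_def partial_const)
next
  fix f g W assume f: "smooth_near M p f" and W: "openin (mtop M) W" "p \<in> W" "\<And>q. q \<in> W \<Longrightarrow> f q = g q"
  have "partial k (\<lambda>y. f (inv_into U \<phi> y)) (\<phi> p) = partial k (\<lambda>y. g (inv_into U \<phi> y)) (\<phi> p)"
    by (rule partial_cong[OF charted_finite[OF M] chart_image_open[OF charted_chart[OF M c] W(1)] _ k])
      (use p W chart_inj[OF charted_chart[OF M c]] in \<open>auto simp: inv_into_f_f\<close>)
  then show "coord_vec M (U, \<phi>) p k f = coord_vec M (U, \<phi>) p k g"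
    using f smooth_near_cong[OF M W f] by (simp add: coord_vec_def)
qed (simp add: coord_vec_def)

section \<open>Circle actions\<close>

lemma circle_action_orbit_smooth:
  assumes M: "smooth_manifold M" and a: "circle_action M a" and p: "p \<in> points M"
  shows "smooth_map real_line M (\<lambda>s. a (cis s) p)"
proof -
  note ch = smooth_manifold_charted[OF M]
  have "smooth_map real_line (mfd_times real_line M) (\<lambda>s. (s, p))"
  proof (rule smooth_mapI[OF charted_real_line charted_mfd_times[OF charted_real_line ch]])
    show "continuous_map (mtop real_line) (mtop (mfd_times real_line M)) (\<lambda>s. (s, p))"
      using p by (simp add: mfd_times_def real_line_def continuous_map_paired)
    fix t :: real
    obtain U \<phi> where U: "(U, \<phi>) \<in> atlas M" "p \<in> U" using charted_cover[OF ch p] .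
    have c: "(UNIV \<times> U, \<lambda>(x, y). restrict (case_sum (\<lambda>_. x) (\<phi> y)) (UNIV <+> coords M)) \<in> atlas (mfd_times real_line M)"
      using U by (auto simp: mfd_times_def real_line_def)
    have "smooth_near real_line t (\<lambda>s. restrict (case_sum (\<lambda>_. s) (\<phi> p)) (UNIV <+> coords M) k)"
      if "k \<in> coords (mfd_times real_line M)" for k
      using that smooth_near_const[of t real_line] 
      by (auto simp: mfd_times_def real_line_def smooth_near_real_line_id[unfolded real_line_def])
    then show "\<exists>(U, \<phi>)\<in>atlas (mfd_times real_line M). (t, p) \<in> U \<and> (\<forall>k\<in>coords (mfd_times real_line M). smooth_near real_line t (\<lambda>q. \<phi> (q, p) k))"
      using U(2) by (intro bexI[OF _ c]) auto
  qed
  then show ?thesis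
    using smooth_map_compose[of real_line "mfd_times real_line M" "\<lambda>s. (s, p)" M "\<lambda>(s, p). a (cis s) p"] a
    by (simp add: circle_action_def)
qed

lemma circle_action_smooth:
  assumes M: "smooth_manifold M" and a: "circle_action M a" and z: "z \<in> sphere 0 1"
  shows "smooth_map M M (a z)"
proof -
  note ch = smooth_manifold_charted[OF M]
  obtain s where s: "z = cis s" using z by (metis cis_Arg dist_0_norm mem_sphere norm_eq_zero sgn_div_norm div_by_1 scaleR_one inverse_1 zero_neq_one)
  have "smooth_map M (mfd_times real_line M) (\<lambda>p. (s, p))"
  proof (rule smooth_mapI[OF ch charted_mfd_times[OF charted_real_line ch]])
    show "continuous_map (mtop M) (mtop (mfd_times real_line M)) (\<lambda>p. (s, p))"
      by (simp add: mfd_times_def real_line_def continuous_map_paired)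
    fix p assume p: "p \<in> points M"
    obtain U \<phi> where U: "(U, \<phi>) \<in> atlas M" "p \<in> U" using charted_cover[OF ch p] .
    have c: "(UNIV \<times> U, \<lambda>(x, y). restrict (case_sum (\<lambda>_. x) (\<phi> y)) (UNIV <+> coords M)) \<in> atlas (mfd_times real_line M)"
      using U by (auto simp: mfd_times_def real_line_def)
    have "smooth_near M p (\<lambda>q. restrict (case_sum (\<lambda>_. s) (\<phi> q)) (UNIV <+> coords M) k)"
      if "k \<in> coords (mfd_times real_line M)" for k
      using that smooth_near_const[OF p] smooth_near_coord[OF M U]
      by (auto simp: mfd_times_def real_line_def)
    then show "\<exists>(U, \<phi>)\<in>atlas (mfd_times real_line M). (s, p) \<in> U \<and> (\<forall>k\<in>coords (mfd_times real_line M). smooth_near M p (\<lambda>q. \<phi> (s, q) k))"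
      using U(2) by (intro bexI[OF _ c]) auto
  qed
  then show ?thesis
    using smooth_map_compose[of M "mfd_times real_line M" "\<lambda>p. (s, p)" M "\<lambda>(s, p). a (cis s) p"] a
    by (simp add: circle_action_def s)
qed

text \<open>Phrased for a single smooth orbit, so that it applies to the diagonal action, whose
  orbits are treated componentwise.\<close>

lemma generating_field_tangent:
  assumes M: "charted M" and \<gamma>: "smooth_map real_line M (\<lambda>s. a (cis s) p)" and p: "p \<in> points M" "a 1 p = p"
  shows "generating_field M a p \<in> tangent M p"
proof -
  have t: "0 \<in> points real_line" by (simp add: real_line_def)
  have d: "((\<lambda>s. f (a (cis s) p)) has_real_derivative deriv (\<lambda>s. f (a (cis s) p)) 0) (at 0)"
    if "smooth_near M p f" for f
    using smooth_near_real_line_differentiable[OF smooth_map_near[OF \<gamma> t]] that p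
    by (simp add: DERIV_deriv_iff_real_differentiable)
  show ?thesis
  proof (rule tangentI)
    fix f g assume f: "smooth_near M p f" and g: "smooth_near M p g"
    show "generating_field M a p (\<lambda>q. f q + g q) = generating_field M a p f + generating_field M a p g"
      using f g smooth_near_add[OF M f g] DERIV_imp_deriv[OF DERIV_add[OF d[OF f] d[OF g]]] 
      by (simp add: generating_field_def)
    show "generating_field M a p (\<lambda>q. f q * g q) = f p * generating_field M a p g + g p * generating_field M a p f"
      using f g smooth_near_mult[OF M f g] DERIV_imp_deriv[OF DERIV_mult[OF d[OF f] d[OF g]]] p
      by (simp add: generating_field_def algebra_simps)
    fix c
    show "generating_field M a p (\<lambda>q. c * f q) = c * generating_field M a p f"
      using f smooth_near_cmult[OF M f] DERIV_imp_deriv[OF DERIV_cmult[OF d[OF f]]]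
      by (simp add: generating_field_def)
  next
    fix f g W assume f: "smooth_near M p f" and W: "openin (mtop M) W" "p \<in> W" "\<And>q. q \<in> W \<Longrightarrow> f q = g q"
    have "open {s. a (cis s) p \<in> W}"
      using openin_continuous_map_preimage[OF smooth_map_continuous[OF \<gamma>] W(1)] by (simp add: real_line_def)
    then have "\<forall>\<^sub>F s in nhds 0. a (cis s) p \<in> W"
      using W(2) p by (intro eventually_nhds_in_open[of "{s. a (cis s) p \<in> W}", simplified]) auto
    then have "\<forall>\<^sub>F s in nhds 0. f (a (cis s) p) = g (a (cis s) p)"
      by eventually_elim (rule W(3))
    then have "deriv (\<lambda>s. f (a (cis s) p)) 0 = deriv (\<lambda>s. g (a (cis s) p)) 0"
      by (rule deriv_cong_ev) simp
    then show "generating_field M a p f = generating_field M a p g"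
      using f smooth_near_cong[OF M W f] by (simp add: generating_field_def)
  qed (simp add: generating_field_def)
qed

text \<open>The chain rule along the orbit. It writes the generating field in coordinate vectors,
  the arguments on which \<open>has_ext_deriv\<close> says something.\<close>

lemma generating_field_coords:
  assumes M: "smooth_manifold M" and a: "circle_action M a" and c: "(U, \<phi>) \<in> atlas M" and p: "p \<in> U"
  shows "generating_field M a p = 
    (\<lambda>f. \<Sum>k\<in>coords M. deriv (\<lambda>s. \<phi> (a (cis s) p) k) 0 * coord_vec M (U, \<phi>) p k f)"
proof
  fix f
  note ch = smooth_manifold_charted[OF M]
  note chU = charted_chart[OF ch c]
  have pM: "p \<in> points M" using chart_subset[OF chU] p by blast
  have p1: "a (cis 0) p = p" using a pM by (simp add: circle_action_def)
  note \<gamma> = circle_action_orbit_smooth[OF M a pM]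
  have t: "0 \<in> points real_line" by (simp add: real_line_def)
  show "generating_field M a p f = (\<Sum>k\<in>coords M. deriv (\<lambda>s. \<phi> (a (cis s) p) k) 0 * coord_vec M (U, \<phi>) p k f)"
  proof (cases "smooth_near M p f")
    case True
    obtain V where V: "openin (powertop_real (coords M)) V" "\<phi> p \<in> V" "\<And>r. Ck_on (coords M) r V (\<lambda>y. f (inv_into U \<phi> y))"
      using smooth_near_chart[OF ch c p True] by metis
    have "open {s. a (cis s) p \<in> U}"
      using openin_continuous_map_preimage[OF smooth_map_continuous[OF \<gamma>] chart_open[OF chU]] by (simp add: real_line_def)
    then have ev: "\<forall>\<^sub>F s in nhds 0. a (cis s) p \<in> U"
      using p p1 by (intro eventually_nhds_in_open[of "{s. a (cis s) p \<in> U}", simplified]) auto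
    have "((\<lambda>s. \<phi> (a (cis s) p) k) has_real_derivative deriv (\<lambda>s. \<phi> (a (cis s) p) k) 0) (at 0)" if "k \<in> coords M" for k
      using smooth_near_real_line_differentiable[OF smooth_map_near[OF \<gamma> t]] smooth_near_coord[OF M c p that] p1
      by (simp add: DERIV_deriv_iff_real_differentiable)
    moreover have "\<forall>\<^sub>F s in nhds 0. \<phi> (a (cis s) p) \<in> extensional (coords M)"
      using ev by eventually_elim (rule chart_extensional[OF chU])
    ultimately have "((\<lambda>s. f (inv_into U \<phi> (\<phi> (a (cis s) p)))) has_real_derivative
      (\<Sum>k\<in>coords M. deriv (\<lambda>s. \<phi> (a (cis s) p) k) 0 * partial k (\<lambda>y. f (inv_into U \<phi> y)) (\<phi> (a (cis 0) p)))) (at 0)"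
      using V p1 by (intro DERIV_along_curve[where V = V and g = "\<lambda>y. f (inv_into U \<phi> y)" and \<gamma> = "\<lambda>s. \<phi> (a (cis s) p)"] charted_finite[OF ch]) (auto simp del: Ck_on.simps)
    moreover have "\<forall>\<^sub>F s in nhds 0. f (inv_into U \<phi> (\<phi> (a (cis s) p))) = f (a (cis s) p)"
      using ev by eventually_elim (simp add: inv_into_f_f[OF chart_inj[OF chU]])
    ultimately have "((\<lambda>s. f (a (cis s) p)) has_real_derivative
      (\<Sum>k\<in>coords M. deriv (\<lambda>s. \<phi> (a (cis s) p) k) 0 * partial k (\<lambda>y. f (inv_into U \<phi> y)) (\<phi> (a (cis 0) p)))) (at 0)"
      using DERIV_cong_ev[of 0 0 "\<lambda>s. f (inv_into U \<phi> (\<phi> (a (cis s) p)))" "\<lambda>s. f (a (cis s) p)"] by simp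
    from DERIV_imp_deriv[OF this] show ?thesis
      using True p1 by (simp add: generating_field_def coord_vec_def)
  qed (simp add: generating_field_def coord_vec_def)
qed

section \<open>The shuffle product\<close>

text \<open>The wedge product at one point with arguments of any type: besides tangent vectors,
  these will be coordinate indices that stand for the coordinate vectors at a moving point.\<close>

definition shuffle_prod :: "('v list \<Rightarrow> complex) \<Rightarrow> ('v list \<Rightarrow> complex) \<Rightarrow> 'v list \<Rightarrow> complex"
  where "shuffle_prod a b vs = (\<Sum>S\<in>Pow {..<length vs}.
    (-1) ^ card {(i, j). i \<in> S \<and> j \<in> {..<length vs} - S \<and> j < i} * a (nths vs S) * b (nths vs (- S)))"

text \<open>The parity involution of the graded algebra; it carries the sign in the antiderivation
  rules.\<close>

definition grade :: "('v list \<Rightarrow> complex) \<Rightarrow> 'v list \<Rightarrow> complex"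
  where "grade a vs = (-1) ^ length vs * a vs"

lemma wedge_shuffle_prod: "wedge \<alpha> \<beta> p vs = shuffle_prod (\<alpha> p) (\<beta> p) vs"
  by (simp add: wedge_def shuffle_prod_def)

lemma shuffle_prod_Nil [simp]: "shuffle_prod a b [] = a [] * b []"
  by (simp add: shuffle_prod_def)

text \<open>Shuffles are split by whether the first argument goes to \<open>a\<close> or to
  \<open>b\<close>; in the second case it passes all arguments of \<open>a\<close>, which costs the
  sign in \<open>grade\<close>. Read as contraction with \<open>v\<close>, this is the
  antiderivation rule, and it is the recursion behind all later inductions on argument
  lists.\<close>

lemma shuffle_prod_Cons:
  "shuffle_prod a b (v # vs) =
     shuffle_prod (\<lambda>us. a (v # us)) b vs + shuffle_prod (grade a) (\<lambda>us. b (v # us)) vs"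
proof -
  define n where "n = length vs"
  define t where "t = (\<lambda>S. (-1) ^ card {(i, j). i \<in> S \<and> j \<in> {..<Suc n} - S \<and> j < i} *
    a (nths (v # vs) S) * b (nths (v # vs) (- S)))"
  let ?inv = "\<lambda>S. {(i, j). i \<in> S \<and> j \<in> {..<n} - S \<and> j < i}"
  have fin: "finite (?inv S)" if "S \<subseteq> {..<n}" for S
    by (rule finite_subset[of _ "{..<n} \<times> {..<n}"]) (use that in auto)
  have inj: "inj_on ((`) Suc) X" for X by (simp add: inj_on_def inj_image_eq_iff)
  have inj0: "inj_on (\<lambda>S. insert 0 (Suc ` S)) X" for X
    by (intro inj_onI) (metis Diff_insert_absorb image_iff inj_Suc inj_image_eq_iff nat.distinct(1))
  have P: "Pow {..<Suc n} = (\<lambda>S. Suc ` S) ` Pow {..<n} \<union> (\<lambda>S. insert 0 (Suc ` S)) ` Pow {..<n}"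
    by (simp add: lessThan_Suc_eq_insert_0 Pow_insert image_Pow_surj[OF refl, symmetric] image_image)
  have "shuffle_prod a b (v # vs) = sum t (Pow {..<Suc n})"
    by (simp add: shuffle_prod_def t_def n_def)
  also have "\<dots> = sum t ((\<lambda>S. Suc ` S) ` Pow {..<n}) + sum t ((\<lambda>S. insert 0 (Suc ` S)) ` Pow {..<n})"
    unfolding P by (rule sum.union_disjoint) auto
  also have "\<dots> = (\<Sum>S\<in>Pow {..<n}. t (Suc ` S)) + (\<Sum>S\<in>Pow {..<n}. t (insert 0 (Suc ` S)))"
    by (simp add: sum.reindex inj inj0)
  also have "(\<Sum>S\<in>Pow {..<n}. t (Suc ` S)) = shuffle_prod (grade a) (\<lambda>us. b (v # us)) vs"
    unfolding shuffle_prod_def n_def[symmetric]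
  proof (rule sum.cong)
    fix S assume S: "S \<in> Pow {..<n}"
    \<comment> \<open>Position 0 belongs to \<open>b\<close> here, so besides the shifted inversions
      there is one inversion with 0 for every element of \<open>S\<close>.\<close>
    have "{(i, j). i \<in> Suc ` S \<and> j \<in> {..<Suc n} - Suc ` S \<and> j < i} =
        map_prod Suc Suc ` ?inv S \<union> (\<lambda>i. (Suc i, 0)) ` S"
      by (auto simp: image_iff less_Suc_eq_0_disj)
    moreover have "card (map_prod Suc Suc ` ?inv S \<union> (\<lambda>i. (Suc i, 0)) ` S) = card (?inv S) + card S"
      using S fin[of S] finite_subset[of S "{..<n}"]
      by (subst card_Un_disjoint) (auto simp: card_image inj_on_def prod.inj_map)
    moreover have "length (nths vs S) = card S"
      using S unfolding length_nths n_def by (intro arg_cong[where f = card]) auto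
    moreover have "nths (v # vs) (Suc ` S) = nths vs S" "nths (v # vs) (- Suc ` S) = v # nths vs (- S)"
      by (simp_all add: nths_Cons inj_image_mem_iff Compl_eq[symmetric])
    ultimately show "t (Suc ` S) = (-1) ^ card (?inv S) * grade a (nths vs S) * b (v # nths vs (- S))"
      by (simp add: t_def grade_def power_add mult_ac)
  qed simp
  also have "(\<Sum>S\<in>Pow {..<n}. t (insert 0 (Suc ` S))) = shuffle_prod (\<lambda>us. a (v # us)) b vs"
    unfolding shuffle_prod_def n_def[symmetric]
  proof (rule sum.cong)
    fix S assume S: "S \<in> Pow {..<n}"
    have "{(i, j). i \<in> insert 0 (Suc ` S) \<and> j \<in> {..<Suc n} - insert 0 (Suc ` S) \<and> j < i} =
        map_prod Suc Suc ` ?inv S"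
      by (auto simp: image_iff less_Suc_eq_0_disj)
    moreover have "card (map_prod Suc Suc ` ?inv S) = card (?inv S)"
      by (auto simp: card_image inj_on_def)
    moreover have "nths (v # vs) (insert 0 (Suc ` S)) = v # nths vs S" "nths (v # vs) (- insert 0 (Suc ` S)) = nths vs (- S)"
      by (simp_all add: nths_Cons inj_image_mem_iff Compl_eq[symmetric])
    ultimately show "t (insert 0 (Suc ` S)) = (-1) ^ card (?inv S) * a (v # nths vs S) * b (nths vs (- S))"
      by (simp add: t_def)
  qed simp
  finally show ?thesis by simp
qed

lemma shuffle_prod_cong:
  assumes "\<And>us. set us \<subseteq> set vs \<Longrightarrow> a us = a' us" "\<And>us. set us \<subseteq> set vs \<Longrightarrow> b us = b' us"
  shows "shuffle_prod a b vs = shuffle_prod a' b' vs"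
  unfolding shuffle_prod_def using assms by (intro sum.cong) (simp_all add: set_nths_subset)

lemma shuffle_prod_map:
  "shuffle_prod a b (map f vs) = shuffle_prod (\<lambda>us. a (map f us)) (\<lambda>us. b (map f us)) vs"
  by (simp add: shuffle_prod_def nths_map)

lemma shuffle_prod_lin_left:
  "shuffle_prod (\<lambda>us. c * a us + d * a' us) b vs = c * shuffle_prod a b vs + d * shuffle_prod a' b vs"
  by (simp add: shuffle_prod_def algebra_simps sum.distrib sum_distrib_left)

lemma shuffle_prod_lin_right:
  "shuffle_prod a (\<lambda>us. c * b us + d * b' us) vs = c * shuffle_prod a b vs + d * shuffle_prod a b' vs"
  by (simp add: shuffle_prod_def algebra_simps sum.distrib sum_distrib_left)

lemma shuffle_prod_diff_left: "shuffle_prod (\<lambda>us. a us - a' us) b vs = shuffle_prod a b vs - shuffle_prod a' b vs"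
  and shuffle_prod_uminus_left: "shuffle_prod (\<lambda>us. - a us) b vs = - shuffle_prod a b vs"
  and shuffle_prod_zero_left: "shuffle_prod (\<lambda>us. 0) b vs = 0"
  and shuffle_prod_diff_right: "shuffle_prod a (\<lambda>us. b us - b' us) vs = shuffle_prod a b vs - shuffle_prod a b' vs"
  and shuffle_prod_zero_right: "shuffle_prod a (\<lambda>us. 0) vs = 0"
  by (simp_all add: shuffle_prod_def algebra_simps sum.distrib sum_subtractf sum_negf)

lemma grade_Cons: "(\<lambda>us. grade a (v # us)) = (\<lambda>us. - grade (\<lambda>us. a (v # us)) us)"
  by (simp add: grade_def fun_eq_iff)

lemma grade_grade [simp]: "grade (grade a) = a"
  by (simp add: grade_def fun_eq_iff flip: power_add mult.assoc)

section \<open>Alternating multilinear maps on one tangent space\<close>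

definition alternating_on :: "'a tvec set \<Rightarrow> ('a tvec list \<Rightarrow> complex) \<Rightarrow> bool"
  where "alternating_on T \<omega> \<longleftrightarrow>
    (\<forall>vs. \<not> set vs \<subseteq> T \<longrightarrow> \<omega> vs = 0) \<and>
    (\<forall>us ws. \<forall>v\<in>T. \<forall>w\<in>T. \<forall>a b. set us \<subseteq> T \<longrightarrow> set ws \<subseteq> T \<longrightarrow>
       \<omega> (us @ (\<lambda>f. a * v f + b * w f) # ws) = of_real a * \<omega> (us @ v # ws) + of_real b * \<omega> (us @ w # ws)) \<and>
    (\<forall>us v vs ws. \<omega> (us @ v # vs @ v # ws) = 0)"

lemma
  assumes "alternating_on T \<omega>"
  shows alternating_on_outside: "\<not> set vs \<subseteq> T \<Longrightarrow> \<omega> vs = 0"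
    and alternating_on_lin: "v \<in> T \<Longrightarrow> w \<in> T \<Longrightarrow> set us \<subseteq> T \<Longrightarrow> set ws \<subseteq> T \<Longrightarrow>
      \<omega> (us @ (\<lambda>f. a * v f + b * w f) # ws) = of_real a * \<omega> (us @ v # ws) + of_real b * \<omega> (us @ w # ws)"
    and alternating_on_alt: "\<omega> (us @ v # vs @ v # ws) = 0"
  using assms by (simp_all add: alternating_on_def)

lemma alternating_on_zero: 
  assumes "alternating_on T \<omega>" "(\<lambda>_. 0) \<in> set vs" "(\<lambda>_. 0) \<in> T"
  shows "\<omega> vs = 0"
proof (cases "set vs \<subseteq> T")
  case True
  obtain us ws where vs: "vs = us @ (\<lambda>_. 0) # ws" using assms(2) by (meson split_list)
  then show ?thesis using alternating_on_lin[OF assms(1,3,3), of us ws 0 0] True by simp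
qed (use alternating_on_outside[OF assms(1)] in blast)

text \<open>It suffices to treat adjacent equal arguments. Polarisation at v + w then gives a sign
  change under adjacent swaps, and swaps bring any two equal arguments together.\<close>

lemma alternating_onI:
  assumes T: "\<And>v w a b. v \<in> T \<Longrightarrow> w \<in> T \<Longrightarrow> (\<lambda>f. a * v f + b * w f) \<in> T"
    and out: "\<And>vs. \<not> set vs \<subseteq> T \<Longrightarrow> \<omega> vs = 0"
    and lin: "\<And>us ws v w a b. v \<in> T \<Longrightarrow> w \<in> T \<Longrightarrow> set us \<subseteq> T \<Longrightarrow> set ws \<subseteq> T \<Longrightarrow>
       \<omega> (us @ (\<lambda>f. a * v f + b * w f) # ws) = of_real a * \<omega> (us @ v # ws) + of_real b * \<omega> (us @ w # ws)"
    and adj: "\<And>us v ws. \<omega> (us @ v # v # ws) = 0"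
  shows "alternating_on T \<omega>"
proof -
  have swap: "\<omega> (us @ v # w # ws) = - \<omega> (us @ w # v # ws)" for us v w ws
  proof (cases "set (us @ v # w # ws) \<subseteq> T")
    case True
    \<comment> \<open>The sum of \<open>v\<close> and \<open>w\<close>, in the literal shape to
      which \<open>lin\<close> and \<open>T\<close> apply.\<close>
    define x where "x = (\<lambda>f. 1 * v f + 1 * w f)"
    have xT: "x \<in> T" unfolding x_def using True by (intro T) auto
    have "\<omega> (us @ x # x # ws) = \<omega> (us @ v # x # ws) + \<omega> (us @ w # x # ws)"
      using lin[of v w us "x # ws" 1 1] True xT by (simp add: x_def)
    also have "\<omega> (us @ v # x # ws) = \<omega> (us @ v # v # ws) + \<omega> (us @ v # w # ws)"
      using lin[of v w "us @ [v]" ws 1 1] True by (simp add: x_def)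
    also have "\<omega> (us @ w # x # ws) = \<omega> (us @ w # v # ws) + \<omega> (us @ w # w # ws)"
      using lin[of v w "us @ [w]" ws 1 1] True by (simp add: x_def)
    finally show ?thesis using adj by (simp add: eq_neg_iff_add_eq_0)
  next
    case False
    then have "\<not> set (us @ w # v # ws) \<subseteq> T" by auto
    then show ?thesis using out[OF False] out[of "us @ w # v # ws"] by simp
  qed
  have "\<omega> (us @ v # vs @ v # ws) = 0" for us v vs ws
  proof (induction vs arbitrary: us)
    case (Cons w vs)
    then show ?case using swap[of us v w "vs @ v # ws"] Cons[of "us @ [w]"] by simp
  qed (simp add: adj)
  then show ?thesis using out lin by (simp add: alternating_on_def)
qed

lemma alternating_on_slice:
  assumes "alternating_on T \<omega>" shows "alternating_on T (\<lambda>us. \<omega> (v # us))"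
proof (cases "v \<in> T")
  case True
  show ?thesis unfolding alternating_on_def
    using alternating_on_outside[OF assms, of "v # _"] alternating_on_lin[OF assms, of _ _ "v # _"] 
      alternating_on_alt[OF assms, of "v # _"] True
    by simp
next
  case False
  then have "(\<lambda>us. \<omega> (v # us)) = (\<lambda>_. 0)" using alternating_on_outside[OF assms, of "v # _"] by (auto simp: fun_eq_iff)
  then show ?thesis by (simp add: alternating_on_def)
qed

lemma alternating_on_grade: "alternating_on T \<omega> \<Longrightarrow> alternating_on T (grade \<omega>)"
  unfolding alternating_on_def grade_def by (simp add: algebra_simps)

lemma shuffle_prod_outside:
  assumes "\<And>vs. \<not> set vs \<subseteq> T \<Longrightarrow> a vs = 0" "\<And>vs. \<not> set vs \<subseteq> T \<Longrightarrow> b vs = 0" "\<not> set vs \<subseteq> T"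
  shows "shuffle_prod a b vs = 0"
  using assms
proof (induction vs arbitrary: a b)
  case (Cons v vs)
  show ?case
  proof (cases "v \<in> T")
    case True
    then have v: "\<not> set vs \<subseteq> T" using Cons.prems by auto
    have "shuffle_prod (\<lambda>us. a (v # us)) b vs = 0" "shuffle_prod (grade a) (\<lambda>us. b (v # us)) vs = 0"
      by (rule Cons.IH[OF _ _ v]; simp add: grade_def Cons.prems)+
    then show ?thesis by (simp add: shuffle_prod_Cons)
  next
    case False
    then have "a (v # us) = 0" "b (v # us) = 0" for us using Cons.prems(1,2) by auto
    then show ?thesis by (simp add: shuffle_prod_Cons shuffle_prod_zero_left shuffle_prod_zero_right)
  qed
qed simp

text \<open>By \<open>shuffle_prod_Cons\<close> and induction on the arguments in front, for all
  pairs of factors since the recursion changes them. For a repeated argument at the head, the terms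
  with both copies in one factor vanish and the two mixed terms cancel by the sign of
  \<open>grade_Cons\<close>.\<close>

lemma alternating_on_shuffle_prod:
  assumes T: "\<And>v w a b. v \<in> T \<Longrightarrow> w \<in> T \<Longrightarrow> (\<lambda>f. a * v f + b * w f) \<in> T"
    and a: "alternating_on T \<alpha>" and b: "alternating_on T \<beta>"
  shows "alternating_on T (shuffle_prod \<alpha> \<beta>)"
proof (rule alternating_onI[OF T])
  show "shuffle_prod \<alpha> \<beta> vs = 0" if "\<not> set vs \<subseteq> T" for vs
    by (rule shuffle_prod_outside[OF _ _ that]) (use alternating_on_outside[OF a] alternating_on_outside[OF b] in auto)
  show "shuffle_prod \<alpha> \<beta> (us @ (\<lambda>f. c * v f + d * w f) # ws) =
      of_real c * shuffle_prod \<alpha> \<beta> (us @ v # ws) + of_real d * shuffle_prod \<alpha> \<beta> (us @ w # ws)"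
    if *: "v \<in> T" "w \<in> T" "set us \<subseteq> T" "set ws \<subseteq> T" for us ws v w c d
    using a b *(3)
  proof (induction us arbitrary: \<alpha> \<beta>)
    case Nil
    have lin: "(\<lambda>us. \<omega> ((\<lambda>f. c * v f + d * w f) # us)) = (\<lambda>us. of_real c * \<omega> (v # us) + of_real d * \<omega> (w # us))"
      if "alternating_on T \<omega>" for \<omega>
    proof
      fix us show "\<omega> ((\<lambda>f. c * v f + d * w f) # us) = of_real c * \<omega> (v # us) + of_real d * \<omega> (w # us)"
        using alternating_on_lin[OF that *(1,2), of "[]" us c d] alternating_on_outside[OF that, of "_ # us"] 
        by (cases "set us \<subseteq> T") auto
    qed
    show ?case
      by (simp add: shuffle_prod_Cons lin[OF Nil(1)] lin[OF Nil(2)] shuffle_prod_lin_left shuffle_prod_lin_right algebra_simps)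
  next
    case (Cons u us)
    then have us: "set us \<subseteq> T" by simp
    show ?case
      using Cons.IH[OF alternating_on_slice[OF Cons.prems(1)] Cons.prems(2) us]
       Cons.IH[OF alternating_on_grade[OF Cons.prems(1)] alternating_on_slice[OF Cons.prems(2)] us]
      by (simp add: shuffle_prod_Cons algebra_simps)
  qed
  show "shuffle_prod \<alpha> \<beta> (us @ v # v # ws) = 0" for us v ws
    using a b
  proof (induction us arbitrary: \<alpha> \<beta>)
    case Nil
    have "\<alpha> (v # v # us) = 0" "\<beta> (v # v # us) = 0" for us
      using alternating_on_alt[OF Nil(1), of "[]" v "[]"] alternating_on_alt[OF Nil(2), of "[]" v "[]"] by auto
    then show ?case
      by (simp add: shuffle_prod_Cons grade_Cons shuffle_prod_zero_left shuffle_prod_zero_right shuffle_prod_uminus_left)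
  next
    case (Cons u us)
    show ?case
      using Cons.IH[OF alternating_on_slice[OF Cons.prems(1)] Cons.prems(2)]
       Cons.IH[OF alternating_on_grade[OF Cons.prems(1)] alternating_on_slice[OF Cons.prems(2)]]
      by (simp add: shuffle_prod_Cons)
  qed
qed

section \<open>The algebra of forms\<close>

definition csmooth_near :: "('a, 'k) manifold \<Rightarrow> 'a \<Rightarrow> ('a \<Rightarrow> complex) \<Rightarrow> bool"
  where "csmooth_near M p f \<longleftrightarrow> smooth_near M p (\<lambda>q. Re (f q)) \<and> smooth_near M p (\<lambda>q. Im (f q))"

lemma csmooth_near_const: "p \<in> points M \<Longrightarrow> csmooth_near M p (\<lambda>_. c)"
  by (simp add: csmooth_near_def smooth_near_const)

lemma csmooth_near_add: "charted M \<Longrightarrow> csmooth_near M p f \<Longrightarrow> csmooth_near M p g \<Longrightarrow> csmooth_near M p (\<lambda>q. f q + g q)"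
  by (simp add: csmooth_near_def smooth_near_add)

lemma csmooth_near_mult: "charted M \<Longrightarrow> csmooth_near M p f \<Longrightarrow> csmooth_near M p g \<Longrightarrow> csmooth_near M p (\<lambda>q. f q * g q)"
  by (simp add: csmooth_near_def smooth_near_add smooth_near_mult smooth_near_diff)

lemma csmooth_near_points: "csmooth_near M p f \<Longrightarrow> p \<in> points M"
  by (auto simp: csmooth_near_def dest: smooth_near_points)

lemma csmooth_near_sum:
  assumes "charted M" "p \<in> points M" "\<And>i. i \<in> A \<Longrightarrow> csmooth_near M p (f i)"
  shows "csmooth_near M p (\<lambda>q. \<Sum>i\<in>A. f i q)"
  using assms(3) by (induction A rule: infinite_finite_induct) (auto intro: csmooth_near_const csmooth_near_add assms)

lemma csmooth_near_cong:
  assumes "charted M" "openin (mtop M) W" "p \<in> W" "\<And>q. q \<in> W \<Longrightarrow> f q = g q" "csmooth_near M p f"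
  shows "csmooth_near M p g"
  using assms smooth_near_cong[OF assms(1-3), of "\<lambda>q. Re (f q)" "\<lambda>q. Re (g q)"] 
    smooth_near_cong[OF assms(1-3), of "\<lambda>q. Im (f q)" "\<lambda>q. Im (g q)"]
  by (simp add: csmooth_near_def)

lemma csmooth_near_map: "smooth_map M N F \<Longrightarrow> p \<in> points M \<Longrightarrow> csmooth_near N (F p) f \<Longrightarrow> csmooth_near M p (\<lambda>q. f (F q))"
  using smooth_map_near[of M N F p "\<lambda>q. Re (f q)"] smooth_map_near[of M N F p "\<lambda>q. Im (f q)"]
  by (simp add: csmooth_near_def)

section \<open>Tangent vectors acting on complex-valued functions\<close>

lemma tvec_complex_const: "v \<in> tangent M p \<Longrightarrow> p \<in> points M \<Longrightarrow> tvec_complex v (\<lambda>_. c) = 0"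
  by (simp add: tvec_complex_def tangent_const complex_eq_iff)

lemma tvec_complex_add:
  assumes "v \<in> tangent M p" "csmooth_near M p f" "csmooth_near M p g"
  shows "tvec_complex v (\<lambda>q. f q + g q) = tvec_complex v f + tvec_complex v g"
  using assms tangent_add[OF assms(1), of "\<lambda>q. Re (f q)" "\<lambda>q. Re (g q)"]
    tangent_add[OF assms(1), of "\<lambda>q. Im (f q)" "\<lambda>q. Im (g q)"]
  by (simp add: tvec_complex_def csmooth_near_def complex_eq_iff)

lemma tangent_diff:
  assumes "charted M" "v \<in> tangent M p" "smooth_near M p f" "smooth_near M p g"
  shows "v (\<lambda>q. f q - g q) = v f - v g"
  using tangent_add[OF assms(2,3) smooth_near_cmult[OF assms(1,4), of "-1"]] tangent_cmult[OF assms(2,4), of "-1"] by simp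

lemma tvec_complex_mult:
  assumes M: "charted M" and v: "v \<in> tangent M p" and f: "csmooth_near M p f" and g: "csmooth_near M p g"
  shows "tvec_complex v (\<lambda>q. f q * g q) = f p * tvec_complex v g + g p * tvec_complex v f"
proof -
  have s: "smooth_near M p (\<lambda>q. Re (f q))" "smooth_near M p (\<lambda>q. Im (f q))" "smooth_near M p (\<lambda>q. Re (g q))" "smooth_near M p (\<lambda>q. Im (g q))"
    using f g by (simp_all add: csmooth_near_def)
  have "v (\<lambda>q. Re (f q) * Re (g q) - Im (f q) * Im (g q)) =
      Re (f p) * v (\<lambda>q. Re (g q)) + Re (g p) * v (\<lambda>q. Re (f q)) - (Im (f p) * v (\<lambda>q. Im (g q)) + Im (g p) * v (\<lambda>q. Im (f q)))"
    using tangent_diff[OF M v smooth_near_mult[OF M s(1,3)] smooth_near_mult[OF M s(2,4)]]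
      tangent_mult[OF v s(1,3)] tangent_mult[OF v s(2,4)] by simp
  moreover have "v (\<lambda>q. Re (f q) * Im (g q) + Im (f q) * Re (g q)) =
      Re (f p) * v (\<lambda>q. Im (g q)) + Im (g p) * v (\<lambda>q. Re (f q)) + (Im (f p) * v (\<lambda>q. Re (g q)) + Re (g p) * v (\<lambda>q. Im (f q)))"
    using tangent_add[OF v smooth_near_mult[OF M s(1,4)] smooth_near_mult[OF M s(2,3)]]
      tangent_mult[OF v s(1,4)] tangent_mult[OF v s(2,3)] by simp
  ultimately show ?thesis
    unfolding tvec_complex_def times_complex.sel by (simp add: complex_eq_iff algebra_simps)
qed

lemma tvec_complex_cmult:
  assumes "charted M" "v \<in> tangent M p" "csmooth_near M p f"
  shows "tvec_complex v (\<lambda>q. c * f q) = c * tvec_complex v f"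
  using tvec_complex_mult[OF assms(1,2) csmooth_near_const assms(3)] tvec_complex_const[OF assms(2)] csmooth_near_points[OF assms(3)]
  by simp

lemma tvec_complex_sum:
  assumes "charted M" "v \<in> tangent M p" "p \<in> points M" "\<And>i. i \<in> A \<Longrightarrow> csmooth_near M p (f i)"
  shows "tvec_complex v (\<lambda>q. \<Sum>i\<in>A. f i q) = (\<Sum>i\<in>A. tvec_complex v (f i))"
  using assms(4)
proof (induction A rule: infinite_finite_induct)
  case (insert i A)
  then show ?case using csmooth_near_sum[OF assms(1,3), of A f] tvec_complex_add[OF assms(2), of "f i" "\<lambda>q. \<Sum>i\<in>A. f i q"] by simp
qed (use tvec_complex_const[OF assms(2,3)] in auto)

lemma tvec_complex_cong:
  assumes "v \<in> tangent M p" "csmooth_near M p f" "openin (mtop M) W" "p \<in> W" "\<And>q. q \<in> W \<Longrightarrow> f q = g q"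
  shows "tvec_complex v f = tvec_complex v g"
  using assms tangent_cong[OF assms(1) _ assms(3,4), of "\<lambda>q. Re (f q)" "\<lambda>q. Re (g q)"]
    tangent_cong[OF assms(1) _ assms(3,4), of "\<lambda>q. Im (f q)" "\<lambda>q. Im (g q)"]
  by (simp add: tvec_complex_def csmooth_near_def)

text \<open>The right-hand side of \<open>has_ext_deriv\<close> on lists of coordinate indices.
  \<open>V\<close> is the frame at the point where the derivative is taken, while \<open>A q\<close>
  is meant to contain the frame at \<open>q\<close>.\<close>

definition ext_deriv_at :: "('k \<Rightarrow> 'a tvec) \<Rightarrow> ('a \<Rightarrow> 'k list \<Rightarrow> complex) \<Rightarrow> 'k list \<Rightarrow> complex"
  where "ext_deriv_at V A ks = (\<Sum>j<length ks. (-1) ^ j * tvec_complex (V (ks ! j)) (\<lambda>q. A q (nths ks (- {j}))))"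

lemma ext_deriv_at_Nil [simp]: "ext_deriv_at V A [] = 0"
  by (simp add: ext_deriv_at_def)

text \<open>Cartan's formula for a coordinate field: contraction of d A with \<open>k\<close>, plus
  d of the contraction of A, is the derivative of A along \<open>k\<close>.\<close>

lemma ext_deriv_at_Cons:
  "ext_deriv_at V A (k # ks) = tvec_complex (V k) (\<lambda>q. A q ks) - ext_deriv_at V (\<lambda>q us. A q (k # us)) ks"
proof -
  have 0: "nths (k # ks) (- {0}) = ks" by (simp add: nths_Cons nths_all)
  have 1: "nths (k # ks) (- {Suc j}) = k # nths ks (- {j})" for j
    by (simp add: nths_Cons) (simp add: Compl_eq)
  show ?thesis
    by (simp add: ext_deriv_at_def sum.lessThan_Suc_shift 0 1 sum_negf del: sum.lessThan_Suc)
qed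

lemma csmooth_near_shuffle_prod:
  assumes M: "charted M" and p: "p \<in> points M"
    and A: "\<And>us. set us \<subseteq> set ks \<Longrightarrow> csmooth_near M p (\<lambda>q. A q us)"
    and B: "\<And>us. set us \<subseteq> set ks \<Longrightarrow> csmooth_near M p (\<lambda>q. B q us)"
  shows "csmooth_near M p (\<lambda>q. shuffle_prod (A q) (B q) ks)"
  unfolding shuffle_prod_def
  by (intro csmooth_near_sum[OF M p] csmooth_near_mult[OF M] csmooth_near_const[OF p] A B set_nths_subset)

lemma tvec_complex_shuffle_prod:
  assumes M: "charted M" and p: "p \<in> points M" and v: "v \<in> tangent M p"
    and A: "\<And>us. set us \<subseteq> set ks \<Longrightarrow> csmooth_near M p (\<lambda>q. A q us)"
    and B: "\<And>us. set us \<subseteq> set ks \<Longrightarrow> csmooth_near M p (\<lambda>q. B q us)"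
  shows "tvec_complex v (\<lambda>q. shuffle_prod (A q) (B q) ks) =
    shuffle_prod (\<lambda>us. tvec_complex v (\<lambda>q. A q us)) (B p) ks + shuffle_prod (A p) (\<lambda>us. tvec_complex v (\<lambda>q. B q us)) ks"
proof -
  note A' = A[OF set_nths_subset] and B' = B[OF set_nths_subset]
  have "tvec_complex v (\<lambda>q. c * A q (nths ks S) * B q (nths ks (- S))) =
      c * tvec_complex v (\<lambda>q. A q (nths ks S)) * B p (nths ks (- S)) + c * A p (nths ks S) * tvec_complex v (\<lambda>q. B q (nths ks (- S)))" for S c
    using tvec_complex_mult[OF M v csmooth_near_mult[OF M csmooth_near_const[OF p, of c] A'[of S]] B'[of "- S"]]
      tvec_complex_cmult[OF M v A'[of S], of c] by (simp add: algebra_simps)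
  then show ?thesis
    unfolding shuffle_prod_def
    by (subst tvec_complex_sum[OF M v p])
      (auto intro!: csmooth_near_mult[OF M] csmooth_near_const[OF p] A' B' simp: sum.distrib)
qed

lemma ext_deriv_at_add:
  assumes V: "\<And>k. k \<in> K \<Longrightarrow> V k \<in> tangent M p"
    and A: "\<And>us. us \<in> lists K \<Longrightarrow> csmooth_near M p (\<lambda>q. A q us)"
    and B: "\<And>us. us \<in> lists K \<Longrightarrow> csmooth_near M p (\<lambda>q. B q us)" and ks: "ks \<in> lists K"
  shows "ext_deriv_at V (\<lambda>q us. A q us + B q us) ks = ext_deriv_at V A ks + ext_deriv_at V B ks"
proof -
  have n: "nths ks S \<in> lists K" for S using ks set_nths_subset[of ks S] by (auto simp: in_lists_conv_set)
  have "tvec_complex (V (ks ! j)) (\<lambda>q. A q (nths ks (- {j})) + B q (nths ks (- {j}))) =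
      tvec_complex (V (ks ! j)) (\<lambda>q. A q (nths ks (- {j}))) + tvec_complex (V (ks ! j)) (\<lambda>q. B q (nths ks (- {j})))"
    if "j < length ks" for j
    by (rule tvec_complex_add[OF V A[OF n] B[OF n]]) (use ks that in \<open>auto simp: in_lists_conv_set\<close>)
  then show ?thesis by (simp add: ext_deriv_at_def algebra_simps sum.distrib)
qed

text \<open>d raises the degree by one and therefore anticommutes with the parity sign.\<close>

lemma ext_deriv_at_grade:
  assumes M: "charted M" and V: "\<And>k. k \<in> K \<Longrightarrow> V k \<in> tangent M p"
    and A: "\<And>us. us \<in> lists K \<Longrightarrow> csmooth_near M p (\<lambda>q. A q us)" and ks: "ks \<in> lists K"
  shows "ext_deriv_at V (\<lambda>q. grade (A q)) ks = - grade (ext_deriv_at V A) ks"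
proof -
  have n: "nths ks S \<in> lists K" for S using ks set_nths_subset[of ks S] by (auto simp: in_lists_conv_set)
  have "tvec_complex (V (ks ! j)) (\<lambda>q. (-1) ^ length (nths ks (- {j})) * A q (nths ks (- {j}))) =
      - ((-1) ^ length ks * tvec_complex (V (ks ! j)) (\<lambda>q. A q (nths ks (- {j}))))"
    if j: "j < length ks" for j
  proof -
    have "length (nths ks (- {j})) = card ({..<length ks} - {j})"
      unfolding length_nths by (intro arg_cong[where f = card]) auto
    also have "\<dots> = length ks - 1" using j by simp
    finally have l: "length ks = Suc (length (nths ks (- {j})))" using j by simp
    have "ks ! j \<in> K" using ks j by (auto simp: in_lists_conv_set)
    from tvec_complex_cmult[OF M V[OF this] A[OF n]] show ?thesis unfolding l by simp
  qed
  then show ?thesis by (simp add: ext_deriv_at_def grade_def sum_negf sum_distrib_left mult_ac)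
qed

text \<open>The antiderivation rule for d. \<open>ext_deriv_at_Cons\<close> and
  \<open>shuffle_prod_Cons\<close> both peel off the first index, so induction reduces the claim to
  the Leibniz rule for the derivative along that index; the signs match by
  \<open>ext_deriv_at_grade\<close> and \<open>grade_Cons\<close>.\<close>

lemma ext_deriv_at_shuffle_prod:
  assumes M: "charted M" and p: "p \<in> points M" and V: "\<And>k. k \<in> K \<Longrightarrow> V k \<in> tangent M p"
    and "\<And>us. us \<in> lists K \<Longrightarrow> csmooth_near M p (\<lambda>q. A q us)"
    and "\<And>us. us \<in> lists K \<Longrightarrow> csmooth_near M p (\<lambda>q. B q us)" and "ks \<in> lists K"
  shows "ext_deriv_at V (\<lambda>q. shuffle_prod (A q) (B q)) ks =
    shuffle_prod (ext_deriv_at V A) (B p) ks + shuffle_prod (grade (A p)) (ext_deriv_at V B) ks"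
  using assms(4-6)
proof (induction ks arbitrary: A B)
  case (Cons k ks)
  then have k: "k \<in> K" and ks: "ks \<in> lists K" by auto
  have sub: "us \<in> lists K" if "set us \<subseteq> set vs" "vs \<in> lists K" for us vs using that by (auto simp: in_lists_conv_set)
  have A1: "csmooth_near M p (\<lambda>q. A q (k # us))" "csmooth_near M p (\<lambda>q. B q (k # us))" if "us \<in> lists K" for us
    using Cons.prems(1,2) k that by auto
  have A2: "csmooth_near M p (\<lambda>q. grade (A q) us)" if "us \<in> lists K" for us
    unfolding grade_def using Cons.prems(1)[OF that] by (intro csmooth_near_mult[OF M] csmooth_near_const[OF p])
  have s1: "csmooth_near M p (\<lambda>q. shuffle_prod (\<lambda>u. A q (k # u)) (B q) us)" if "us \<in> lists K" for us
    by (rule csmooth_near_shuffle_prod[OF M p]; rule A1(1) Cons.prems(2), erule sub[OF _ that])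
  have s2: "csmooth_near M p (\<lambda>q. shuffle_prod (grade (A q)) (\<lambda>u. B q (k # u)) us)" if "us \<in> lists K" for us
    by (rule csmooth_near_shuffle_prod[OF M p]; rule A2 A1(2), erule sub[OF _ that])
  have "ext_deriv_at V (\<lambda>q. shuffle_prod (A q) (B q)) (k # ks) =
      tvec_complex (V k) (\<lambda>q. shuffle_prod (A q) (B q) ks) -
      ext_deriv_at V (\<lambda>q us. shuffle_prod (\<lambda>u. A q (k # u)) (B q) us + shuffle_prod (grade (A q)) (\<lambda>u. B q (k # u)) us) ks"
    by (simp add: ext_deriv_at_Cons shuffle_prod_Cons)
  also have "ext_deriv_at V (\<lambda>q us. shuffle_prod (\<lambda>u. A q (k # u)) (B q) us + shuffle_prod (grade (A q)) (\<lambda>u. B q (k # u)) us) ks =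
      ext_deriv_at V (\<lambda>q. shuffle_prod (\<lambda>u. A q (k # u)) (B q)) ks + ext_deriv_at V (\<lambda>q. shuffle_prod (grade (A q)) (\<lambda>u. B q (k # u))) ks"
    by (rule ext_deriv_at_add[where K = K and M = M, OF V s1 s2 ks])
  also have "ext_deriv_at V (\<lambda>q. shuffle_prod (\<lambda>u. A q (k # u)) (B q)) ks =
      shuffle_prod (ext_deriv_at V (\<lambda>q u. A q (k # u))) (B p) ks + shuffle_prod (grade (\<lambda>u. A p (k # u))) (ext_deriv_at V B) ks"
    by (rule Cons.IH[OF A1(1) Cons.prems(2) ks])
  also have "ext_deriv_at V (\<lambda>q. shuffle_prod (grade (A q)) (\<lambda>u. B q (k # u))) ks =
      shuffle_prod (ext_deriv_at V (\<lambda>q. grade (A q))) (\<lambda>u. B p (k # u)) ks + shuffle_prod (A p) (ext_deriv_at V (\<lambda>q u. B q (k # u))) ks"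
    using Cons.IH[OF A2 A1(2) ks] by simp
  also have "shuffle_prod (ext_deriv_at V (\<lambda>q. grade (A q))) (\<lambda>u. B p (k # u)) ks =
      shuffle_prod (\<lambda>u. - grade (ext_deriv_at V A) u) (\<lambda>u. B p (k # u)) ks"
  proof (rule shuffle_prod_cong[OF _ refl])
    fix us assume "set us \<subseteq> set ks"
    from ext_deriv_at_grade[where K = K, OF M V Cons.prems(1) sub[OF this ks]]
    show "ext_deriv_at V (\<lambda>q. grade (A q)) us = - grade (ext_deriv_at V A) us" .
  qed
  also have "tvec_complex (V k) (\<lambda>q. shuffle_prod (A q) (B q) ks) =
      shuffle_prod (\<lambda>us. tvec_complex (V k) (\<lambda>q. A q us)) (B p) ks + shuffle_prod (A p) (\<lambda>us. tvec_complex (V k) (\<lambda>q. B q us)) ks"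
    by (rule tvec_complex_shuffle_prod[OF M p V[OF k]]; rule Cons.prems(1,2), erule sub[OF _ ks])
  finally show ?case
    by (simp add: shuffle_prod_Cons ext_deriv_at_Cons grade_Cons shuffle_prod_diff_left shuffle_prod_diff_right shuffle_prod_uminus_left)
qed simp

text \<open>Separates the condition at each point from smoothness, and states smoothness through
  germs. Both parts can then be transferred along wedge products and projections
  independently.\<close>

lemma forms_iff:
  assumes M: "charted M"
  shows "\<omega> \<in> forms M \<longleftrightarrow> (\<forall>p vs. p \<notin> points M \<longrightarrow> \<omega> p vs = 0) \<and>
    (\<forall>p\<in>points M. alternating_on (tangent M p) (\<omega> p)) \<and>
    (\<forall>U \<phi> ks p. (U, \<phi>) \<in> atlas M \<longrightarrow> ks \<in> lists (coords M) \<longrightarrow> p \<in> U \<longrightarrow>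
       csmooth_near M p (\<lambda>q. \<omega> q (map (coord_vec M (U, \<phi>) q) ks)))"
proof -
  have s: "(smooth_fun_on M (fst c) (\<lambda>q. Re (f q)) \<and> smooth_fun_on M (fst c) (\<lambda>q. Im (f q))) \<longleftrightarrow> (\<forall>p\<in>fst c. csmooth_near M p f)"
    if "c \<in> atlas M" for c f
  proof -
    have o: "openin (mtop M) (fst c)" using charted_chart[OF M that] chart_open by (metis prod.collapse)
    show ?thesis using smooth_fun_onI[OF M _ o] smooth_near_openin[OF o] by (auto simp: csmooth_near_def)
  qed
  have smooth: "(\<forall>c\<in>atlas M. \<forall>ks\<in>lists (coords M).
       smooth_fun_on M (fst c) (\<lambda>q. Re (\<omega> q (map (coord_vec M c q) ks))) \<and>
       smooth_fun_on M (fst c) (\<lambda>q. Im (\<omega> q (map (coord_vec M c q) ks)))) \<longleftrightarrow>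
    (\<forall>U \<phi> ks p. (U, \<phi>) \<in> atlas M \<longrightarrow> ks \<in> lists (coords M) \<longrightarrow> p \<in> U \<longrightarrow>
       csmooth_near M p (\<lambda>q. \<omega> q (map (coord_vec M (U, \<phi>) q) ks)))"
    using s by fastforce
  show ?thesis
    unfolding smooth[symmetric] forms_def mem_Collect_eq
  proof (intro iffI, goal_cases)
    case 1
    note h1 = 1[THEN conjunct1] and h2 = 1[THEN conjunct2, THEN conjunct1] 
      and h3 = 1[THEN conjunct2, THEN conjunct2, THEN conjunct1] and h4 = 1[THEN conjunct2, THEN conjunct2, THEN conjunct2]
    show ?case
    proof (intro conjI ballI)
      show "\<forall>p vs. p \<notin> points M \<longrightarrow> \<omega> p vs = 0" using h1 by blast
      fix p assume p: "p \<in> points M"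
      show "alternating_on (tangent M p) (\<omega> p)"
        unfolding alternating_on_def
        by (intro conjI, use h1 p in blast, rule bspec[OF h2 p], rule spec[OF h3])
    qed (use h4 in blast)+
  next
    case 2
    note h1 = 2[THEN conjunct1] and h2 = 2[THEN conjunct2, THEN conjunct1, unfolded alternating_on_def] and h4 = 2[THEN conjunct2, THEN conjunct2]
    show ?case
    proof (intro conjI)
      show "\<forall>p vs. \<not> (p \<in> points M \<and> set vs \<subseteq> tangent M p) \<longrightarrow> \<omega> p vs = 0"
        using h1 h2 by blast
      show "\<forall>p us v vs ws. \<omega> p (us @ v # vs @ v # ws) = 0"
        using h1 h2 by blast
    qed (rule ballI, drule bspec[OF h2], elim conjE, assumption, rule h4)
  qed
qed

lemma
  assumes "charted M" "\<omega> \<in> forms M"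
  shows form_outside: "p \<notin> points M \<Longrightarrow> \<omega> p vs = 0"
    and form_alternating: "p \<in> points M \<Longrightarrow> alternating_on (tangent M p) (\<omega> p)"
    and form_smooth: "(U, \<phi>) \<in> atlas M \<Longrightarrow> ks \<in> lists (coords M) \<Longrightarrow> p \<in> U \<Longrightarrow>
       csmooth_near M p (\<lambda>q. \<omega> q (map (coord_vec M (U, \<phi>) q) ks))"
proof -
  note * = assms(2)[unfolded forms_iff[OF assms(1)]]
  show "p \<notin> points M \<Longrightarrow> \<omega> p vs = 0"
    by (rule *[THEN conjunct1, rule_format])
  show "p \<in> points M \<Longrightarrow> alternating_on (tangent M p) (\<omega> p)"
    by (rule *[THEN conjunct2, THEN conjunct1, rule_format])
  show "(U, \<phi>) \<in> atlas M \<Longrightarrow> ks \<in> lists (coords M) \<Longrightarrow> p \<in> U \<Longrightarrow>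
       csmooth_near M p (\<lambda>q. \<omega> q (map (coord_vec M (U, \<phi>) q) ks))"
    by (rule *[THEN conjunct2, THEN conjunct2, THEN spec, THEN spec, THEN spec, THEN spec, THEN mp, THEN mp, THEN mp])
qed

lemma formI:
  assumes "charted M" "\<And>p vs. p \<notin> points M \<Longrightarrow> \<omega> p vs = 0"
    "\<And>p. p \<in> points M \<Longrightarrow> alternating_on (tangent M p) (\<omega> p)"
    "\<And>U \<phi> ks p. (U, \<phi>) \<in> atlas M \<Longrightarrow> ks \<in> lists (coords M) \<Longrightarrow> p \<in> U \<Longrightarrow>
       csmooth_near M p (\<lambda>q. \<omega> q (map (coord_vec M (U, \<phi>) q) ks))"
  shows "\<omega> \<in> forms M"
  unfolding forms_iff[OF assms(1)] using assms(2-4) by simp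

section \<open>Closure of forms under sum and wedge, and the rules for d, contraction and
  pullback\<close>

lemma alternating_on_add: "alternating_on T \<alpha> \<Longrightarrow> alternating_on T \<beta> \<Longrightarrow> alternating_on T (\<lambda>vs. \<alpha> vs + \<beta> vs)"
  unfolding alternating_on_def by (simp add: algebra_simps)

lemma forms_add:
  assumes M: "charted M" and a: "\<alpha> \<in> forms M" and b: "\<beta> \<in> forms M"
  shows "(\<lambda>p vs. \<alpha> p vs + \<beta> p vs) \<in> forms M"
  by (rule formI[OF M])
    (simp_all add: form_outside[OF M a] form_outside[OF M b] alternating_on_add form_alternating[OF M a] form_alternating[OF M b]
      csmooth_near_add[OF M] form_smooth[OF M a] form_smooth[OF M b])

lemma chart_point: "charted M \<Longrightarrow> (U, \<phi>) \<in> atlas M \<Longrightarrow> p \<in> U \<Longrightarrow> p \<in> points M"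
  using chart_subset charted_chart by blast

lemma forms_wedge:
  assumes M: "charted M" and a: "\<alpha> \<in> forms M" and b: "\<beta> \<in> forms M"
  shows "wedge \<alpha> \<beta> \<in> forms M"
proof (rule formI[OF M])
  show "wedge \<alpha> \<beta> p vs = 0" if "p \<notin> points M" for p vs
  proof -
    have "\<alpha> p = (\<lambda>_. 0)" by (rule ext) (rule form_outside[OF M a that])
    then show ?thesis by (simp add: wedge_shuffle_prod shuffle_prod_zero_left)
  qed
  show "alternating_on (tangent M p) (wedge \<alpha> \<beta> p)" if "p \<in> points M" for p
  proof -
    have "wedge \<alpha> \<beta> p = shuffle_prod (\<alpha> p) (\<beta> p)" by (rule ext) (rule wedge_shuffle_prod)
    then show ?thesis
      by (simp only:) (rule alternating_on_shuffle_prod[OF tangent_lin form_alternating[OF M a that] form_alternating[OF M b that]])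
  qed
  fix U \<phi> ks p assume c: "(U, \<phi>) \<in> atlas M" and ks: "ks \<in> lists (coords M)" and p: "p \<in> U"
  have sub: "us \<in> lists (coords M)" if "set us \<subseteq> set ks" for us using that ks by (auto simp: in_lists_conv_set)
  show "csmooth_near M p (\<lambda>q. wedge \<alpha> \<beta> q (map (coord_vec M (U, \<phi>) q) ks))"
    unfolding wedge_shuffle_prod shuffle_prod_map
    by (rule csmooth_near_shuffle_prod[OF M chart_point[OF M c p]])
      (auto intro!: form_smooth[OF M a c _ p] form_smooth[OF M b c _ p] dest: sub)
qed

lemma has_ext_deriv_iff:
  "has_ext_deriv M \<omega> \<eta> \<longleftrightarrow> (\<forall>U \<phi> p ks. (U, \<phi>) \<in> atlas M \<longrightarrow> p \<in> U \<longrightarrow> ks \<in> lists (coords M) \<longrightarrow>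
    \<eta> p (map (coord_vec M (U, \<phi>) p) ks) =
      ext_deriv_at (coord_vec M (U, \<phi>) p) (\<lambda>q us. \<omega> q (map (coord_vec M (U, \<phi>) q) us)) ks)"
  unfolding has_ext_deriv_def ext_deriv_at_def by (simp only: Ball_def split_paired_All fst_conv snd_conv) blast

lemma has_ext_deriv_add:
  assumes M: "charted M" and a: "\<alpha> \<in> forms M" and b: "\<beta> \<in> forms M"
    and d: "has_ext_deriv M \<alpha> \<alpha>'" "has_ext_deriv M \<beta> \<beta>'"
  shows "has_ext_deriv M (\<lambda>p vs. \<alpha> p vs + \<beta> p vs) (\<lambda>p vs. \<alpha>' p vs + \<beta>' p vs)"
  unfolding has_ext_deriv_iff
proof (intro allI impI)
  fix U \<phi> p ks assume c: "(U, \<phi>) \<in> atlas M" and p: "p \<in> U" and ks: "ks \<in> lists (coords M)"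
  then show "\<alpha>' p (map (coord_vec M (U, \<phi>) p) ks) + \<beta>' p (map (coord_vec M (U, \<phi>) p) ks) =
      ext_deriv_at (coord_vec M (U, \<phi>) p) (\<lambda>q us. \<alpha> q (map (coord_vec M (U, \<phi>) q) us) + \<beta> q (map (coord_vec M (U, \<phi>) q) us)) ks"
    using ext_deriv_at_add[where K = "coords M", OF coord_vec_tangent[OF M c p] form_smooth[OF M a c _ p] form_smooth[OF M b c _ p] ks]
      d unfolding has_ext_deriv_iff by auto
qed

text \<open>The derivatives enter through their values on coordinate vectors alone. Hence \<alpha>'
  and \<beta>' can be arbitrary functions with these values, such as contractions that have not been
  shown to be forms.\<close>

lemma has_ext_deriv_wedge:
  assumes M: "charted M" and a: "\<alpha> \<in> forms M" and b: "\<beta> \<in> forms M"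
    and d: "has_ext_deriv M \<alpha> \<alpha>'" "has_ext_deriv M \<beta> \<beta>'"
  shows "has_ext_deriv M (wedge \<alpha> \<beta>) (\<lambda>p vs. wedge \<alpha>' \<beta> p vs + wedge (\<lambda>p. grade (\<alpha> p)) \<beta>' p vs)"
  unfolding has_ext_deriv_iff
proof (intro allI impI)
  fix U \<phi> p ks assume c: "(U, \<phi>) \<in> atlas M" and p: "p \<in> U" and ks: "ks \<in> lists (coords M)"
  let ?V = "coord_vec M (U, \<phi>)"
  have sub: "us \<in> lists (coords M)" if "set us \<subseteq> set ks" for us using that ks by (auto simp: in_lists_conv_set)
  have "ext_deriv_at (?V p) (\<lambda>q us. wedge \<alpha> \<beta> q (map (?V q) us)) ks =
    ext_deriv_at (?V p) (\<lambda>q. shuffle_prod (\<lambda>us. \<alpha> q (map (?V q) us)) (\<lambda>us. \<beta> q (map (?V q) us))) ks"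
    by (simp add: wedge_shuffle_prod shuffle_prod_map)
  also have "\<dots> = shuffle_prod (ext_deriv_at (?V p) (\<lambda>q us. \<alpha> q (map (?V q) us))) (\<lambda>us. \<beta> p (map (?V p) us)) ks +
      shuffle_prod (grade (\<lambda>us. \<alpha> p (map (?V p) us))) (ext_deriv_at (?V p) (\<lambda>q us. \<beta> q (map (?V q) us))) ks"
    by (rule ext_deriv_at_shuffle_prod[where K = "coords M", OF M chart_point[OF M c p] coord_vec_tangent[OF M c p] form_smooth[OF M a c _ p] form_smooth[OF M b c _ p] ks])
  also have "shuffle_prod (ext_deriv_at (?V p) (\<lambda>q us. \<alpha> q (map (?V q) us))) (\<lambda>us. \<beta> p (map (?V p) us)) ks =
      shuffle_prod (\<lambda>us. \<alpha>' p (map (?V p) us)) (\<lambda>us. \<beta> p (map (?V p) us)) ks"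
    using d(1) c p sub by (intro shuffle_prod_cong) (auto simp: has_ext_deriv_iff)
  also have "shuffle_prod (grade (\<lambda>us. \<alpha> p (map (?V p) us))) (ext_deriv_at (?V p) (\<lambda>q us. \<beta> q (map (?V q) us))) ks =
      shuffle_prod (\<lambda>us. grade (\<alpha> p) (map (?V p) us)) (\<lambda>us. \<beta>' p (map (?V p) us)) ks"
    using d(2) c p sub by (intro shuffle_prod_cong) (auto simp: has_ext_deriv_iff grade_def)
  finally show "wedge \<alpha>' \<beta> p (map (?V p) ks) + wedge (\<lambda>p. grade (\<alpha> p)) \<beta>' p (map (?V p) ks) =
     ext_deriv_at (?V p) (\<lambda>q us. wedge \<alpha> \<beta> q (map (?V q) us)) ks"
    by (simp add: wedge_shuffle_prod shuffle_prod_map)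
qed

lemma interior_wedge:
  "interior X (wedge \<alpha> \<beta>) = (\<lambda>p vs. wedge (interior X \<alpha>) \<beta> p vs + wedge (\<lambda>p. grade (\<alpha> p)) (interior X \<beta>) p vs)"
  by (simp add: interior_def wedge_shuffle_prod shuffle_prod_Cons fun_eq_iff)

lemma pullback_wedge:
  assumes "charted M" "\<And>p. p \<in> points M \<Longrightarrow> F p \<in> points M" "\<alpha> \<in> forms M" "\<beta> \<in> forms M"
  shows "pullback M M F (wedge \<alpha> \<beta>) = wedge (pullback M M F \<alpha>) (pullback M M F \<beta>)"
proof (intro ext)
  fix p vs
  show "pullback M M F (wedge \<alpha> \<beta>) p vs = wedge (pullback M M F \<alpha>) (pullback M M F \<beta>) p vs"
  proof (cases "p \<in> points M \<and> set vs \<subseteq> tangent M p")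
    case True
    then show ?thesis
      unfolding wedge_shuffle_prod pullback_def
      by (auto simp: wedge_shuffle_prod shuffle_prod_map intro!: shuffle_prod_cong)
  next
    case False
    show ?thesis
    proof (cases "p \<in> points M")
      case True
      then have "\<not> set vs \<subseteq> tangent M p" using False by blast
      then have "shuffle_prod (pullback M M F \<alpha> p) (pullback M M F \<beta> p) vs = 0"
        by (intro shuffle_prod_outside[of "tangent M p"]) (auto simp: pullback_def)
      then show ?thesis
        using False by (auto simp add: wedge_shuffle_prod pullback_def[of M M F "wedge \<alpha> \<beta>"])
    next
      case False
      then show ?thesis by (simp add: wedge_shuffle_prod pullback_def shuffle_prod_zero_left)
    qed
  qed
qed

lemma zero_form_forms:
  assumes M: "charted M" and f: "\<And>p. p \<in> points M \<Longrightarrow> csmooth_near M p f"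
  shows "zero_form M f \<in> forms M"
proof (rule formI[OF M])
  show "alternating_on (tangent M p) (zero_form M f p)" for p by (auto simp: alternating_on_def zero_form_def)
  fix U \<phi> ks p assume c: "(U, \<phi>) \<in> atlas M" and p: "p \<in> U"
  note pM = chart_point[OF M c p]
  show "csmooth_near M p (\<lambda>q. zero_form M f q (map (coord_vec M (U, \<phi>) q) ks))"
  proof (cases "ks = []")
    case True
    show ?thesis by (rule csmooth_near_cong[OF M openin_topspace pM _ f[OF pM]]) (simp add: zero_form_def True)
  next
    case False
    then show ?thesis by (simp add: zero_form_def csmooth_near_const[OF pM])
  qed
qed (simp add: zero_form_def)

lemma has_ext_deriv_zero_form_const:
  assumes M: "charted M"
  shows "has_ext_deriv M (zero_form M (\<lambda>_. c)) (\<lambda>_ _. 0)"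
  unfolding has_ext_deriv_iff
proof (intro allI impI)
  fix U \<phi> p ks assume c: "(U, \<phi>) \<in> atlas M" and p: "p \<in> U" and ks: "ks \<in> lists (coords M)"
  note pM = chart_point[OF M c p]
  have "tvec_complex (coord_vec M (U, \<phi>) p k) (\<lambda>q. zero_form M (\<lambda>_. c) q us) = 0" if "k \<in> coords M" for k us
  proof -
    have "tvec_complex (coord_vec M (U, \<phi>) p k) (\<lambda>q. if us = [] then c else 0) = 
        tvec_complex (coord_vec M (U, \<phi>) p k) (\<lambda>q. zero_form M (\<lambda>_. c) q us)"
      by (rule tvec_complex_cong[OF coord_vec_tangent[OF M c p that] csmooth_near_const[OF pM] openin_topspace pM])
        (simp add: zero_form_def)
    then show ?thesis using tvec_complex_const[OF coord_vec_tangent[OF M c p that] pM] by metis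
  qed
  moreover have "ks ! j \<in> coords M" if "j < length ks" for j using ks that by (auto simp: in_lists_conv_set)
  \<comment> \<open>A 0-form sees whether the list is empty and nothing else; replacing the moving
    frame by \<open>undefined\<close> makes the arguments independent of \<open>q\<close>.\<close>
  moreover have "zero_form M (\<lambda>_. c) q (map (coord_vec M (U, \<phi>) q) us) = zero_form M (\<lambda>_. c) q (map undefined us)" for q us
    by (simp add: zero_form_def)
  ultimately show "0 = ext_deriv_at (coord_vec M (U, \<phi>) p) (\<lambda>q us. zero_form M (\<lambda>_. c) q (map (coord_vec M (U, \<phi>) q) us)) ks"
    unfolding ext_deriv_at_def by simp
qed

section \<open>Maps into and out of a product\<close>

lemma points_mfd_prod: "points (mfd_prod I M) = PiE I (\<lambda>i. points (M i))"
  by (simp add: mfd_prod_def)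

section \<open>Product charts and smoothness of projections\<close>

lemma prod_chart_component:
  assumes "\<And>i. i \<in> I \<Longrightarrow> is_chart (M i) (U i, \<phi> i)" "i \<in> I"
    and \<Phi>: "\<Phi> = (\<lambda>x. \<lambda>(i, k)\<in>(SIGMA i:I. coords (M i)). \<phi> i (x i) k)" and x: "x \<in> PiE I U"
  shows "(\<lambda>k\<in>coords (M i). \<Phi> x (i, k)) = \<phi> i (x i)"
proof -
  have "\<phi> i (x i) \<in> extensional (coords (M i))"
    using chart_extensional[OF assms(1)[OF assms(2)]] x assms(2) by (simp add: PiE_mem)
  then show ?thesis using assms(2) by (auto simp: \<Phi> extensional_def fun_eq_iff)
qed

lemma prod_chart_inv:
  assumes M: "charted (mfd_prod I M)" and ch: "\<And>i. i \<in> I \<Longrightarrow> is_chart (M i) (U i, \<phi> i)" and i: "i \<in> I"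
    and \<Phi>: "\<Phi> = (\<lambda>x. \<lambda>(i, k)\<in>(SIGMA i:I. coords (M i)). \<phi> i (x i) k)"
    and c: "(PiE I U, \<Phi>) \<in> atlas (mfd_prod I M)" and y: "y \<in> \<Phi> ` PiE I U"
  shows "inv_into (PiE I U) \<Phi> y i = inv_into (U i) (\<phi> i) (\<lambda>k\<in>coords (M i). y (i, k))"
proof -
  obtain x where x: "x \<in> PiE I U" "y = \<Phi> x" using y by blast
  have "inv_into (PiE I U) \<Phi> y = x" using chart_inj[OF charted_chart[OF M c]] x by (simp add: inv_into_f_f)
  moreover have "inv_into (U i) (\<phi> i) (\<phi> i (x i)) = x i"
    using chart_inj[OF ch[OF i]] x i by (simp add: inv_into_f_f PiE_mem)
  ultimately show ?thesis using prod_chart_component[OF ch i \<Phi> x(1)] x(2) by simp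
qed

text \<open>In a product chart the projection selects a block of coordinates; passing to another
  chart of the factor then applies a transition map of \<open>M i\<close>.\<close>

lemma smooth_map_proj:
  assumes I: "finite I" and M: "\<And>i. i \<in> I \<Longrightarrow> smooth_manifold (M i)" and i: "i \<in> I"
  shows "smooth_map (mfd_prod I M) (M i) (\<lambda>p. p i)"
proof -
  have cP: "charted (mfd_prod I M)" by (rule charted_mfd_prod[OF I smooth_manifold_charted[OF M]])
  note cM = smooth_manifold_charted[OF M]
  have cont: "continuous_map (mtop (mfd_prod I M)) (mtop (M i)) (\<lambda>p. p i)"
    unfolding mfd_prod_def manifold.simps by (rule continuous_map_product_projection[OF i])
  show ?thesis
  proof (rule smooth_mapI[OF cP cM[OF i] cont])
    fix p assume p: "p \<in> points (mfd_prod I M)"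
    then have pi: "p i \<in> points (M i)" using i by (auto simp: points_mfd_prod)
    obtain V \<psi> where V: "(V, \<psi>) \<in> atlas (M i)" "p i \<in> V" using charted_cover[OF cM[OF i] pi] .
    define W where "W = {q \<in> points (mfd_prod I M). q i \<in> V}"
    have W: "openin (mtop (mfd_prod I M)) W"
      unfolding W_def by (rule openin_continuous_map_preimage[OF cont chart_open[OF charted_chart[OF cM[OF i] V(1)]]])
    have "smooth_near (mfd_prod I M) p (\<lambda>q. \<psi> (q i) k)" if k: "k \<in> coords (M i)" for k
    proof (rule smooth_near_openin[OF W])
      show "p \<in> W" using p V by (simp add: W_def)
      show "smooth_fun_on (mfd_prod I M) W (\<lambda>q. \<psi> (q i) k)"
        unfolding smooth_fun_on_def Cinf_on_def
      proof (clarify)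
        fix X \<Phi> r assume c: "(X, \<Phi>) \<in> atlas (mfd_prod I M)"
        then obtain U \<phi> where X: "X = PiE I U" and \<Phi>: "\<Phi> = (\<lambda>x. \<lambda>(i, k)\<in>(SIGMA i:I. coords (M i)). \<phi> i (x i) k)"
          and U: "\<And>i. i \<in> I \<Longrightarrow> (U i, \<phi> i) \<in> atlas (M i)"
          by (elim mfd_prod_chartE) blast
        have ch: "is_chart (M i) (U i, \<phi> i)" if "i \<in> I" for i using charted_chart[OF cM[OF that] U[OF that]] .
        note chX = charted_chart[OF cP c]
        have o: "openin (powertop_real (coords (mfd_prod I M))) (\<Phi> ` (X \<inter> W))" by (rule chart_image_open[OF chX W])
        have "Ck_on (coords (mfd_prod I M)) r (\<Phi> ` (X \<inter> W))
           (\<lambda>y. \<psi> (inv_into (U i) (\<phi> i) (\<lambda>l\<in>coords (M i). y (i, l))) k)"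
        proof (rule Ck_on_compose[where g = "\<lambda>z. \<psi> (inv_into (U i) (\<phi> i) z) k" and h = "\<lambda>y. \<lambda>l\<in>coords (M i). y (i, l)",
             OF charted_finite[OF cP] o charted_finite[OF cM[OF i]] chart_image_open[OF ch[OF i] chart_open[OF charted_chart[OF cM[OF i] V(1)]]]])
          show "(\<lambda>y. \<lambda>l\<in>coords (M i). y (i, l)) ` \<Phi> ` (X \<inter> W) \<subseteq> \<phi> i ` (U i \<inter> V)"
            using prod_chart_component[OF ch i \<Phi>] i by (auto simp: X W_def PiE_mem)
          show "Ck_on (coords (mfd_prod I M)) r (\<Phi> ` (X \<inter> W)) (\<lambda>y. (\<lambda>l\<in>coords (M i). y (i, l)) l)"
            if "l \<in> coords (M i)" for l
            using that i Ck_on_coord[of "(i, l)" "coords (mfd_prod I M)"] by (simp add: mfd_prod_def)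
          show "Ck_on (coords (M i)) r (\<phi> i ` (U i \<inter> V)) (\<lambda>z. \<psi> (inv_into (U i) (\<phi> i) z) k)"
            using M[OF i] U[OF i] V(1) k by (fastforce simp: smooth_manifold_def smooth_transition_def Cinf_on_def)
        qed
        then show "Ck_on (coords (mfd_prod I M)) r (\<Phi> ` (X \<inter> W)) (\<lambda>y. \<psi> (inv_into X \<Phi> y i) k)"
          by (rule Ck_on_cong[OF charted_finite[OF cP] o, rotated])
            (use prod_chart_inv[OF cP ch i \<Phi> c[unfolded X]] in \<open>auto simp: X\<close>)
      qed
    qed
    then show "\<exists>(U, \<phi>)\<in>atlas (M i). p i \<in> U \<and> (\<forall>k\<in>coords (M i). smooth_near (mfd_prod I M) p (\<lambda>q. \<phi> (q i) k))"
      using V by auto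
  qed
qed

lemma smooth_map_into_prod:
  assumes I: "finite I" and M: "\<And>i. i \<in> I \<Longrightarrow> smooth_manifold (M i)" and N: "charted N"
    and F: "\<And>i. i \<in> I \<Longrightarrow> smooth_map N (M i) (\<lambda>q. F q i)" and ext: "\<And>q. q \<in> points N \<Longrightarrow> F q \<in> extensional I"
  shows "smooth_map N (mfd_prod I M) F"
proof (rule smooth_mapI[OF N charted_mfd_prod[OF I smooth_manifold_charted[OF M]]])
  show "continuous_map (mtop N) (mtop (mfd_prod I M)) F"
    using smooth_map_continuous[OF F] ext by (auto simp: mfd_prod_def continuous_map_componentwise)
  fix p assume p: "p \<in> points N"
  have "\<forall>i\<in>I. \<exists>c. c \<in> atlas (M i) \<and> F p i \<in> fst c"
    using charted_cover[OF smooth_manifold_charted[OF M] smooth_map_points[OF F p]] by (metis fst_conv)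
  then obtain c where c: "\<And>i. i \<in> I \<Longrightarrow> c i \<in> atlas (M i) \<and> F p i \<in> fst (c i)" by metis
  have at: "(PiE I (\<lambda>i. fst (c i)), \<lambda>x. \<lambda>(i, k)\<in>(SIGMA i:I. coords (M i)). snd (c i) (x i) k) \<in> atlas (mfd_prod I M)"
    using c by (intro mfd_prod_chart_mem) simp
  have mem: "F p \<in> PiE I (\<lambda>i. fst (c i))" using c ext[OF p] by (simp add: PiE_iff)
  have "smooth_near N p (\<lambda>q. (\<lambda>(i, k)\<in>(SIGMA i:I. coords (M i)). snd (c i) (F q i) k) j)"
    if jc: "j \<in> coords (mfd_prod I M)" for j
  proof -
    obtain i k where j: "j = (i, k)" "i \<in> I" "k \<in> coords (M i)" using jc by (cases j) (auto simp: mfd_prod_def)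
    have "smooth_near N p (\<lambda>q. snd (c i) (F q i) k)"
      by (rule smooth_map_near[OF F[OF j(2)] p smooth_near_coord[OF M[OF j(2)] _ _ j(3), where U = "fst (c i)"]]) (use c j in auto)
    then show ?thesis using j by simp
  qed
  then show "\<exists>(U, \<phi>)\<in>atlas (mfd_prod I M). F p \<in> U \<and> (\<forall>k\<in>coords (mfd_prod I M). smooth_near N p (\<lambda>q. \<phi> (F q) k))"
    using mem by (intro bexI[OF _ at]) (simp only: case_prod_conv; blast)
qed

lemma tvec_complex_tangent_map:
  assumes "smooth_map M N F" "p \<in> points M" "csmooth_near N (F p) f"
  shows "tvec_complex (tangent_map M N F p v) f = tvec_complex v (\<lambda>q. f (F q))"
  using assms by (simp add: tvec_complex_def tangent_map_def csmooth_near_def)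

lemma alternating_on_pullback:
  assumes N: "charted N" and M: "charted M" and F: "smooth_map N M F" and p: "p \<in> points N"
    and \<omega>: "alternating_on (tangent M (F p)) (\<omega> (F p))"
  shows "alternating_on (tangent N p) (pullback N M F \<omega> p)"
proof -
  have T: "set (map (tangent_map N M F p) vs) \<subseteq> tangent M (F p)" if "set vs \<subseteq> tangent N p" for vs
    using that tangent_map_tangent[OF N M F p] by auto
  show ?thesis
    unfolding alternating_on_def
  proof (intro conjI allI ballI impI)
    fix us ws v w a b
    assume *: "v \<in> tangent N p" "w \<in> tangent N p" "set us \<subseteq> tangent N p" "set ws \<subseteq> tangent N p"
    then show "pullback N M F \<omega> p (us @ (\<lambda>f. a * v f + b * w f) # ws) =
        of_real a * pullback N M F \<omega> p (us @ v # ws) + of_real b * pullback N M F \<omega> p (us @ w # ws)"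
      using p tangent_lin[OF *(1,2), of a b] alternating_on_lin[OF \<omega> tangent_map_tangent[OF N M F p *(1)] tangent_map_tangent[OF N M F p *(2)] T[OF *(3)] T[OF *(4)], of a b]
      by (simp add: pullback_def tangent_map_lin)
  next
    fix us v vs ws
    show "pullback N M F \<omega> p (us @ v # vs @ v # ws) = 0"
      using alternating_on_alt[OF \<omega>, of "map (tangent_map N M F p) us" _ "map (tangent_map N M F p) vs"]
      by (simp add: pullback_def)
  qed (simp add: pullback_def)
qed

locale manifold_family =
  fixes I :: "'i set" and M :: "'i \<Rightarrow> ('a, 'k) manifold"
  assumes finite_index: "finite I" and smooth: "\<And>i. i \<in> I \<Longrightarrow> smooth_manifold (M i)"
begin

abbreviation "P \<equiv> mfd_prod I M"

lemma charted_factor: "i \<in> I \<Longrightarrow> charted (M i)"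
  by (rule smooth_manifold_charted[OF smooth])

lemma charted_P: "charted P"
  by (rule charted_mfd_prod[OF finite_index charted_factor])

lemma proj_smooth: "i \<in> I \<Longrightarrow> smooth_map P (M i) (\<lambda>p. p i)"
  by (rule smooth_map_proj[OF finite_index smooth])

lemma proj_points: "i \<in> I \<Longrightarrow> p \<in> points P \<Longrightarrow> p i \<in> points (M i)"
  by (auto simp: points_mfd_prod)

lemma proj_near: "i \<in> I \<Longrightarrow> p \<in> points P \<Longrightarrow> smooth_near (M i) (p i) f \<Longrightarrow> smooth_near P p (\<lambda>q. f (q i))"
  using smooth_map_near[OF proj_smooth, of i p f] by simp

lemma proj_csmooth_near: "i \<in> I \<Longrightarrow> p \<in> points P \<Longrightarrow> csmooth_near (M i) (p i) f \<Longrightarrow> csmooth_near P p (\<lambda>q. f (q i))"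
  using csmooth_near_map[OF proj_smooth, of i p f] by simp

text \<open>Moving the coordinate (j, k) moves the k-th coordinate of factor j and leaves every
  other block of coordinates constant.\<close>

lemma tangent_map_proj_coord_vec:
  assumes U: "\<forall>i\<in>I. (U i, \<phi> i) \<in> atlas (M i)"
    and \<Phi>: "\<Phi> = (\<lambda>x. \<lambda>(i, k)\<in>(SIGMA i:I. coords (M i)). \<phi> i (x i) k)"
    and p: "p \<in> PiE I U" and i: "i \<in> I" and j: "j \<in> I" and k: "k \<in> coords (M j)"
  shows "tangent_map P (M i) (\<lambda>p. p i) p (coord_vec P (PiE I U, \<Phi>) p (j, k)) =
    (if j = i then coord_vec (M i) (U i, \<phi> i) (p i) k else (\<lambda>_. 0))"
proof
  fix f
  have ch: "is_chart (M i) (U i, \<phi> i)" if "i \<in> I" for i using charted_chart[OF charted_factor[OF that] bspec[OF U that]] .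
  have c: "(PiE I U, \<Phi>) \<in> atlas P" unfolding \<Phi> by (rule mfd_prod_chart_mem) (use U in blast)
  have pP: "p \<in> points P" using chart_point[OF charted_P c p] .
  show "tangent_map P (M i) (\<lambda>p. p i) p (coord_vec P (PiE I U, \<Phi>) p (j, k)) f =
    (if j = i then coord_vec (M i) (U i, \<phi> i) (p i) k else (\<lambda>_. 0)) f"
  proof (cases "smooth_near (M i) (p i) f")
    case True
    have jk: "(j, k) \<in> coords P" using j k by (simp add: mfd_prod_def)
    have o: "openin (powertop_real (coords P)) (\<Phi> ` PiE I U)"
      using chart_image_open[OF charted_chart[OF charted_P c] openin_topspace] chart_subset[OF charted_chart[OF charted_P c]]
      by (simp add: Int_absorb2)
    have "tangent_map P (M i) (\<lambda>p. p i) p (coord_vec P (PiE I U, \<Phi>) p (j, k)) f =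
        partial (j, k) (\<lambda>y. f (inv_into (PiE I U) \<Phi> y i)) (\<Phi> p)"
      using True proj_near[OF i pP True] by (simp add: tangent_map_def coord_vec_def)
    also have "\<dots> = partial (j, k) (\<lambda>y. f (inv_into (U i) (\<phi> i) (\<lambda>l\<in>coords (M i). y (i, l)))) (\<Phi> p)"
      by (rule partial_cong[OF charted_finite[OF charted_P] o imageI[OF p] jk])
        (simp add: prod_chart_inv[OF charted_P ch i \<Phi> c])
    also have "\<dots> = (if j = i then partial k (\<lambda>y. f (inv_into (U i) (\<phi> i) y)) (\<phi> i (p i)) else 0)"
    proof (cases "j = i")
      case True
      have pc: "(\<lambda>l\<in>coords (M i). \<Phi> p (i, l)) = \<phi> i (p i)" by (rule prod_chart_component[OF ch i \<Phi> p])
      have "(\<lambda>l\<in>coords (M i). ((\<Phi> p)((i, k) := s)) (i, l)) = (\<phi> i (p i))(k := s)" for s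
        using k True unfolding pc[symmetric] by (auto simp: fun_eq_iff)
      moreover have "\<Phi> p (i, k) = \<phi> i (p i) k" using i k True by (simp add: \<Phi>)
      ultimately show ?thesis using True by (simp add: partial_def del: fun_upd_apply)
    next
      case False
      then have "(\<lambda>l\<in>coords (M i). ((\<Phi> p)((j, k) := s)) (i, l)) = (\<lambda>l\<in>coords (M i). \<Phi> p (i, l))" for s
        by (auto simp: fun_eq_iff)
      then show ?thesis using False by (simp add: partial_def del: fun_upd_apply)
    qed
    finally show ?thesis using True by (simp add: coord_vec_def)
  next
    case False
    then show ?thesis by (simp add: tangent_map_def coord_vec_def)
  qed
qed

text \<open>An index from a factor other than i inserts the zero vector. The hypothesis on \<omega>
  is that zero arguments give 0, which holds for forms and also for the contraction in the moment
  map condition.\<close>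

lemma pullback_proj_coord:
  assumes U: "\<forall>i\<in>I. (U i, \<phi> i) \<in> atlas (M i)"
    and \<Phi>: "\<Phi> = (\<lambda>x. \<lambda>(i, k)\<in>(SIGMA i:I. coords (M i)). \<phi> i (x i) k)"
    and p: "p \<in> PiE I U" and i: "i \<in> I" and ks: "ks \<in> lists (coords P)"
    and zero: "\<And>vs. (\<lambda>_. 0) \<in> set vs \<Longrightarrow> \<omega> (p i) vs = 0"
  shows "pullback P (M i) (\<lambda>p. p i) \<omega> p (map (coord_vec P (PiE I U, \<Phi>) p) ks) =
    (if fst ` set ks \<subseteq> {i} then \<omega> (p i) (map (coord_vec (M i) (U i, \<phi> i) (p i)) (map snd ks)) else 0)"
proof -
  have c: "(PiE I U, \<Phi>) \<in> atlas P" unfolding \<Phi> by (rule mfd_prod_chart_mem) (use U in blast)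
  have pP: "p \<in> points P" using chart_point[OF charted_P c p] .
  have T: "tangent_map P (M i) (\<lambda>p. p i) p (coord_vec P (PiE I U, \<Phi>) p l) =
    (if fst l = i then coord_vec (M i) (U i, \<phi> i) (p i) (snd l) else (\<lambda>_. 0))" if "l \<in> set ks" for l
    using tangent_map_proj_coord_vec[OF U \<Phi> p i, of "fst l" "snd l"] ks that
    by (auto simp: in_lists_conv_set mfd_prod_def)
  have "pullback P (M i) (\<lambda>p. p i) \<omega> p (map (coord_vec P (PiE I U, \<Phi>) p) ks) =
     \<omega> (p i) (map (\<lambda>l. if fst l = i then coord_vec (M i) (U i, \<phi> i) (p i) (snd l) else (\<lambda>_. 0)) ks)"
    using pP coord_vec_tangent[OF charted_P c p] ks T
    by (auto simp: pullback_def in_lists_conv_set cong: map_cong)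
  also have "\<dots> = (if fst ` set ks \<subseteq> {i} then \<omega> (p i) (map (coord_vec (M i) (U i, \<phi> i) (p i)) (map snd ks)) else 0)"
  proof (cases "fst ` set ks \<subseteq> {i}")
    case True
    then have "map (\<lambda>l. if fst l = i then coord_vec (M i) (U i, \<phi> i) (p i) (snd l) else (\<lambda>_. 0)) ks =
       map (coord_vec (M i) (U i, \<phi> i) (p i)) (map snd ks)" by auto
    then show ?thesis using True by metis
  next
    case False
    then obtain l where "l \<in> set ks" "fst l \<noteq> i" by auto
    then have m: "(\<lambda>_. 0) \<in> set (map (\<lambda>l. if fst l = i then coord_vec (M i) (U i, \<phi> i) (p i) (snd l) else (\<lambda>_. 0)) ks)"
      by force
    from zero[OF m] show ?thesis by (simp only: False if_False)
  qed
  finally show ?thesis .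
qed

lemma form_zero:
  assumes "i \<in> I" "\<omega> \<in> forms (M i)" "(\<lambda>_. 0) \<in> set vs"
  shows "\<omega> q vs = 0"
  using form_outside[OF charted_factor[OF assms(1)] assms(2)] 
     alternating_on_zero[OF form_alternating[OF charted_factor[OF assms(1)] assms(2)] assms(3) zero_tangent] by blast

lemma pullback_proj_smooth:
  assumes i: "i \<in> I" and \<omega>: "\<omega> \<in> forms (M i)" and U: "\<forall>i\<in>I. (U i, \<phi> i) \<in> atlas (M i)"
    and p: "p \<in> PiE I U" and ks: "ks \<in> lists (coords P)"
  shows "csmooth_near (M i) (p i) (\<lambda>x. if fst ` set ks \<subseteq> {i} then \<omega> x (map (coord_vec (M i) (U i, \<phi> i) x) (map snd ks)) else 0)"
proof (cases "fst ` set ks \<subseteq> {i}")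
  case True
  have pU: "p i \<in> U i" using p i by (simp add: PiE_mem)
  have "map snd ks \<in> lists (coords (M i))" using ks True by (fastforce simp: in_lists_conv_set mfd_prod_def)
  from form_smooth[OF charted_factor[OF i] \<omega> bspec[OF U i] this pU] show ?thesis using True by simp
next
  case False
  have "p i \<in> points (M i)" using chart_point[OF charted_factor[OF i] bspec[OF U i]] p i by (simp add: PiE_mem)
  then show ?thesis using False by (simp add: csmooth_near_const)
qed

lemma pullback_proj_forms:
  assumes i: "i \<in> I" and \<omega>: "\<omega> \<in> forms (M i)"
  shows "pullback P (M i) (\<lambda>p. p i) \<omega> \<in> forms P"
proof (rule formI[OF charted_P])
  show "alternating_on (tangent P p) (pullback P (M i) (\<lambda>p. p i) \<omega> p)" if "p \<in> points P" for p
    by (rule alternating_on_pullback[OF charted_P charted_factor[OF i] proj_smooth[OF i] that])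
      (rule form_alternating[OF charted_factor[OF i] \<omega> proj_points[OF i that]])
  fix X \<Phi> ks p assume c: "(X, \<Phi>) \<in> atlas P" and ks: "ks \<in> lists (coords P)" and p: "p \<in> X"
  obtain U \<phi> where X: "X = PiE I U" and \<Phi>: "\<Phi> = (\<lambda>x. \<lambda>(i, k)\<in>(SIGMA i:I. coords (M i)). \<phi> i (x i) k)"
    and U: "\<forall>i\<in>I. (U i, \<phi> i) \<in> atlas (M i)"
    using c by (elim mfd_prod_chartE) blast
  show "csmooth_near P p (\<lambda>q. pullback P (M i) (\<lambda>p. p i) \<omega> q (map (coord_vec P (X, \<Phi>) q) ks))"
    by (rule csmooth_near_cong[OF charted_P chart_open[OF charted_chart[OF charted_P c]] p _ 
          proj_csmooth_near[OF i chart_point[OF charted_P c p] pullback_proj_smooth[OF i \<omega> U p[unfolded X] ks]]])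
      (use pullback_proj_coord[OF U \<Phi> _ i ks form_zero[OF i \<omega>]] in \<open>simp add: X\<close>)
qed (simp add: pullback_def)

text \<open>If all indices belong to factor i, this is the formula for d there. Otherwise fix an
  index of another factor. Deleting a position of factor i leaves that index in the list, so the
  coefficient is 0; deleting a position of another factor differentiates a function of
  \<open>q i\<close> in a direction that does not move \<open>q i\<close>.\<close>

lemma pullback_proj_ext_deriv:
  assumes i: "i \<in> I" and \<omega>: "\<omega> \<in> forms (M i)" and \<eta>: "\<And>q vs. (\<lambda>_. 0) \<in> set vs \<Longrightarrow> \<eta> q vs = 0"
    and d: "has_ext_deriv (M i) \<omega> \<eta>"
  shows "has_ext_deriv P (pullback P (M i) (\<lambda>p. p i) \<omega>) (pullback P (M i) (\<lambda>p. p i) \<eta>)"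
  unfolding has_ext_deriv_iff
proof (intro allI impI)
  fix X \<Phi> p ks assume c: "(X, \<Phi>) \<in> atlas P" and p: "p \<in> X" and ks: "ks \<in> lists (coords P)"
  obtain U \<phi> where X: "X = PiE I U" and \<Phi>: "\<Phi> = (\<lambda>x. \<lambda>(i, k)\<in>(SIGMA i:I. coords (M i)). \<phi> i (x i) k)"
    and U: "\<forall>i\<in>I. (U i, \<phi> i) \<in> atlas (M i)"
    using c by (elim mfd_prod_chartE) blast
  have pP: "p \<in> points P" using chart_point[OF charted_P c p] .
  let ?V = "coord_vec (M i) (U i, \<phi> i)"
  \<comment> \<open>\<open>G us\<close> is the coefficient of the pullback at the indices
    \<open>us\<close>, as a function on factor i.\<close>
  define G where "G = (\<lambda>us x. if fst ` set us \<subseteq> {i} then \<omega> x (map (?V x) (map snd us)) else 0)"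
  have n: "nths ks S \<in> lists (coords P)" for S using ks set_nths_subset[of ks S] by (auto simp: in_lists_conv_set)
  have tm: "tvec_complex (coord_vec P (X, \<Phi>) p (ks ! j)) (\<lambda>q. pullback P (M i) (\<lambda>p. p i) \<omega> q (map (coord_vec P (X, \<Phi>) q) (nths ks (- {j})))) =
      (if fst (ks ! j) = i then tvec_complex (?V (p i) (snd (ks ! j))) (G (nths ks (- {j}))) else 0)" (is "?l = ?r")
    if j: "j < length ks" for j
  proof -
    have kj: "ks ! j \<in> coords P" using ks j by (auto simp: in_lists_conv_set)
    have sm: "csmooth_near (M i) (p i) (G (nths ks (- {j})))"
      unfolding G_def by (rule pullback_proj_smooth[OF i \<omega> U p[unfolded X] n])
    have "?l = tvec_complex (coord_vec P (X, \<Phi>) p (ks ! j)) (\<lambda>q. G (nths ks (- {j})) (q i))"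
      by (rule sym, rule tvec_complex_cong[OF coord_vec_tangent[OF charted_P c p kj] proj_csmooth_near[OF i pP sm] 
            chart_open[OF charted_chart[OF charted_P c]] p])
        (use pullback_proj_coord[OF U \<Phi> _ i n form_zero[OF i \<omega>]] in \<open>simp add: X G_def\<close>)
    also have "\<dots> = tvec_complex (tangent_map P (M i) (\<lambda>p. p i) p (coord_vec P (X, \<Phi>) p (ks ! j))) (G (nths ks (- {j})))"
      by (rule tvec_complex_tangent_map[where F = "\<lambda>p. p i", OF proj_smooth[OF i] pP sm, symmetric])
    also have "\<dots> = ?r"
      using tangent_map_proj_coord_vec[OF U \<Phi> p[unfolded X] i, of "fst (ks ! j)" "snd (ks ! j)"] kj
      by (auto simp: X mfd_prod_def tvec_complex_def complex_eq_iff)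
    finally show ?thesis .
  qed
  show "pullback P (M i) (\<lambda>p. p i) \<eta> p (map (coord_vec P (X, \<Phi>) p) ks) =
      ext_deriv_at (coord_vec P (X, \<Phi>) p) (\<lambda>q us. pullback P (M i) (\<lambda>p. p i) \<omega> q (map (coord_vec P (X, \<Phi>) q) us)) ks"
  proof (cases "fst ` set ks \<subseteq> {i}")
    case True
    have "map snd ks \<in> lists (coords (M i))" using ks True by (fastforce simp: in_lists_conv_set mfd_prod_def)
    moreover have "p i \<in> U i" using p X i by (simp add: PiE_mem)
    ultimately have "\<eta> (p i) (map (?V (p i)) (map snd ks)) =
        ext_deriv_at (?V (p i)) (\<lambda>q us. \<omega> q (map (?V q) us)) (map snd ks)"
      using d bspec[OF U i] unfolding has_ext_deriv_iff by blast
    also have "\<dots> = (\<Sum>j<length ks. (-1) ^ j * tvec_complex (?V (p i) (snd (ks ! j))) (G (nths ks (- {j}))))"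
    proof -
      have "G (nths ks (- {j})) = (\<lambda>q. \<omega> q (map (?V q) (nths (map snd ks) (- {j}))))" for j
      proof -
        have "fst ` set (nths ks (- {j})) \<subseteq> {i}" using True set_nths_subset[of ks "- {j}"] by blast
        then show ?thesis by (simp add: G_def nths_map)
      qed
      then show ?thesis unfolding ext_deriv_at_def by simp
    qed
    also have "\<dots> = ext_deriv_at (coord_vec P (X, \<Phi>) p) (\<lambda>q us. pullback P (M i) (\<lambda>p. p i) \<omega> q (map (coord_vec P (X, \<Phi>) q) us)) ks"
      unfolding ext_deriv_at_def
    proof (intro sum.cong refl)
      fix j assume "j \<in> {..<length ks}"
      then have j: "j < length ks" by simp
      then have "fst (ks ! j) = i" using True nth_mem by blast
      then show "(-1) ^ j * tvec_complex (?V (p i) (snd (ks ! j))) (G (nths ks (- {j}))) = 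
          (-1) ^ j * tvec_complex (coord_vec P (X, \<Phi>) p (ks ! j)) (\<lambda>q. pullback P (M i) (\<lambda>p. p i) \<omega> q (map (coord_vec P (X, \<Phi>) q) (nths ks (- {j}))))"
        unfolding tm[OF j] by simp
    qed
    finally show ?thesis
      using pullback_proj_coord[OF U \<Phi> p[unfolded X] i ks \<eta>] True by (simp add: X)
  next
    case False
    then obtain l where l: "l \<in> set ks" "fst l \<noteq> i" by auto
    have pi: "p i \<in> U i" using p X i by (simp add: PiE_mem)
    have "(if fst (ks ! j) = i then tvec_complex (?V (p i) (snd (ks ! j))) (G (nths ks (- {j}))) else 0) = 0"
      if j: "j < length ks" for j
    proof (cases "fst (ks ! j) = i")
      case True
      then have "l \<in> set (nths ks (- {j}))"
        using l by (auto simp: set_nths in_set_conv_nth)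
      then have "\<not> fst ` set (nths ks (- {j})) \<subseteq> {i}" using l(2) by blast
      then have "G (nths ks (- {j})) = (\<lambda>_. 0)" by (simp add: G_def)
      moreover have "snd (ks ! j) \<in> coords (M i)" using True nth_mem[OF j] ks by (auto simp: in_lists_conv_set mfd_prod_def)
      ultimately show ?thesis
        using tvec_complex_const[OF coord_vec_tangent[OF charted_factor[OF i] bspec[OF U i] pi] proj_points[OF i pP]] by simp
    qed simp
    then have "ext_deriv_at (coord_vec P (X, \<Phi>) p) (\<lambda>q us. pullback P (M i) (\<lambda>p. p i) \<omega> q (map (coord_vec P (X, \<Phi>) q) us)) ks = 0"
      unfolding ext_deriv_at_def by (simp add: tm)
    then show ?thesis
      using pullback_proj_coord[OF U \<Phi> p[unfolded X] i ks \<eta>] False by (simp add: X)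
  qed
qed

end

section \<open>Invariance of the moment map\<close>

lemma alternating_on_sum:
  assumes T: "\<And>v w a b. v \<in> T \<Longrightarrow> w \<in> T \<Longrightarrow> (\<lambda>f. a * v f + b * w f) \<in> T" and zero: "(\<lambda>_. 0) \<in> T"
    and \<omega>: "alternating_on T \<omega>" and v: "\<And>k. k \<in> K \<Longrightarrow> v k \<in> T" and K: "finite K" and us: "set us \<subseteq> T" "set ws \<subseteq> T"
  shows "\<omega> (us @ (\<lambda>f. \<Sum>k\<in>K. c k * v k f) # ws) = (\<Sum>k\<in>K. of_real (c k) * \<omega> (us @ v k # ws))"
    and "(\<lambda>f. \<Sum>k\<in>K. c k * v k f) \<in> T"
proof -
  have "\<omega> (us @ (\<lambda>f. \<Sum>k\<in>K. c k * v k f) # ws) = (\<Sum>k\<in>K. of_real (c k) * \<omega> (us @ v k # ws)) \<and>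
     (\<lambda>f. \<Sum>k\<in>K. c k * v k f) \<in> T"
    using K v
  proof (induction K rule: finite_induct)
    case empty
    then show ?case using alternating_on_zero[OF \<omega> _ zero] zero by simp
  next
    case (insert k K)
    then have IH: "\<omega> (us @ (\<lambda>f. \<Sum>k\<in>K. c k * v k f) # ws) = (\<Sum>k\<in>K. of_real (c k) * \<omega> (us @ v k # ws))"
      "(\<lambda>f. \<Sum>k\<in>K. c k * v k f) \<in> T" and vk: "v k \<in> T" by simp_all
    have "(\<lambda>f. \<Sum>k\<in>insert k K. c k * v k f) = (\<lambda>f. c k * v k f + 1 * (\<Sum>k\<in>K. c k * v k f))"
      using insert by simp
    then show ?case
      using alternating_on_lin[OF \<omega> vk IH(2) us, of "c k" 1] T[OF vk IH(2), of "c k" 1] insert IH by simp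
  qed
  then show "\<omega> (us @ (\<lambda>f. \<Sum>k\<in>K. c k * v k f) # ws) = (\<Sum>k\<in>K. of_real (c k) * \<omega> (us @ v k # ws))"
    and "(\<lambda>f. \<Sum>k\<in>K. c k * v k f) \<in> T" by blast+
qed

text \<open>The derivative of \<open>\<mu>\<close> along the generating field \<open>X\<close> is \<open>x(X, X) = 0\<close>.\<close>

lemma moment_map_generating_field:
  assumes M: "smooth_manifold M" and a: "circle_action M a" and x: "x \<in> forms M" and \<mu>: "moment_map M a x \<mu>" and p: "p \<in> points M"
  shows "generating_field M a p \<mu> = 0"
proof -
  note ch = smooth_manifold_charted[OF M]
  obtain U \<phi> where c: "(U, \<phi>) \<in> atlas M" and pU: "p \<in> U" using charted_cover[OF ch p] .
  define d where "d = (\<lambda>k. deriv (\<lambda>s. \<phi> (a (cis s) p) k) 0)"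
  let ?V = "coord_vec M (U, \<phi>)" and ?X = "generating_field M a p"
  have X: "?X = (\<lambda>f. \<Sum>k\<in>coords M. d k * ?V p k f)"
    unfolding d_def by (rule generating_field_coords[OF M a c pU])
  have XT: "?X \<in> tangent M p"
    using a p by (intro generating_field_tangent[where a = a and p = p, OF ch circle_action_orbit_smooth[OF M a p] p]) (simp add: circle_action_def)
  have alt: "alternating_on (tangent M p) (x p)" by (rule form_alternating[OF ch x p])
  have sm: "smooth_near M p \<mu>"
    using \<mu> p unfolding moment_map_def by (blast intro: smooth_near_openin[OF openin_topspace])
  have de: "has_ext_deriv M (zero_form M (\<lambda>p. of_real (\<mu> p))) (interior (generating_field M a) x)"
    using \<mu> by (simp add: moment_map_def)
  \<comment> \<open>The moment map condition on one coordinate vector. Summing over \<open>k\<close>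
    with the coordinates of the generating field puts that field into the second argument
    too.\<close>
  have "x p [?X, ?V p k] = of_real (?V p k \<mu>)" if k: "k \<in> coords M" for k
  proof -
    have "interior (generating_field M a) x p (map (?V p) [k]) =
        ext_deriv_at (?V p) (\<lambda>q us. zero_form M (\<lambda>p. of_real (\<mu> p)) q (map (?V q) us)) [k]"
      by (rule de[unfolded has_ext_deriv_iff, rule_format, OF c pU]) (simp add: k)
    also have "\<dots> = tvec_complex (?V p k) (\<lambda>q. zero_form M (\<lambda>p. of_real (\<mu> p)) q [])"
      by (simp add: ext_deriv_at_Cons)
    also have "\<dots> = tvec_complex (?V p k) (\<lambda>q. of_real (\<mu> q))"
      by (rule sym, rule tvec_complex_cong[OF coord_vec_tangent[OF ch c pU k] _ openin_topspace p])
        (simp_all add: zero_form_def csmooth_near_def sm smooth_near_const[OF p])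
    also have "\<dots> = of_real (?V p k \<mu>)"
      using tangent_const[OF coord_vec_tangent[OF ch c pU k] p] by (simp add: tvec_complex_def complex_eq_iff)
    finally show ?thesis by (simp add: interior_def)
  qed
  then have *: "complex_of_real (?X \<mu>) = (\<Sum>k\<in>coords M. of_real (d k) * x p ([?X] @ ?V p k # []))"
    using fun_cong[OF X, of \<mu>] by simp
  have "x p ([?X] @ (\<lambda>f. \<Sum>k\<in>coords M. d k * ?V p k f) # []) = (\<Sum>k\<in>coords M. of_real (d k) * x p ([?X] @ ?V p k # []))"
    by (rule alternating_on_sum(1)[OF tangent_lin zero_tangent alt coord_vec_tangent[OF ch c pU] charted_finite[OF ch]])
      (simp_all add: XT)
  then have "complex_of_real (?X \<mu>) = x p ([] @ ?X # [] @ ?X # [])"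
    unfolding * X[symmetric] by simp
  also have "\<dots> = 0" by (rule alternating_on_alt[OF alt])
  finally show ?thesis by simp
qed

text \<open>\<mu> is constant along the orbit because its derivative vanishes at every time, by
  \<open>moment_map_generating_field\<close> at the point reached.\<close>

lemma moment_map_invariant:
  assumes M: "smooth_manifold M" and a: "circle_action M a" and x: "x \<in> forms M" and \<mu>: "moment_map M a x \<mu>" 
    and p: "p \<in> points M" and z: "z \<in> sphere 0 1"
  shows "\<mu> (a z p) = \<mu> p"
proof -
  obtain t where t: "z = cis t" using z by (metis cis_Arg dist_0_norm mem_sphere norm_eq_zero sgn_div_norm div_by_1 scaleR_one inverse_1 zero_neq_one)
  have D: "((\<lambda>s. \<mu> (a (cis s) p)) has_real_derivative 0) (at t)" for t
  proof -
    \<comment> \<open>\<open>generating_field\<close> differentiates at time 0; restarting the orbit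
      at the point reached at time \<open>t\<close> moves the derivative there.\<close>
    define q where "q = a (cis t) p"
    have q: "q \<in> points M" using a p unfolding q_def circle_action_def by simp
    have q1: "a (cis 0) q = q" using a q by (simp add: circle_action_def)
    have sm: "smooth_near M q \<mu>"
      using \<mu> q unfolding moment_map_def by (blast intro: smooth_near_openin[OF openin_topspace])
    have "(\<lambda>s. \<mu> (a (cis s) q)) differentiable (at 0)"
      by (rule smooth_near_real_line_differentiable[OF smooth_map_near[OF circle_action_orbit_smooth[OF M a q]]])
        (use sm q1 in \<open>simp_all add: real_line_def\<close>)
    then have "((\<lambda>s. \<mu> (a (cis s) q)) has_real_derivative 0) (at (t + - t))"
      using moment_map_generating_field[OF M a x \<mu> q] sm
      by (simp add: DERIV_deriv_iff_real_differentiable[symmetric] generating_field_def)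
    then have "((\<lambda>s. \<mu> (a (cis (s + - t)) q)) has_real_derivative 0) (at t)"
      by (simp only: DERIV_shift)
    moreover have "a (cis (s + - t)) q = a (cis s) p" for s
    proof -
      have "a (cis (s + - t) * cis t) p = a (cis (s + - t)) (a (cis t) p)"
        using a p unfolding circle_action_def by simp
      then show ?thesis unfolding q_def by (simp add: cis_mult)
    qed
    ultimately show ?thesis by simp
  qed
  have "\<mu> (a (cis t) p) = \<mu> (a (cis 0) p)"
    using DERIV_isconst_all[of "\<lambda>s. \<mu> (a (cis s) p)" t 0] D by blast
  then show ?thesis using a p t by (simp add: circle_action_def)
qed

section \<open>The diagonal action\<close>

locale circle_family = manifold_family I M for I :: "'i set" and M :: "'i \<Rightarrow> ('a, 'k) manifold" +
  fixes a :: "'i \<Rightarrow> complex \<Rightarrow> 'a \<Rightarrow> 'a"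
  assumes action: "\<And>i. i \<in> I \<Longrightarrow> circle_action (M i) (a i)"
begin

abbreviation "aP \<equiv> diagonal_action I a"

lemma diagonal_action_component: "i \<in> I \<Longrightarrow> aP z p i = a i z (p i)"
  by (simp add: diagonal_action_def)

lemma diagonal_action_smooth:
  assumes "z \<in> sphere 0 1" shows "smooth_map P P (aP z)"
proof (rule smooth_map_into_prod[OF finite_index smooth charted_P])
  fix i assume i: "i \<in> I"
  show "smooth_map P (M i) (\<lambda>q. aP z q i)"
    unfolding diagonal_action_component[OF i]
    by (rule smooth_map_compose[OF proj_smooth[OF i] circle_action_smooth[OF smooth[OF i] action[OF i] assms]])
qed (assumption, simp add: diagonal_action_def)

lemma diagonal_action_orbit_smooth:
  assumes "p \<in> points P" shows "smooth_map real_line P (\<lambda>s. aP (cis s) p)"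
proof (rule smooth_map_into_prod[OF finite_index smooth charted_real_line])
  fix i assume i: "i \<in> I"
  show "smooth_map real_line (M i) (\<lambda>s. aP (cis s) p i)"
    unfolding diagonal_action_component[OF i]
    by (rule circle_action_orbit_smooth[OF smooth[OF i] action[OF i] proj_points[OF i assms]])
qed (assumption, simp add: diagonal_action_def)

lemma diagonal_action_points: "z \<in> sphere 0 1 \<Longrightarrow> p \<in> points P \<Longrightarrow> aP z p \<in> points P"
  using smooth_map_points[OF diagonal_action_smooth] .

lemma diagonal_action_one:
  assumes "p \<in> points P" shows "aP 1 p = p"
proof
  fix i show "aP 1 p i = p i"
    using assms action[of i] by (cases "i \<in> I") (auto simp: diagonal_action_def points_mfd_prod circle_action_def PiE_iff extensional_def)
qed

lemma diagonal_generating_field_tangent: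
  assumes "p \<in> points P" shows "generating_field P aP p \<in> tangent P p"
  by (rule generating_field_tangent[where a = aP and p = p, OF charted_P diagonal_action_orbit_smooth[OF assms] assms diagonal_action_one[OF assms]])

lemma tangent_map_proj_generating_field:
  assumes i: "i \<in> I" and p: "p \<in> points P"
  shows "tangent_map P (M i) (\<lambda>p. p i) p (generating_field P aP p) = generating_field (M i) (a i) (p i)"
proof
  fix f
  show "tangent_map P (M i) (\<lambda>p. p i) p (generating_field P aP p) f = generating_field (M i) (a i) (p i) f"
    using proj_near[OF i p] by (simp add: tangent_map_def generating_field_def diagonal_action_component[OF i])
qed

lemma fixed_points_diagonal: "fixed_points P aP = PiE I (\<lambda>i. fixed_points (M i) (a i))"
proof (rule equalityI; rule subsetI)
  fix p assume p: "p \<in> fixed_points P aP"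
  then have "a i z (p i) = p i" if "i \<in> I" "z \<in> sphere 0 1" for i z
    using that diagonal_action_component[OF that(1), of z p] by (simp add: fixed_points_def)
  then show "p \<in> PiE I (\<lambda>i. fixed_points (M i) (a i))"
    using p by (auto simp: fixed_points_def points_mfd_prod PiE_iff)
next
  fix p assume p: "p \<in> PiE I (\<lambda>i. fixed_points (M i) (a i))"
  have "aP z p = p" if "z \<in> sphere 0 1" for z
  proof
    fix i show "aP z p i = p i"
      using p that by (cases "i \<in> I") (auto simp: diagonal_action_def PiE_iff extensional_def fixed_points_def)
  qed
  then show "p \<in> fixed_points P aP"
    using p by (auto simp: fixed_points_def points_mfd_prod PiE_iff)
qed

text \<open>The projection is equivariant for the diagonal action, so both pullbacks come from the
  same composite map to factor i.\<close>

lemma pullback_proj_invariant: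
  assumes i: "i \<in> I" and \<omega>: "\<omega> \<in> invariant_forms (M i) (a i)"
  shows "pullback P (M i) (\<lambda>p. p i) \<omega> \<in> invariant_forms P aP"
  unfolding invariant_forms_def mem_Collect_eq
proof (intro conjI ballI)
  show "pullback P (M i) (\<lambda>p. p i) \<omega> \<in> forms P"
    using \<omega> by (intro pullback_proj_forms[OF i]) (simp add: invariant_forms_def)
  fix z :: complex assume z: "z \<in> sphere 0 1"
  show "pullback P P (aP z) (pullback P (M i) (\<lambda>p. p i) \<omega>) = pullback P (M i) (\<lambda>p. p i) \<omega>"
  proof (intro ext)
    fix p vs
    show "pullback P P (aP z) (pullback P (M i) (\<lambda>p. p i) \<omega>) p vs = pullback P (M i) (\<lambda>p. p i) \<omega> p vs"
    proof (cases "p \<in> points P \<and> set vs \<subseteq> tangent P p")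
      case True
      then have p: "p \<in> points P" and vs: "set vs \<subseteq> tangent P p" by auto
      note az = circle_action_smooth[OF smooth[OF i] action[OF i] z]
      have T: "tangent_map P (M i) (\<lambda>p. p i) (aP z p) (tangent_map P P (aP z) p v) =
          tangent_map (M i) (M i) (a i z) (p i) (tangent_map P (M i) (\<lambda>p. p i) p v)" for v
        using tangent_map_compose[where G = "\<lambda>p. p i", OF diagonal_action_smooth[OF z] proj_smooth[OF i] p, of v]
          tangent_map_compose[where F = "\<lambda>p. p i", OF proj_smooth[OF i] az p, of v]
        by (simp add: diagonal_action_component[OF i])
      have T1: "set (map (tangent_map P P (aP z) p) vs) \<subseteq> tangent P (aP z p)"
        using vs tangent_map_tangent[OF charted_P charted_P diagonal_action_smooth[OF z] p] by auto
      have T2: "set (map (tangent_map P (M i) (\<lambda>p. p i) p) vs) \<subseteq> tangent (M i) (p i)"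
        using vs tangent_map_tangent[where F = "\<lambda>p. p i", OF charted_P charted_factor[OF i] proj_smooth[OF i] p] by auto
      have "pullback P P (aP z) (pullback P (M i) (\<lambda>p. p i) \<omega>) p vs =
          \<omega> (aP z p i) (map (tangent_map P (M i) (\<lambda>p. p i) (aP z p)) (map (tangent_map P P (aP z) p) vs))"
        using p vs T1 diagonal_action_points[OF z p] by (simp add: pullback_def)
      also have "\<dots> = \<omega> (a i z (p i)) (map (tangent_map (M i) (M i) (a i z) (p i)) (map (tangent_map P (M i) (\<lambda>p. p i) p) vs))"
        by (simp add: T diagonal_action_component[OF i] cong: map_cong)
      also have "\<dots> = pullback (M i) (M i) (a i z) \<omega> (p i) (map (tangent_map P (M i) (\<lambda>p. p i) p) vs)"
        using proj_points[OF i p] T2 by (simp add: pullback_def)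
      also have "pullback (M i) (M i) (a i z) \<omega> = \<omega>" using \<omega> z by (simp add: invariant_forms_def)
      also have "\<omega> (p i) (map (tangent_map P (M i) (\<lambda>p. p i) p) vs) = pullback P (M i) (\<lambda>p. p i) \<omega> p vs"
        using p vs by (simp add: pullback_def)
      finally show ?thesis .
    qed (auto simp: pullback_def)
  qed
qed

lemma zero_form_pullback_proj:
  "i \<in> I \<Longrightarrow> zero_form P (\<lambda>p. f (p i)) = pullback P (M i) (\<lambda>p. p i) (zero_form (M i) f)"
  by (auto simp: zero_form_def pullback_def fun_eq_iff proj_points)

lemma pullback_proj_interior:
  assumes i: "i \<in> I"
  shows "pullback P (M i) (\<lambda>p. p i) (interior (generating_field (M i) (a i)) \<omega>) =
    interior (generating_field P aP) (pullback P (M i) (\<lambda>p. p i) \<omega>)"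
proof (intro ext)
  fix p vs
  show "pullback P (M i) (\<lambda>p. p i) (interior (generating_field (M i) (a i)) \<omega>) p vs =
    interior (generating_field P aP) (pullback P (M i) (\<lambda>p. p i) \<omega>) p vs"
    using tangent_map_proj_generating_field[OF i, of p] diagonal_generating_field_tangent[of p]
    by (cases "p \<in> points P") (simp_all add: pullback_def interior_def)
qed

lemma moment_zero_form_invariant:
  assumes i: "i \<in> I" and x: "x \<in> invariant_forms (M i) (a i)" and \<mu>: "moment_map (M i) (a i) x \<mu>"
  shows "zero_form (M i) (\<lambda>p. of_real (\<mu> p)) \<in> invariant_forms (M i) (a i)"
proof -
  have sm: "smooth_near (M i) p \<mu>" if "p \<in> points (M i)" for p
    using \<mu> that unfolding moment_map_def by (blast intro: smooth_near_openin[OF openin_topspace])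
  then have "zero_form (M i) (\<lambda>p. of_real (\<mu> p)) \<in> forms (M i)"
    by (intro zero_form_forms[OF charted_factor[OF i]]) (simp add: csmooth_near_def smooth_near_const)
  moreover have "x \<in> forms (M i)" using x by (simp add: invariant_forms_def)
  then have "\<mu> (a i z p) = \<mu> p" "a i z p \<in> points (M i)" if "z \<in> sphere 0 1" "p \<in> points (M i)" for z p
    using moment_map_invariant[OF smooth[OF i] action[OF i] _ \<mu> that(2,1)] 
      smooth_map_points[OF circle_action_smooth[OF smooth[OF i] action[OF i] that(1)] that(2)] by auto
  then have "pullback (M i) (M i) (a i z) (zero_form (M i) (\<lambda>p. of_real (\<mu> p))) = zero_form (M i) (\<lambda>p. of_real (\<mu> p))"
    if "z \<in> sphere 0 1" for z
    using that by (auto simp: pullback_def zero_form_def fun_eq_iff)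
  ultimately show ?thesis by (simp add: invariant_forms_def)
qed

text \<open>These are the facts from which \<open>cocycle_extension\<close> makes x_i + t \<mu>_i an
  equivariant cocycle on the product.\<close>

lemma moment_form_diagonal:
  assumes i: "i \<in> I" and x: "x \<in> invariant_forms (M i) (a i)" and d: "has_ext_deriv (M i) x (\<lambda>_ _. 0)" and \<mu>: "moment_map (M i) (a i) x \<mu>"
  shows "pullback P (M i) (\<lambda>p. p i) x \<in> invariant_forms P aP"
    and "zero_form P (\<lambda>p. of_real (\<mu> (p i))) \<in> invariant_forms P aP"
    and "has_ext_deriv P (pullback P (M i) (\<lambda>p. p i) x) (\<lambda>_ _. 0)"
    and "has_ext_deriv P (zero_form P (\<lambda>p. of_real (\<mu> (p i)))) (interior (generating_field P aP) (pullback P (M i) (\<lambda>p. p i) x))"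
proof -
  have xf: "x \<in> forms (M i)" using x by (simp add: invariant_forms_def)
  note \<mu>i = moment_zero_form_invariant[OF i x \<mu>]
  show "pullback P (M i) (\<lambda>p. p i) x \<in> invariant_forms P aP" by (rule pullback_proj_invariant[OF i x])
  have z: "zero_form P (\<lambda>p. of_real (\<mu> (p i))) = pullback P (M i) (\<lambda>p. p i) (zero_form (M i) (\<lambda>p. of_real (\<mu> p)))"
    by (rule zero_form_pullback_proj[OF i])
  show "zero_form P (\<lambda>p. of_real (\<mu> (p i))) \<in> invariant_forms P aP"
    unfolding z by (rule pullback_proj_invariant[OF i \<mu>i])
  have "pullback P (M i) (\<lambda>p. p i) (\<lambda>_ _. 0) = (\<lambda>_ _. 0)" by (simp add: pullback_def fun_eq_iff)
  then show "has_ext_deriv P (pullback P (M i) (\<lambda>p. p i) x) (\<lambda>_ _. 0)"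
    using pullback_proj_ext_deriv[OF i xf _ d] by simp
  \<comment> \<open>The contraction has not been shown to be a form; vanishing on zero arguments is
    what \<open>pullback_proj_ext_deriv\<close> asks of it.\<close>
  have "interior (generating_field (M i) (a i)) x q vs = 0" if "(\<lambda>_. 0) \<in> set vs" for q vs
    unfolding interior_def using that by (intro form_zero[OF i xf]) simp
  then show "has_ext_deriv P (zero_form P (\<lambda>p. of_real (\<mu> (p i)))) (interior (generating_field P aP) (pullback P (M i) (\<lambda>p. p i) x))"
    unfolding z pullback_proj_interior[OF i, symmetric]
    using \<mu>i \<mu> by (intro pullback_proj_ext_deriv[OF i]) (auto simp: invariant_forms_def moment_map_def)
qed

end

section \<open>The Cartan model\<close>

text \<open>The assumptions are those supplied for the product by \<open>charted_mfd_prod\<close>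
  and smoothness of the diagonal action.\<close>

locale cartan_model =
  fixes N :: "('a, 'k) manifold" and b :: "complex \<Rightarrow> 'a \<Rightarrow> 'a"
  assumes charted: "charted N" and maps: "\<And>z p. z \<in> sphere 0 1 \<Longrightarrow> p \<in> points N \<Longrightarrow> b z p \<in> points N"
begin

abbreviation "X \<equiv> generating_field N b"
abbreviation "R0 \<equiv> (form_ring N)\<lparr>carrier := invariant_forms N b\<rparr>"
abbreviation "C \<equiv> cocycle_ring (cartan_ring N b) (cartan_deriv N b)"

lemma invariant_formsD: "\<omega> \<in> invariant_forms N b \<Longrightarrow> \<omega> \<in> forms N"
  by (simp add: invariant_forms_def)

lemma invariant_forms_add:
  assumes "\<alpha> \<in> invariant_forms N b" "\<beta> \<in> invariant_forms N b"
  shows "(\<lambda>p vs. \<alpha> p vs + \<beta> p vs) \<in> invariant_forms N b"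
proof -
  have "pullback N N (b z) (\<lambda>p vs. \<alpha> p vs + \<beta> p vs) = (\<lambda>p vs. pullback N N (b z) \<alpha> p vs + pullback N N (b z) \<beta> p vs)" for z
    by (simp add: pullback_def fun_eq_iff)
  then show ?thesis using assms forms_add[OF charted] by (auto simp: invariant_forms_def)
qed

lemma invariant_forms_wedge:
  assumes "\<alpha> \<in> invariant_forms N b" "\<beta> \<in> invariant_forms N b"
  shows "wedge \<alpha> \<beta> \<in> invariant_forms N b"
  using assms forms_wedge[OF charted] pullback_wedge[OF charted maps] by (auto simp: invariant_forms_def)

lemma invariant_forms_const: "zero_form N (\<lambda>_. c) \<in> invariant_forms N b"
  using zero_form_forms[OF charted csmooth_near_const] maps
  by (auto simp: invariant_forms_def pullback_def zero_form_def fun_eq_iff)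

lemma invariant_forms_zero: "(\<lambda>_ _. 0) \<in> invariant_forms N b"
proof -
  have "zero_form N (\<lambda>_. 0) = (\<lambda>_ _. 0)" by (simp add: zero_form_def fun_eq_iff)
  then show ?thesis using invariant_forms_const[of 0] by simp
qed

lemma R0_simps [simp]:
  "carrier R0 = invariant_forms N b" "\<alpha> \<otimes>\<^bsub>R0\<^esub> \<beta> = wedge \<alpha> \<beta>" "\<one>\<^bsub>R0\<^esub> = zero_form N (\<lambda>_. 1)"
  "\<zero>\<^bsub>R0\<^esub> = (\<lambda>_ _. 0)" "\<alpha> \<oplus>\<^bsub>R0\<^esub> \<beta> = (\<lambda>p vs. \<alpha> p vs + \<beta> p vs)"
  by (simp_all add: form_ring_def)

lemma form_ring_simps [simp]:
  "\<alpha> \<otimes>\<^bsub>form_ring N\<^esub> \<beta> = wedge \<alpha> \<beta>" "\<one>\<^bsub>form_ring N\<^esub> = zero_form N (\<lambda>_. 1)"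
  "\<zero>\<^bsub>form_ring N\<^esub> = (\<lambda>_ _. 0)" "\<alpha> \<oplus>\<^bsub>form_ring N\<^esub> \<beta> = (\<lambda>p vs. \<alpha> p vs + \<beta> p vs)"
  by (simp_all add: form_ring_def)

lemma abelian_monoid_R0: "abelian_monoid R0"
  by (rule abelian_monoidI) (auto simp: invariant_forms_add invariant_forms_zero add_ac fun_eq_iff)

lemma finsum_R0:
  assumes "finite A" "f \<in> A \<rightarrow> invariant_forms N b"
  shows "finsum R0 f A = (\<lambda>p vs. \<Sum>i\<in>A. f i p vs)" "(\<lambda>p vs. \<Sum>i\<in>A. f i p vs) \<in> invariant_forms N b"
proof -
  interpret abelian_monoid R0 by (rule abelian_monoid_R0)
  have "finsum R0 f A = (\<lambda>p vs. \<Sum>i\<in>A. f i p vs) \<and> (\<lambda>p vs. \<Sum>i\<in>A. f i p vs) \<in> invariant_forms N b"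
    using assms
  proof (induction A rule: finite_induct)
    case empty
    then show ?case using invariant_forms_zero by (simp add: finsum_empty[unfolded R0_simps])
  next
    case (insert i A)
    then show ?case
      using finsum_insert[of A i f] invariant_forms_add[of "f i" "\<lambda>p vs. \<Sum>i\<in>A. f i p vs"] by (simp add: fun_eq_iff)
  qed
  then show "finsum R0 f A = (\<lambda>p vs. \<Sum>i\<in>A. f i p vs)" "(\<lambda>p vs. \<Sum>i\<in>A. f i p vs) \<in> invariant_forms N b" by auto
qed

definition cartan :: "(nat \<Rightarrow> 'a form) set"
  where "cartan = {\<alpha>. (\<forall>n. \<alpha> n \<in> invariant_forms N b) \<and> (\<exists>n. \<forall>m>n. \<alpha> m = (\<lambda>_ _. 0))}"

definition cmult :: "(nat \<Rightarrow> 'a form) \<Rightarrow> (nat \<Rightarrow> 'a form) \<Rightarrow> nat \<Rightarrow> 'a form"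
  where "cmult \<alpha> \<beta> n = (\<lambda>p vs. \<Sum>i\<le>n. wedge (\<alpha> i) (\<beta> (n - i)) p vs)"

lemma carrier_cartan_ring: "carrier (cartan_ring N b) = cartan"
  by (auto simp: cartan_ring_def UP_def up_def cartan_def bound_def)

lemma cartan_ring_mult:
  assumes "\<alpha> \<in> cartan" "\<beta> \<in> cartan"
  shows "\<alpha> \<otimes>\<^bsub>cartan_ring N b\<^esub> \<beta> = cmult \<alpha> \<beta>"
proof -
  have "\<alpha> \<in> up R0" "\<beta> \<in> up R0" using assms carrier_cartan_ring by (simp_all add: cartan_ring_def UP_def)
  then have "\<alpha> \<otimes>\<^bsub>cartan_ring N b\<^esub> \<beta> = (\<lambda>n. \<Oplus>\<^bsub>R0\<^esub>i\<in>{..n}. wedge (\<alpha> i) (\<beta> (n - i)))"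
    by (simp add: cartan_ring_def UP_def form_ring_def)
  then show ?thesis
    using finsum_R0(1)[of "{..n}" "\<lambda>i. wedge (\<alpha> i) (\<beta> (n - i))" for n] assms invariant_forms_wedge
    by (auto simp: cmult_def cartan_def fun_eq_iff)
qed

lemma cartan_ring_add:
  assumes "\<alpha> \<in> cartan" "\<beta> \<in> cartan"
  shows "\<alpha> \<oplus>\<^bsub>cartan_ring N b\<^esub> \<beta> = (\<lambda>n p vs. \<alpha> n p vs + \<beta> n p vs)"
proof -
  have "\<alpha> \<in> up R0" "\<beta> \<in> up R0" using assms carrier_cartan_ring by (simp_all add: cartan_ring_def UP_def)
  then show ?thesis by (simp add: cartan_ring_def UP_def form_ring_def)
qed

lemma cartan_ring_zero: "\<zero>\<^bsub>cartan_ring N b\<^esub> = (\<lambda>_ _ _. 0)"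
  and cartan_ring_one: "\<one>\<^bsub>cartan_ring N b\<^esub> = (\<lambda>i. if i = 0 then zero_form N (\<lambda>_. 1) else (\<lambda>_ _. 0))"
  by (simp_all add: cartan_ring_def UP_def cong: if_cong)

lemma cartan_ring_monom:
  "\<omega> \<in> invariant_forms N b \<Longrightarrow> up_ring.monom (cartan_ring N b) \<omega> k = (\<lambda>i. if i = k then \<omega> else (\<lambda>_ _. 0))"
  by (simp add: cartan_ring_def UP_def cong: if_cong)

text \<open>This is t times contraction with the generating field, hence the shift of the index;
  \<open>cocycle\<close> thus reads d \<alpha> = t \<iota> \<alpha>.\<close>

definition contract :: "(nat \<Rightarrow> 'a form) \<Rightarrow> nat \<Rightarrow> 'a form"
  where "contract \<alpha> n = (if n = 0 then (\<lambda>_ _. 0) else interior X (\<alpha> (n - 1)))"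

definition cocycle :: "(nat \<Rightarrow> 'a form) \<Rightarrow> bool"
  where "cocycle \<alpha> \<longleftrightarrow> \<alpha> \<in> cartan \<and> (\<forall>n. has_ext_deriv N (\<alpha> n) (contract \<alpha> n))"

lemma carrier_C: "carrier C = {\<alpha>. cocycle \<alpha>}"
proof -
  have "cartan_deriv N b \<alpha> (\<lambda>_ _ _. 0) \<longleftrightarrow> (\<forall>n. has_ext_deriv N (\<alpha> n) (contract \<alpha> n))" for \<alpha>
  proof
    assume *: "cartan_deriv N b \<alpha> (\<lambda>_ _ _. 0)"
    show "\<forall>n. has_ext_deriv N (\<alpha> n) (contract \<alpha> n)"
    proof
      fix n show "has_ext_deriv N (\<alpha> n) (contract \<alpha> n)" using * by (cases n) (simp_all add: cartan_deriv_def contract_def)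
    qed
  next
    assume "\<forall>n. has_ext_deriv N (\<alpha> n) (contract \<alpha> n)"
    then have "has_ext_deriv N (\<alpha> 0) (contract \<alpha> 0)" "\<forall>n. has_ext_deriv N (\<alpha> (Suc n)) (contract \<alpha> (Suc n))" by blast+
    then show "cartan_deriv N b \<alpha> (\<lambda>_ _ _. 0)" by (simp add: cartan_deriv_def contract_def)
  qed
  then show ?thesis by (auto simp: cocycle_ring_def cocycle_def carrier_cartan_ring cartan_ring_zero)
qed

lemma C_simps: 
  "\<zero>\<^bsub>C\<^esub> = (\<lambda>_ _ _. 0)" "\<one>\<^bsub>C\<^esub> = (\<lambda>i. if i = 0 then zero_form N (\<lambda>_. 1) else (\<lambda>_ _. 0))"
  "\<alpha> \<in> cartan \<Longrightarrow> \<beta> \<in> cartan \<Longrightarrow> \<alpha> \<oplus>\<^bsub>C\<^esub> \<beta> = (\<lambda>n p vs. \<alpha> n p vs + \<beta> n p vs)"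
  "\<alpha> \<in> cartan \<Longrightarrow> \<beta> \<in> cartan \<Longrightarrow> \<alpha> \<otimes>\<^bsub>C\<^esub> \<beta> = cmult \<alpha> \<beta>"
  using cartan_ring_zero cartan_ring_one cartan_ring_add[of \<alpha> \<beta>] cartan_ring_mult[of \<alpha> \<beta>] by (simp_all add: cocycle_ring_def)

lemma has_ext_deriv_sum:
  assumes "finite A" "\<And>i. i \<in> A \<Longrightarrow> f i \<in> invariant_forms N b" "\<And>i. i \<in> A \<Longrightarrow> has_ext_deriv N (f i) (g i)"
  shows "has_ext_deriv N (\<lambda>p vs. \<Sum>i\<in>A. f i p vs) (\<lambda>p vs. \<Sum>i\<in>A. g i p vs)"
  using assms
proof (induction A rule: finite_induct)
  case empty
  have "zero_form N (\<lambda>_. 0) = (\<lambda>_ _. 0)" by (simp add: zero_form_def fun_eq_iff)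
  then show ?case using has_ext_deriv_zero_form_const[OF charted, of 0] by simp
next
  case (insert i A)
  have "(\<lambda>p vs. \<Sum>i\<in>A. f i p vs) \<in> forms N"
    using finsum_R0(2)[of A f] insert invariant_formsD by blast
  then show ?case
    using has_ext_deriv_add[OF charted, of "f i" "\<lambda>p vs. \<Sum>i\<in>A. f i p vs" "g i" "\<lambda>p vs. \<Sum>i\<in>A. g i p vs"] insert invariant_formsD
    by simp
qed

lemma cartan_cmult:
  assumes "\<alpha> \<in> cartan" "\<beta> \<in> cartan" shows "cmult \<alpha> \<beta> \<in> cartan"
proof -
  obtain n m where n: "\<And>k. k > n \<Longrightarrow> \<alpha> k = (\<lambda>_ _. 0)" and m: "\<And>k. k > m \<Longrightarrow> \<beta> k = (\<lambda>_ _. 0)"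
    using assms unfolding cartan_def by blast
  have "wedge (\<alpha> i) (\<beta> (k - i)) p vs = 0" if "k > n + m" for i k p vs
  proof (cases "i > n")
    case True
    then show ?thesis by (simp add: n wedge_shuffle_prod shuffle_prod_zero_left)
  next
    case False
    then have "k - i > m" using that by linarith
    then show ?thesis by (simp add: m wedge_shuffle_prod shuffle_prod_zero_right)
  qed
  then have "\<forall>k>n + m. cmult \<alpha> \<beta> k = (\<lambda>_ _. 0)" by (simp add: cmult_def)
  moreover have "cmult \<alpha> \<beta> k \<in> invariant_forms N b" for k
    unfolding cmult_def using assms by (intro finsum_R0(2)) (auto simp: cartan_def intro!: invariant_forms_wedge)
  ultimately show ?thesis unfolding cartan_def by blast
qed

text \<open>d and contraction obey the antiderivation rule with the same sign \<open>grade\<close>,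
  hence so does d - t \<iota>, and a product of elements that it kills is killed as well.\<close>

lemma cocycle_cmult:
  assumes a: "cocycle \<alpha>" and b: "cocycle \<beta>" shows "cocycle (cmult \<alpha> \<beta>)"
  unfolding cocycle_def
proof (intro conjI allI)
  have inv: "\<alpha> i \<in> invariant_forms N b" "\<beta> i \<in> invariant_forms N b" for i
    using a b by (auto simp: cocycle_def cartan_def)
  show "cmult \<alpha> \<beta> \<in> cartan" using a b cartan_cmult by (simp add: cocycle_def)
  fix n
  have d: "has_ext_deriv N (cmult \<alpha> \<beta> n) (\<lambda>p vs. \<Sum>i\<le>n. wedge (contract \<alpha> i) (\<beta> (n - i)) p vs + wedge (\<lambda>p. grade (\<alpha> i p)) (contract \<beta> (n - i)) p vs)"
    unfolding cmult_def using a b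
    by (intro has_ext_deriv_sum has_ext_deriv_wedge[OF charted] invariant_forms_wedge)
      (auto simp: inv invariant_formsD[OF inv(1)] invariant_formsD[OF inv(2)] cocycle_def)
  have "(\<Sum>i\<le>n. wedge (contract \<alpha> i) (\<beta> (n - i)) p vs + wedge (\<lambda>p. grade (\<alpha> i p)) (contract \<beta> (n - i)) p vs) =
    contract (cmult \<alpha> \<beta>) n p vs" for p vs
  proof (cases n)
    case 0
    then show ?thesis by (simp add: contract_def wedge_shuffle_prod shuffle_prod_zero_left shuffle_prod_zero_right)
  next
    case (Suc m)
    \<comment> \<open>Each sum on the left has one term more than the right-hand side: i = 0 here
      and i = n in the next sum. In both, \<open>contract\<close> is taken at index 0 and is
      zero.\<close>
    have "(\<Sum>i\<le>n. wedge (contract \<alpha> i) (\<beta> (n - i)) p vs) = (\<Sum>i\<le>m. wedge (interior X (\<alpha> i)) (\<beta> (m - i)) p vs)"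
      unfolding Suc by (subst sum.atMost_Suc_shift) (simp add: contract_def wedge_shuffle_prod shuffle_prod_zero_left)
    moreover have "(\<Sum>i\<le>n. wedge (\<lambda>p. grade (\<alpha> i p)) (contract \<beta> (n - i)) p vs) = 
        (\<Sum>i\<le>m. wedge (\<lambda>p. grade (\<alpha> i p)) (interior X (\<beta> (m - i))) p vs)"
      unfolding Suc by (simp add: contract_def wedge_shuffle_prod shuffle_prod_zero_right Suc_diff_le)
    moreover have "contract (cmult \<alpha> \<beta>) n p vs = (\<Sum>i\<le>m. interior X (wedge (\<alpha> i) (\<beta> (m - i))) p vs)"
      by (simp add: Suc contract_def cmult_def interior_def)
    ultimately show ?thesis by (simp add: interior_wedge sum.distrib)
  qed
  then show "has_ext_deriv N (cmult \<alpha> \<beta> n) (contract (cmult \<alpha> \<beta>) n)" using d by presburger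
qed

lemma cartan_add: "\<alpha> \<in> cartan \<Longrightarrow> \<beta> \<in> cartan \<Longrightarrow> (\<lambda>n p vs. \<alpha> n p vs + \<beta> n p vs) \<in> cartan"
  unfolding cartan_def
proof (clarify, intro conjI allI)
  fix n m assume n: "\<forall>k>n. \<alpha> k = (\<lambda>_ _. 0)" and m: "\<forall>k>m. \<beta> k = (\<lambda>_ _. 0)"
  show "\<exists>n. \<forall>k>n. (\<lambda>p vs. \<alpha> k p vs + \<beta> k p vs) = (\<lambda>_ _. 0)"
    by (rule exI[of _ "max n m"]) (simp add: n m)
qed (simp add: invariant_forms_add)

lemma cocycle_add:
  assumes a: "cocycle \<alpha>" and b: "cocycle \<beta>" shows "cocycle (\<lambda>n p vs. \<alpha> n p vs + \<beta> n p vs)"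
  unfolding cocycle_def
proof (intro conjI allI)
  show "(\<lambda>n p vs. \<alpha> n p vs + \<beta> n p vs) \<in> cartan" using a b cartan_add by (simp add: cocycle_def)
  fix n
  have "\<alpha> n \<in> forms N" "\<beta> n \<in> forms N" using a b by (auto simp: cocycle_def cartan_def intro: invariant_formsD)
  moreover have "contract (\<lambda>n p vs. \<alpha> n p vs + \<beta> n p vs) n = (\<lambda>p vs. contract \<alpha> n p vs + contract \<beta> n p vs)"
    by (simp add: contract_def interior_def fun_eq_iff)
  ultimately show "has_ext_deriv N (\<lambda>p vs. \<alpha> n p vs + \<beta> n p vs) (contract (\<lambda>n p vs. \<alpha> n p vs + \<beta> n p vs) n)"
    using has_ext_deriv_add[OF charted] a b by (simp add: cocycle_def)
qed

lemma has_ext_deriv_0: "has_ext_deriv N (\<lambda>_ _. 0) (\<lambda>_ _. 0)"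
  using has_ext_deriv_sum[of "{}"] by simp

lemma interior_zero_form: "interior X (zero_form N f) = (\<lambda>_ _. 0)"
  and interior_0: "interior X (\<lambda>_ _. 0) = (\<lambda>_ _. 0)"
  by (simp_all add: interior_def zero_form_def fun_eq_iff)

text \<open>For k = 0 these are the scalars, and for k = 1, c = 1 the variable t.\<close>

lemma cocycle_const: "cocycle (\<lambda>i. if i = k then zero_form N (\<lambda>_. c) else (\<lambda>_ _. 0))"
  unfolding cocycle_def
proof (intro conjI allI)
  show "(\<lambda>i. if i = k then zero_form N (\<lambda>_. c) else (\<lambda>_ _. 0)) \<in> cartan"
    by (auto simp: cartan_def invariant_forms_const invariant_forms_zero intro: exI[of _ k])
  fix n
  have "contract (\<lambda>i. if i = k then zero_form N (\<lambda>_. c) else (\<lambda>_ _. 0)) n = (\<lambda>_ _. 0)"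
    by (simp add: contract_def interior_zero_form interior_0)
  then show "has_ext_deriv N (if n = k then zero_form N (\<lambda>_. c) else (\<lambda>_ _. 0)) (contract (\<lambda>i. if i = k then zero_form N (\<lambda>_. c) else (\<lambda>_ _. 0)) n)"
    by (simp add: has_ext_deriv_0 has_ext_deriv_zero_form_const[OF charted])
qed

lemma cocycle_extension:
  assumes "x \<in> invariant_forms N b" "zero_form N f \<in> invariant_forms N b"
    "has_ext_deriv N x (\<lambda>_ _. 0)" "has_ext_deriv N (zero_form N f) (interior X x)"
  shows "cocycle (\<lambda>i. if i = 0 then x else if i = 1 then zero_form N f else (\<lambda>_ _. 0))"
  unfolding cocycle_def
proof (intro conjI allI)
  show "(\<lambda>i. if i = 0 then x else if i = 1 then zero_form N f else (\<lambda>_ _. 0)) \<in> cartan"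
    using assms by (auto simp: cartan_def invariant_forms_zero intro: exI[of _ 1])
  fix n :: nat
  show "has_ext_deriv N (if n = 0 then x else if n = 1 then zero_form N f else (\<lambda>_ _. 0))
     (contract (\<lambda>i. if i = 0 then x else if i = 1 then zero_form N f else (\<lambda>_ _. 0)) n)"
    using assms by (auto simp: contract_def interior_zero_form interior_0 has_ext_deriv_0)
qed

lemma cocycle_zero: "cocycle (\<lambda>_ _ _. 0)"
proof -
  have "zero_form N (\<lambda>_. 0) = (\<lambda>_ _. 0)" by (simp add: zero_form_def fun_eq_iff)
  then show ?thesis using cocycle_const[of 0 0] by (simp cong: if_cong)
qed

lemma abelian_monoid_C: "abelian_monoid C"
proof -
  have c: "\<alpha> \<in> cartan" if "cocycle \<alpha>" for \<alpha> using that by (simp add: cocycle_def)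
  have z: "(\<lambda>_ _ _. 0) \<in> cartan" by (rule c[OF cocycle_zero])
  show ?thesis
    by (rule abelian_monoidI)
      (simp_all add: carrier_C C_simps(1) C_simps(3) c z cocycle_add cocycle_zero cartan_add add_ac)
qed

end

section \<open>Restriction to fixed points\<close>

definition mpoly_ev :: "(nat \<Rightarrow> complex poly) \<Rightarrow> nat \<Rightarrow> mpolynomial \<Rightarrow> complex poly"
  where "mpoly_ev w m f = (\<Sum>e\<in>Poly_Mapping.keys f. [:Poly_Mapping.lookup f e:] * (\<Prod>i\<le>m. w i ^ Poly_Mapping.lookup e i))"

lemma mpoly_eval_closed:
  fixes C :: "('b, 'm) ring_scheme" (structure)
  assumes am: "abelian_monoid C"
    and mult: "\<And>x y. x \<in> carrier C \<Longrightarrow> y \<in> carrier C \<Longrightarrow> x \<otimes> y \<in> carrier C" and one: "\<one> \<in> carrier C"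
    and s: "\<And>c. s c \<in> carrier C" and v: "\<And>i. i \<le> m \<Longrightarrow> v i \<in> carrier C"
  shows "mpoly_eval C s v m f \<in> carrier C"
proof -
  interpret abelian_monoid C by (rule am)
  have pow: "x [^] n \<in> carrier C" if "x \<in> carrier C" for x and n :: nat
    using that by (induction n) (simp_all add: nat_pow_def one mult)
  have "foldr (\<lambda>i r. (v i [^] g i) \<otimes> r) is \<one> \<in> carrier C" if "set is \<subseteq> {..m}" for "is" and g :: "nat \<Rightarrow> nat"
    using that by (induction "is") (auto simp: one mult pow v)
  then have "foldr (\<lambda>i r. (v i [^] g i) \<otimes> r) [0..<Suc m] \<one> \<in> carrier C" for g :: "nat \<Rightarrow> nat"
    by (simp add: subset_iff del: upt_Suc)
  then show ?thesis unfolding mpoly_eval_def by (intro finsum_closed) (simp add: mult s del: upt_Suc)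
qed

text \<open>The target is commutative, so the ordered product of \<open>mpoly_eval\<close> becomes
  an ordinary one under \<open>h\<close>. The hypotheses are formulated on the carrier and are
  checked there for cocycles and restriction to a fixed point.\<close>

lemma mpoly_eval_hom:
  fixes C :: "('b, 'm) ring_scheme" (structure) and h :: "'b \<Rightarrow> complex poly"
  assumes am: "abelian_monoid C"
    and mult: "\<And>x y. x \<in> carrier C \<Longrightarrow> y \<in> carrier C \<Longrightarrow> x \<otimes> y \<in> carrier C" and one: "\<one> \<in> carrier C"
    and s: "\<And>c. s c \<in> carrier C" and v: "\<And>i. i \<le> m \<Longrightarrow> v i \<in> carrier C"
    and hmult: "\<And>x y. x \<in> carrier C \<Longrightarrow> y \<in> carrier C \<Longrightarrow> h (x \<otimes> y) = h x * h y" and hone: "h \<one> = 1"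
    and hzero: "h \<zero> = 0" and hadd: "\<And>x y. x \<in> carrier C \<Longrightarrow> y \<in> carrier C \<Longrightarrow> h (x \<oplus> y) = h x + h y"
    and hs: "\<And>c. h (s c) = [:c:]"
  shows "h (mpoly_eval C s v m f) = mpoly_ev (\<lambda>i. h (v i)) m f"
proof -
  interpret abelian_monoid C by (rule am)
  have pow: "x [^] n \<in> carrier C \<and> h (x [^] n) = h x ^ n" if "x \<in> carrier C" for x and n :: nat
    using that by (induction n) (simp_all add: nat_pow_def one hone mult hmult mult.commute)
  have fold: "foldr (\<lambda>i r. (v i [^] g i) \<otimes> r) is \<one> \<in> carrier C \<and>
      h (foldr (\<lambda>i r. (v i [^] g i) \<otimes> r) is \<one>) = prod_list (map (\<lambda>i. h (v i) ^ g i) is)"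
    if "set is \<subseteq> {..m}" for "is" and g :: "nat \<Rightarrow> nat"
    using that by (induction "is") (auto simp: one hone mult hmult pow v)
  have pl: "prod_list (map (\<lambda>i. h (v i) ^ g i) [0..<Suc m]) = (\<Prod>i\<le>m. h (v i) ^ g i)" for g
    using prod.distinct_set_conv_list[of "[0..<Suc m]" "\<lambda>i. h (v i) ^ g i"]
    by (simp add: atLeast0LessThan lessThan_Suc_atMost del: upt_Suc)
  define t where "t = (\<lambda>e. s (Poly_Mapping.lookup f e) \<otimes> foldr (\<lambda>i r. (v i [^] Poly_Mapping.lookup e i) \<otimes> r) [0..<Suc m] \<one>)"
  have sub: "set [0..<Suc m] \<subseteq> {..m}" by auto
  have t: "t e \<in> carrier C" "h (t e) = [:Poly_Mapping.lookup f e:] * (\<Prod>i\<le>m. h (v i) ^ Poly_Mapping.lookup e i)" for e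
    using fold[OF sub, of "Poly_Mapping.lookup e"] s hs pl mult hmult by (simp_all add: t_def del: upt_Suc)
  have "h (finsum C t A) = (\<Sum>e\<in>A. h (t e))" if "finite A" for A
    using that
  proof (induction A rule: finite_induct)
    case (insert x A)
    then show ?case using t(1) by (simp add: finsum_insert hadd)
  qed (simp add: hzero)
  moreover have "mpoly_eval C s v m f = finsum C t (Poly_Mapping.keys f)" unfolding mpoly_eval_def t_def ..
  ultimately show ?thesis using t(2) by (simp add: mpoly_ev_def)
qed

section \<open>Restriction of equivariant classes\<close>

context cartan_model
begin

lemma coeff_restrict_form:
  assumes "\<alpha> \<in> cartan"
  shows "Polynomial.coeff (restrict_form p \<alpha>) n = \<alpha> n p []"
proof -
  obtain N' where "\<And>k. k > N' \<Longrightarrow> \<alpha> k = (\<lambda>_ _. 0)" using assms unfolding cartan_def by blast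
  then have "{k. \<alpha> k p [] \<noteq> 0} \<subseteq> {..N'}" by (auto simp: not_less[symmetric])
  then have "finite {k. \<alpha> k p [] \<noteq> 0}" using finite_subset by blast
  then show ?thesis by (simp add: restrict_form_def Polynomial.coeff_sum if_distrib sum.If_cases cong: if_cong)
qed

lemma restrict_form_add:
  "\<alpha> \<in> cartan \<Longrightarrow> \<beta> \<in> cartan \<Longrightarrow> restrict_form p (\<lambda>n p vs. \<alpha> n p vs + \<beta> n p vs) = restrict_form p \<alpha> + restrict_form p \<beta>"
  by (rule poly_eqI) (simp add: coeff_restrict_form cartan_add)

text \<open>On the empty list the wedge product is the product of the values, so taking the part of
  form degree 0 is multiplicative.\<close>

lemma restrict_form_cmult:
  "\<alpha> \<in> cartan \<Longrightarrow> \<beta> \<in> cartan \<Longrightarrow> restrict_form p (cmult \<alpha> \<beta>) = restrict_form p \<alpha> * restrict_form p \<beta>"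
  by (rule poly_eqI) (simp add: coeff_restrict_form cartan_cmult Polynomial.coeff_mult, simp add: cmult_def wedge_shuffle_prod)

text \<open>The value of d \<omega> on the empty list is an empty sum, so d has no part of degree 0;
  and the contraction term vanishes because the generating field is 0 at a fixed point.\<close>

lemma coboundary_restrict:
  assumes b: "\<beta> \<in> coboundaries (cartan_ring N b) (cartan_deriv N b)" and p: "p \<in> fixed_points N b"
  shows "\<beta> \<in> cartan" "restrict_form p \<beta> = 0"
proof -
  obtain \<alpha> where \<alpha>: "\<alpha> \<in> cartan" "cartan_deriv N b \<alpha> \<beta>" and \<beta>: "\<beta> \<in> cartan"
    using b by (auto simp: coboundaries_def carrier_cartan_ring)
  have pN: "p \<in> points N" using p by (simp add: fixed_points_def)
  obtain U \<phi> where c: "(U, \<phi>) \<in> atlas N" "p \<in> U" using charted_cover[OF charted pN] .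
  have X: "X p = (\<lambda>_. 0)"
    using p by (auto simp: generating_field_def fixed_points_def)
  have d: "\<eta> p [] = 0" if "has_ext_deriv N \<omega> \<eta>" for \<omega> \<eta>
    using that[unfolded has_ext_deriv_iff, rule_format, OF c, of "[]"] by simp
  have "\<beta> n p [] = 0" for n
  proof (cases n)
    case 0
    then show ?thesis using \<alpha>(2) d[of "\<alpha> 0" "\<beta> 0"] by (simp add: cartan_deriv_def)
  next
    case (Suc k)
    have "\<beta> (Suc k) p [] + interior X (\<alpha> k) p [] = 0"
      using \<alpha>(2) d[of "\<alpha> (Suc k)" "\<lambda>p vs. \<beta> (Suc k) p vs + interior X (\<alpha> k) p vs"] by (simp add: cartan_deriv_def)
    moreover have "\<alpha> k \<in> forms N" using \<alpha>(1) by (auto simp: cartan_def intro: invariant_formsD)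
    from alternating_on_zero[OF form_alternating[OF charted this pN] _ zero_tangent]
    have "interior X (\<alpha> k) p [] = 0" by (simp add: interior_def X)
    ultimately show ?thesis using Suc by simp
  qed
  then show "\<beta> \<in> cartan" "restrict_form p \<beta> = 0"
    using \<beta> by (auto simp: coeff_restrict_form intro!: poly_eqI)
qed

lemma equiv_class_carrier:
  "cocycle \<alpha> \<Longrightarrow> equiv_class N b \<alpha> \<in> carrier (equiv_cohomology N b)"
  by (auto simp: cohomology_class_def cohomology_ring_def FactRing_def A_RCOSETS_def' carrier_C)

lemma restrict_class_equiv_class:
  assumes \<alpha>: "cocycle \<alpha>" and p: "p \<in> fixed_points N b"
  shows "restrict_class p (equiv_class N b \<alpha>) = restrict_form p \<alpha>"
proof -
  let ?B = "coboundaries (cartan_ring N b) (cartan_deriv N b)"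
  have \<alpha>c: "\<alpha> \<in> cartan" using \<alpha> by (simp add: cocycle_def)
  have "equiv_class N b \<alpha> = (\<lambda>\<beta>. \<beta> \<oplus>\<^bsub>C\<^esub> \<alpha>) ` ?B"
    by (auto simp: cohomology_class_def a_r_coset_def')
  then have "restrict_form p ` equiv_class N b \<alpha> = (\<lambda>\<beta>. restrict_form p (\<beta> \<oplus>\<^bsub>C\<^esub> \<alpha>)) ` ?B"
    by (simp add: image_image)
  also have "\<dots> = (\<lambda>\<beta>. restrict_form p \<alpha>) ` ?B"
    using coboundary_restrict[OF _ p] \<alpha>c by (intro image_cong refl) (simp add: C_simps(3) restrict_form_add)
  also have "\<dots> = {restrict_form p \<alpha>}"
  proof -
    \<comment> \<open>The zero coboundary shows that the set of restrictions is not empty, so it is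
      a singleton and \<open>the_elem\<close> returns its element.\<close>
    have "cartan_deriv N b (\<lambda>_ _ _. 0) (\<lambda>_ _ _. 0)"
      by (simp add: cartan_deriv_def has_ext_deriv_0 interior_0)
    moreover have "(\<lambda>_ _ _. 0) \<in> cartan" using cocycle_zero by (simp add: cocycle_def)
    ultimately have "(\<lambda>_ _ _. 0) \<in> ?B" unfolding coboundaries_def carrier_cartan_ring by blast
    then show ?thesis by blast
  qed
  finally show ?thesis by (simp add: restrict_class_def)
qed

lemma cartan_monom:
  "\<omega> \<in> invariant_forms N b \<Longrightarrow> (\<lambda>i. if i = k then \<omega> else (\<lambda>_ _. 0)) \<in> cartan"
  by (auto simp: cartan_def invariant_forms_zero intro: exI[of _ k])

text \<open>A two-form has no part of degree 0, so x_i + t \<mu>_i restricts to \<mu>_i(p) t; the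
  rest is the homomorphism property of restriction on cocycles.\<close>

lemma eta_restrict:
  assumes "\<And>i. i \<in> {1..m} \<Longrightarrow> x i \<in> invariant_forms N b \<and> zero_form N (\<lambda>p. of_real (\<mu> i p)) \<in> invariant_forms N b \<and>
     has_ext_deriv N (x i) (\<lambda>_ _. 0) \<and> has_ext_deriv N (zero_form N (\<lambda>p. of_real (\<mu> i p))) (interior X (x i)) \<and> homogeneous_form 2 (x i)"
  shows "eta N b x \<mu> m f \<in> carrier (equiv_cohomology N b)"
    and "p \<in> fixed_points N b \<Longrightarrow> restrict_class p (eta N b x \<mu> m f) =
      mpoly_ev (\<lambda>i. if i = 0 then Polynomial.monom 1 1 else Polynomial.monom (of_real (\<mu> i p)) 1) m f"
proof -
  let ?v = "\<lambda>i. if i = 0 then cartan_t N b else equiv_extension N b (x i) (\<mu> i)"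
  have inv: "x i \<in> invariant_forms N b" "zero_form N (\<lambda>p. of_real (\<mu> i p)) \<in> invariant_forms N b" if "i \<in> {1..m}" for i
    using assms[OF that] by auto
  have t: "cartan_t N b = (\<lambda>i. if i = 1 then zero_form N (\<lambda>_. 1) else (\<lambda>_ _. 0))"
    unfolding cartan_t_def by (rule cartan_ring_monom[OF invariant_forms_const])
  have ext: "equiv_extension N b (x i) (\<mu> i) = (\<lambda>k. if k = 0 then x i else if k = 1 then zero_form N (\<lambda>p. of_real (\<mu> i p)) else (\<lambda>_ _. 0))"
    if "i \<in> {1..m}" for i
    unfolding equiv_extension_def cartan_ring_monom[OF inv(1)[OF that]] cartan_ring_monom[OF inv(2)[OF that]]
    by (subst cartan_ring_add[OF cartan_monom[OF inv(1)[OF that]] cartan_monom[OF inv(2)[OF that]]]) (simp add: fun_eq_iff)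
  have const: "cartan_const N b c = (\<lambda>i. if i = 0 then zero_form N (\<lambda>_. c) else (\<lambda>_ _. 0))" for c
    unfolding cartan_const_def by (rule cartan_ring_monom[OF invariant_forms_const])
  have v: "cocycle (?v i)" if "i \<le> m" for i
  proof (cases "i = 0")
    case True
    then show ?thesis using cocycle_const[of 1 1] by (simp add: t)
  next
    case False
    then have i: "i \<in> {1..m}" using that by simp
    then show ?thesis using False assms[OF i] cocycle_extension[of "x i" "\<lambda>p. of_real (\<mu> i p)"] by (simp only: ext if_False)
  qed
  have c: "\<alpha> \<in> cartan" if "cocycle \<alpha>" for \<alpha> using that by (simp add: cocycle_def)
  have one: "cocycle \<one>\<^bsub>C\<^esub>" unfolding C_simps by (rule cocycle_const)
  have cst: "cocycle (cartan_const N b c)" for c unfolding const by (rule cocycle_const)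
  have closed: "x \<otimes>\<^bsub>C\<^esub> y \<in> carrier C" if "x \<in> carrier C" "y \<in> carrier C" for x y
    using that by (simp add: carrier_C C_simps(4) c cocycle_cmult)
  have hom: "restrict_form p (mpoly_eval C (cartan_const N b) ?v m f) = mpoly_ev (\<lambda>i. restrict_form p (?v i)) m f"
    if p: "p \<in> points N" for p
  proof (rule mpoly_eval_hom[where h = "restrict_form p", OF abelian_monoid_C closed])
    show "restrict_form p \<one>\<^bsub>C\<^esub> = 1"
      using p c[OF one] by (intro poly_eqI) (simp add: coeff_restrict_form, simp add: C_simps zero_form_def)
    show "restrict_form p \<zero>\<^bsub>C\<^esub> = 0"
      using c[OF cocycle_zero] by (intro poly_eqI) (simp add: coeff_restrict_form C_simps)
    show "restrict_form p (cartan_const N b c) = [:c:]" for c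
      using p c[OF cst] by (intro poly_eqI) (simp add: coeff_restrict_form coeff_pCons split: nat.split, simp add: const zero_form_def)
  qed (simp_all add: carrier_C C_simps(3,4) c one cst v restrict_form_add restrict_form_cmult)
  have "mpoly_eval C (cartan_const N b) ?v m f \<in> carrier C"
    by (rule mpoly_eval_closed[OF abelian_monoid_C closed]) (simp_all add: carrier_C one cst v)
  then have coc: "cocycle (mpoly_eval C (cartan_const N b) ?v m f)" by (simp add: carrier_C)
  show "eta N b x \<mu> m f \<in> carrier (equiv_cohomology N b)"
    unfolding eta_def by (rule equiv_class_carrier[OF coc])
  show "restrict_class p (eta N b x \<mu> m f) =
      mpoly_ev (\<lambda>i. if i = 0 then Polynomial.monom 1 1 else Polynomial.monom (of_real (\<mu> i p)) 1) m f"
    if p: "p \<in> fixed_points N b"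
  proof -
    have pN: "p \<in> points N" using p by (simp add: fixed_points_def)
    have "restrict_form p (?v i) = (if i = 0 then Polynomial.monom 1 1 else Polynomial.monom (of_real (\<mu> i p)) 1)" if i: "i \<le> m" for i
    proof (rule poly_eqI)
      fix k
      show "Polynomial.coeff (restrict_form p (?v i)) k = Polynomial.coeff (if i = 0 then Polynomial.monom 1 1 else Polynomial.monom (of_real (\<mu> i p)) 1) k"
      proof (cases "i = 0")
        case True
        then show ?thesis using c[OF v[OF i]] pN by (simp add: coeff_restrict_form) (simp add: t zero_form_def)
      next
        case False
        then have im: "i \<in> {1..m}" using i by simp
        have "x i p [] = 0" using assms[OF im] by (simp add: homogeneous_form_def)
        then show ?thesis using False c[OF v[OF i]] pN by (simp add: coeff_restrict_form) (simp add: ext[OF im] zero_form_def)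
      qed
    qed
    then have "mpoly_ev (\<lambda>i. restrict_form p (?v i)) m f =
       mpoly_ev (\<lambda>i. if i = 0 then Polynomial.monom 1 1 else Polynomial.monom (of_real (\<mu> i p)) 1) m f"
      unfolding mpoly_ev_def by (intro sum.cong prod.cong arg_cong2[where f = "(*)"] refl) (simp only: atMost_iff)
    then show ?thesis
      unfolding eta_def restrict_class_equiv_class[OF coc p] using hom[OF pN] by simp
  qed
qed

end

section \<open>The polynomial ring\<close>

text \<open>Kept general in the types because it serves both for polynomials, as sums of monomials,
  and for exponents, as sums of single powers.\<close>

lemma mpolynomial_induct [case_names zero add]:
  fixes f :: "'a::zero \<Rightarrow>\<^sub>0 'b::comm_monoid_add"
  assumes "P 0" "\<And>a b f. a \<notin> Poly_Mapping.keys f \<Longrightarrow> b \<noteq> 0 \<Longrightarrow> P f \<Longrightarrow> P (Poly_Mapping.single a b + f)"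
  shows "P f"
proof (induction f rule: update_induct)
  case (update f a b)
  have "Poly_Mapping.update a b f = Poly_Mapping.single a b + f"
    using update(1) by (intro poly_mapping_eqI) (auto simp: lookup_update lookup_add lookup_single in_keys_iff when_def)
  then show ?case using assms(2)[OF update] by simp
qed (rule assms(1))

abbreviation monomial_value :: "(nat \<Rightarrow> complex poly) \<Rightarrow> nat \<Rightarrow> (nat \<Rightarrow>\<^sub>0 nat) \<Rightarrow> complex poly"
  where "monomial_value w m e \<equiv> \<Prod>i\<le>m. w i ^ Poly_Mapping.lookup e i"

lemma mpoly_ev_superset:
  assumes "finite A" "Poly_Mapping.keys f \<subseteq> A"
  shows "mpoly_ev w m f = (\<Sum>e\<in>A. [:Poly_Mapping.lookup f e:] * monomial_value w m e)"
  unfolding mpoly_ev_def using assms by (intro sum.mono_neutral_left) (auto simp: in_keys_iff)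

lemma mpoly_ev_zero: "mpoly_ev w m 0 = 0"
  by (simp add: mpoly_ev_def)

lemma mpoly_ev_single: "mpoly_ev w m (Poly_Mapping.single e c) = [:c:] * monomial_value w m e"
  by (subst mpoly_ev_superset[of "{e}"]) auto

lemma mpoly_ev_add: "mpoly_ev w m (f + g) = mpoly_ev w m f + mpoly_ev w m g"
proof -
  let ?A = "Poly_Mapping.keys f \<union> Poly_Mapping.keys g"
  have "mpoly_ev w m (f + g) = (\<Sum>e\<in>?A. [:Poly_Mapping.lookup (f + g) e:] * monomial_value w m e)"
    by (rule mpoly_ev_superset) (use Poly_Mapping.keys_add[of f g] in auto)
  also have "\<dots> = (\<Sum>e\<in>?A. [:Poly_Mapping.lookup f e:] * monomial_value w m e + [:Poly_Mapping.lookup g e:] * monomial_value w m e)"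
    by (simp add: lookup_add smult_add_left)
  also have "\<dots> = mpoly_ev w m f + mpoly_ev w m g"
    by (simp only: sum.distrib mpoly_ev_superset[of ?A f] mpoly_ev_superset[of ?A g] finite_Un finite_keys Un_upper1 Un_upper2)
  finally show ?thesis .
qed

lemma mpoly_ev_mult: "mpoly_ev w m (f * g) = mpoly_ev w m f * mpoly_ev w m g"
proof (induction f rule: mpolynomial_induct)
  case (add a b f)
  have "mpoly_ev w m (Poly_Mapping.single a b * g) = mpoly_ev w m (Poly_Mapping.single a b) * mpoly_ev w m g"
  proof (induction g rule: mpolynomial_induct)
    case (add c d g)
    then show ?case
      by (simp add: distrib_left mpoly_ev_add mult_single mpoly_ev_single lookup_add power_add prod.distrib mult_ac smult_add_right)
  qed (simp add: mpoly_ev_zero)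
  then show ?case using add by (simp add: distrib_right mpoly_ev_add)
qed (simp add: mpoly_ev_zero)

lemma mpoly_ev_mconst: "mpoly_ev w m (mconst c) = [:c:]"
  by (simp add: mconst_def mpoly_ev_single)

lemma mpoly_ev_one: "mpoly_ev w m 1 = 1"
  using mpoly_ev_single[of w m 0 1] by (simp flip: one_pCons)

lemma mpoly_ev_mvar: "i \<le> m \<Longrightarrow> mpoly_ev w m (mvar i) = w i"
proof -
  assume i: "i \<le> m"
  have "w k ^ Poly_Mapping.lookup (Poly_Mapping.single i 1) k = (if k = i then w i else 1)" for k
    by (simp add: lookup_single when_def)
  then show ?thesis using i by (simp add: mvar_def mpoly_ev_single)
qed

lemma mpoly_ev_uminus: "mpoly_ev w m (- f) = - mpoly_ev w m f"
  using mpoly_ev_add[of w m f "- f"] by (simp add: mpoly_ev_zero eq_neg_iff_add_eq_0 add.commute)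

lemma mpoly_ev_diff: "mpoly_ev w m (f - g) = mpoly_ev w m f - mpoly_ev w m g"
  using mpoly_ev_add[of w m f "- g"] by (simp add: mpoly_ev_uminus)

lemma mpoly_ev_prod: "mpoly_ev w m (\<Prod>i\<in>A. f i) = (\<Prod>i\<in>A. mpoly_ev w m (f i))"
  by (induction A rule: infinite_finite_induct) (simp_all add: mpoly_ev_one mpoly_ev_mult)

lemma mpoly_ev_sum: "mpoly_ev w m (\<Sum>i\<in>A. f i) = (\<Sum>i\<in>A. mpoly_ev w m (f i))"
  by (induction A rule: infinite_finite_induct) (simp_all add: mpoly_ev_zero mpoly_ev_add)

lemma mpoly_ev_cong: "(\<And>i. i \<le> m \<Longrightarrow> w i = w' i) \<Longrightarrow> mpoly_ev w m f = mpoly_ev w' m f"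
  unfolding mpoly_ev_def by (intro sum.cong prod.cong arg_cong2[where f = "(*)"] arg_cong2[where f = power] refl) simp

lemma poly_ring_simps [simp]:
  "f \<otimes>\<^bsub>poly_ring m\<^esub> g = f * g" "f \<oplus>\<^bsub>poly_ring m\<^esub> g = f + g" "\<one>\<^bsub>poly_ring m\<^esub> = 1" "\<zero>\<^bsub>poly_ring m\<^esub> = 0"
  by (simp_all add: poly_ring_def)

lemma poly_ring_carrier: "f \<in> carrier (poly_ring m) \<longleftrightarrow> (\<forall>e\<in>Poly_Mapping.keys f. Poly_Mapping.keys e \<subseteq> {0..m})"
  by (simp add: poly_ring_def)

lemma poly_ring_zero: "0 \<in> carrier (poly_ring m)"
  and poly_ring_one: "1 \<in> carrier (poly_ring m)"
  and poly_ring_mvar: "i \<le> m \<Longrightarrow> mvar i \<in> carrier (poly_ring m)"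
  and poly_ring_mconst: "mconst c \<in> carrier (poly_ring m)"
  and poly_ring_uminus: "f \<in> carrier (poly_ring m) \<Longrightarrow> - f \<in> carrier (poly_ring m)"
  by (auto simp: poly_ring_carrier mvar_def mconst_def)

lemma poly_ring_add: "f \<in> carrier (poly_ring m) \<Longrightarrow> g \<in> carrier (poly_ring m) \<Longrightarrow> f + g \<in> carrier (poly_ring m)"
  using Poly_Mapping.keys_add[of f g] by (fastforce simp: poly_ring_carrier)

lemma poly_ring_mult:
  assumes "f \<in> carrier (poly_ring m)" "g \<in> carrier (poly_ring m)" shows "f * g \<in> carrier (poly_ring m)"
  unfolding poly_ring_carrier
proof
  fix e assume "e \<in> Poly_Mapping.keys (f * g)"
  then obtain a b where "a \<in> Poly_Mapping.keys f" "b \<in> Poly_Mapping.keys g" "e = a + b"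
    using Poly_Mapping.keys_mult[of f g] by auto
  then show "Poly_Mapping.keys e \<subseteq> {0..m}"
    using assms Poly_Mapping.keys_add[of a b] unfolding poly_ring_carrier by blast
qed

lemma poly_ring_diff: "f \<in> carrier (poly_ring m) \<Longrightarrow> g \<in> carrier (poly_ring m) \<Longrightarrow> f - g \<in> carrier (poly_ring m)"
  using poly_ring_add[of f m "- g"] poly_ring_uminus[of g m] by simp

lemma poly_ring_prod: "(\<And>i. i \<in> A \<Longrightarrow> f i \<in> carrier (poly_ring m)) \<Longrightarrow> (\<Prod>i\<in>A. f i) \<in> carrier (poly_ring m)"
  by (induction A rule: infinite_finite_induct) (auto intro: poly_ring_one poly_ring_mult)

lemma ring_poly_ring: "ring (poly_ring m)"
proof (rule ringI)
  show "abelian_group (poly_ring m)"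
    by (rule abelian_groupI) (auto simp: poly_ring_add poly_ring_zero add_ac intro: bexI[OF _ poly_ring_uminus])
  show "Group.monoid (poly_ring m)"
    by (rule monoidI) (auto simp: poly_ring_mult poly_ring_one mult_ac)
qed (auto simp: algebra_simps)

lemma poly_ring_idealI:
  assumes "Z \<subseteq> carrier (poly_ring m)" "0 \<in> Z" "\<And>f g. f \<in> Z \<Longrightarrow> g \<in> Z \<Longrightarrow> f + g \<in> Z"
    and mult: "\<And>f g. f \<in> Z \<Longrightarrow> g \<in> carrier (poly_ring m) \<Longrightarrow> g * f \<in> Z"
  shows "ideal Z (poly_ring m)"
proof (rule idealI[OF ring_poly_ring])
  interpret ring "poly_ring m" by (rule ring_poly_ring)
  show "subgroup Z (add_monoid (poly_ring m))"
  proof (rule subgroup.intro)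
    fix f assume f: "f \<in> Z"
    have "- 1 * f \<in> Z" by (rule mult[OF f poly_ring_uminus[OF poly_ring_one]])
    moreover have "\<ominus>\<^bsub>poly_ring m\<^esub> f = - f"
      using f assms(1) by (intro minus_equality) (auto simp: poly_ring_uminus)
    ultimately show "inv\<^bsub>add_monoid (poly_ring m)\<^esub> f \<in> Z" by (simp add: a_inv_def)
  qed (use assms in auto)
qed (use mult in \<open>auto simp: mult.commute\<close>)

section \<open>Polynomials vanishing on a union of lines\<close>

text \<open>The line through the origin and \<open>(1, \<theta> 1 (J 1), \<dots>, \<theta> m (J m))\<close>.\<close>

definition line_ev :: "nat \<Rightarrow> (nat \<Rightarrow> nat \<Rightarrow> real) \<Rightarrow> (nat \<Rightarrow> nat) \<Rightarrow> mpolynomial \<Rightarrow> complex poly"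
  where "line_ev m \<theta> J = mpoly_ev (\<lambda>i. if i = 0 then Polynomial.monom 1 1 else Polynomial.monom (of_real (\<theta> i (J i))) 1) m"

lemma line_ev_covering_poly:
  "line_ev m \<theta> J (covering_poly m \<theta> A) = (\<Prod>i\<in>{1..m}. \<Prod>j\<in>A i. Polynomial.monom (of_real (\<theta> i (J i) - \<theta> i j)) 1)"
  unfolding line_ev_def covering_poly_def mpoly_ev_prod
  by (intro prod.cong refl) (simp add: mpoly_ev_diff mpoly_ev_mult mpoly_ev_mvar mpoly_ev_mconst smult_monom diff_monom)

text \<open>On the line of \<open>J\<close> each factor becomes a multiple of t by a difference of
  two \<theta> values. C[t] has no zero divisors, so the product vanishes iff some difference does,
  and the \<theta> values of one coordinate are distinct.\<close>

lemma line_ev_covering_poly_eq_0_iff: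
  assumes inj: "\<And>i. i \<in> {1..m} \<Longrightarrow> inj_on (\<theta> i) {1..n i}" and A: "\<And>i. i \<in> {1..m} \<Longrightarrow> A i \<subseteq> {1..n i}" and J: "J \<in> index_set m n"
  shows "line_ev m \<theta> J (covering_poly m \<theta> A) = 0 \<longleftrightarrow> (\<exists>i\<in>{1..m}. J i \<in> A i)"
proof -
  have "(\<exists>j\<in>A i. \<theta> i (J i) = \<theta> i j) \<longleftrightarrow> J i \<in> A i" if i: "i \<in> {1..m}" for i
  proof -
    have "J i \<in> {1..n i}" using J i by (auto simp: index_set_def)
    then have "\<theta> i (J i) = \<theta> i j \<longleftrightarrow> J i = j" if "j \<in> A i" for j
      using inj_on_eq_iff[OF inj[OF i]] A[OF i] that by blast
    then show ?thesis by auto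
  qed
  moreover have "finite (A i)" if "i \<in> {1..m}" for i using A[OF that] finite_subset by blast
  ultimately show ?thesis by (simp add: line_ev_covering_poly monom_eq_0_iff)
qed

text \<open>The embedding of C[t] as polynomials in variable 0. Newton coefficients are taken from
  it because t restricts to t on every line, so that \<open>line_ev\<close> returns the coefficient
  itself.\<close>

definition tpoly :: "complex poly \<Rightarrow> mpolynomial"
  where "tpoly q = poly (map_poly mconst q) (mvar 0)"

lemma tpoly_0: "tpoly 0 = 0"
  by (simp add: tpoly_def)

lemma tpoly_pCons: "tpoly (pCons c q) = mconst c + mvar 0 * tpoly q"
  by (simp add: tpoly_def map_poly_pCons mconst_def)

lemma tpoly_add: "tpoly (p + q) = tpoly p + tpoly q"
  by (induction p q rule: poly_induct2) (simp_all add: tpoly_0 tpoly_pCons mconst_def single_add algebra_simps)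

lemma tpoly_smult: "tpoly (Polynomial.smult c q) = mconst c * tpoly q"
  by (induction q rule: pCons_induct) (simp_all add: tpoly_0 tpoly_pCons mconst_def mult_single algebra_simps)

lemma tpoly_carrier: "tpoly q \<in> carrier (poly_ring m)"
  by (induction q rule: pCons_induct) (simp_all add: tpoly_0 tpoly_pCons poly_ring_zero poly_ring_add poly_ring_mult poly_ring_mvar poly_ring_mconst)

lemma line_ev_tpoly: "line_ev m \<theta> J (tpoly q) = q"
proof (induction q rule: pCons_induct)
  case (pCons c q)
  have "Polynomial.monom 1 1 * q = pCons 0 q" by (simp add: monom_altdef)
  then show ?case using pCons by (simp add: line_ev_def tpoly_pCons mpoly_ev_add mpoly_ev_mult mpoly_ev_mvar mpoly_ev_mconst)
qed (simp add: tpoly_0 line_ev_def mpoly_ev_zero)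

section \<open>Covering polynomials and reduction to minimal coverings\<close>

lemma covering_poly_carrier: "covering_poly m \<theta> A \<in> carrier (poly_ring m)"
  unfolding covering_poly_def
  by (intro poly_ring_prod poly_ring_diff poly_ring_mult poly_ring_mvar poly_ring_mconst) auto

lemma covering_poly_insert:
  assumes "i \<in> {1..m}" "finite (A i)" "j \<notin> A i"
  shows "covering_poly m \<theta> (A(i := insert j (A i))) = (mvar i - mconst (of_real (\<theta> i j)) * mvar 0) * covering_poly m \<theta> A"
proof -
  let ?g = "\<lambda>A i. \<Prod>j\<in>A i. mvar i - mconst (of_real (\<theta> i j)) * mvar 0"
  have "covering_poly m \<theta> (A(i := insert j (A i))) = ?g (A(i := insert j (A i))) i * (\<Prod>k\<in>{1..m} - {i}. ?g (A(i := insert j (A i))) k)"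
    unfolding covering_poly_def by (rule prod.remove) (use assms in auto)
  also have "(\<Prod>k\<in>{1..m} - {i}. ?g (A(i := insert j (A i))) k) = (\<Prod>k\<in>{1..m} - {i}. ?g A k)"
    by (rule prod.cong) auto
  also have "?g (A(i := insert j (A i))) i = (mvar i - mconst (of_real (\<theta> i j)) * mvar 0) * ?g A i"
    using assms by simp
  also have "(mvar i - mconst (of_real (\<theta> i j)) * mvar 0) * ?g A i * (\<Prod>k\<in>{1..m} - {i}. ?g A k) =
     (mvar i - mconst (of_real (\<theta> i j)) * mvar 0) * (\<Prod>k\<in>{1..m}. ?g A k)"
    by (subst prod.remove[of "{1..m}" i "?g A"]) (use assms in \<open>simp_all add: mult.assoc\<close>)
  finally show ?thesis by (simp add: covering_poly_def)
qed

lemma covering_poly_minimal: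
  assumes "covering m n D A"
  shows "\<exists>B g. minimal_covering m n D B \<and> g \<in> carrier (poly_ring m) \<and> covering_poly m \<theta> A = g * covering_poly m \<theta> B"
  using assms
proof (induction "\<Sum>i\<in>{1..m}. card (A i)" arbitrary: A rule: less_induct)
  case less
  have fin: "finite (A i)" if "i \<in> {1..m}" for i using less.prems that finite_subset unfolding covering_def by blast
  show ?case
  proof (cases "minimal_covering m n D A")
    case True
    then show ?thesis by (intro exI[of _ A] exI[of _ 1]) (simp add: poly_ring_one)
  next
    case False
    then obtain i j where i: "i \<in> {1..m}" "j \<in> A i" and cov: "covering m n D (A(i := A i - {j}))"
      using less.prems unfolding minimal_covering_def by blast
    let ?A = "A(i := A i - {j})"
    have "(\<Sum>i\<in>{1..m}. card (?A i)) < (\<Sum>i\<in>{1..m}. card (A i))"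
    proof (rule sum_strict_mono_ex1)
      show "\<forall>k\<in>{1..m}. card (?A k) \<le> card (A k)" using fin by (auto intro!: card_mono)
      show "\<exists>k\<in>{1..m}. card (?A k) < card (A k)"
        using card_Diff1_less[OF fin[OF i(1)] i(2)] by (intro bexI[OF _ i(1)]) (simp only: fun_upd_same)
    qed simp
    from less.hyps[OF this cov] obtain B g where "minimal_covering m n D B \<and> g \<in> carrier (poly_ring m) \<and>
      covering_poly m \<theta> ?A = g * covering_poly m \<theta> B" by (elim exE)
    then have B: "minimal_covering m n D B" "g \<in> carrier (poly_ring m)"
      "covering_poly m \<theta> ?A = g * covering_poly m \<theta> B" by simp_all
    have "?A(i := insert j (?A i)) = A" using i by (auto simp: fun_eq_iff)
    then have "covering_poly m \<theta> A = (mvar i - mconst (of_real (\<theta> i j)) * mvar 0) * covering_poly m \<theta> ?A"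
      using covering_poly_insert[of i m ?A j \<theta>] i fin by simp
    then have "covering_poly m \<theta> A = ((mvar i - mconst (of_real (\<theta> i j)) * mvar 0) * g) * covering_poly m \<theta> B"
      using B(3) by (simp add: mult.assoc)
    moreover have "(mvar i - mconst (of_real (\<theta> i j)) * mvar 0) * g \<in> carrier (poly_ring m)"
      using i by (intro poly_ring_mult[OF _ B(2)] poly_ring_diff poly_ring_mult poly_ring_mvar poly_ring_mconst) auto
    ultimately show ?thesis using B(1) by blast
  qed
qed

text \<open>
  The order in each coordinate in which \<open>D\<close> is an upper set is given by \<open>r\<close>.  The polynomials of
  the segments \<open>A\<close> (tuples of upper sets for \<open>r\<close>) form a Newton basis over the polynomials in \<open>t\<close>; those of
  the covering segments lie in the ideal, and the others are triangular with respect to evaluation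
  on the lines \<open>top A\<close>.
\<close>

locale upper_set =
  fixes m :: nat and n :: "nat \<Rightarrow> nat" and \<theta> r :: "nat \<Rightarrow> nat \<Rightarrow> real" and D :: "(nat \<Rightarrow> nat) set"
  assumes inj: "\<And>i. i \<in> {1..m} \<Longrightarrow> inj_on (\<theta> i) {1..n i}"
    and inj_r: "\<And>i. i \<in> {1..m} \<Longrightarrow> inj_on (r i) {1..n i}"
    and D: "D \<subseteq> index_set m n"
    and upper: "\<And>J J'. J \<in> D \<Longrightarrow> J' \<in> index_set m n \<Longrightarrow> (\<And>i. i \<in> {1..m} \<Longrightarrow> r i (J i) \<le> r i (J' i)) \<Longrightarrow> J' \<in> D"
begin

abbreviation "N \<equiv> covering_poly m \<theta>"
abbreviation "R \<equiv> poly_ring m"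

definition vanishing :: "mpolynomial set"
  where "vanishing = {f \<in> carrier R. \<forall>J\<in>D. line_ev m \<theta> J f = 0}"

definition generators :: "mpolynomial set"
  where "generators = N ` {A. minimal_covering m n D A}"

text \<open>\<open>PiE\<close> makes a tuple determined by its entries at 1, ..., m, so that there
  are finitely many and each Newton polynomial is indexed by its tuple of segments exactly
  once.\<close>

definition segments :: "(nat \<Rightarrow> nat set) set"
  where "segments = {A \<in> PiE {1..m} (\<lambda>i. Pow {1..n i}). \<forall>i\<in>{1..m}. \<forall>j\<in>A i. \<forall>j'\<in>{1..n i}. r i j \<le> r i j' \<longrightarrow> j' \<in> A i}"

definition free_segments :: "(nat \<Rightarrow> nat set) set"
  where "free_segments = {A \<in> segments. \<not> covering m n D A}"

lemma D_range:
  assumes "J \<in> D" "i \<in> {1..m}" shows "J i \<in> {1..n i}"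
  using subsetD[OF D assms(1)] assms(2) unfolding index_set_def by (rule PiE_mem)

lemma covering_vanishing:
  assumes "covering m n D A" shows "N A \<in> vanishing"
  unfolding vanishing_def mem_Collect_eq
proof (intro conjI ballI covering_poly_carrier)
  fix J assume J: "J \<in> D"
  have A: "A i \<subseteq> {1..n i}" if "i \<in> {1..m}" for i using assms that by (simp add: covering_def)
  have "J \<in> index_set m n" using J D by (rule subsetD[rotated])
  moreover have "\<exists>i\<in>{1..m}. J i \<in> A i" using assms J unfolding covering_def by blast
  ultimately show "line_ev m \<theta> J (N A) = 0"
    using line_ev_covering_poly_eq_0_iff[of m \<theta> n A J, OF inj A] by simp
qed

lemma generators_vanishing: "generators \<subseteq> vanishing"
  unfolding generators_def by (intro image_subsetI covering_vanishing) (simp add: minimal_covering_def)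

lemma ideal_vanishing: "ideal vanishing R"
  by (rule poly_ring_idealI)
    (auto simp: vanishing_def poly_ring_zero poly_ring_add poly_ring_mult line_ev_def mpoly_ev_zero mpoly_ev_add mpoly_ev_mult)

abbreviation "I \<equiv> Idl\<^bsub>R\<^esub> generators"

lemma generators_carrier: "generators \<subseteq> carrier R"
  using generators_vanishing by (auto simp: vanishing_def)

lemma ideal_I: "ideal I R"
  by (rule ring.genideal_ideal[OF ring_poly_ring generators_carrier])

lemma I_vanishing: "I \<subseteq> vanishing"
  by (rule ring.genideal_minimal[OF ring_poly_ring ideal_vanishing generators_vanishing])

lemma I_add: "f \<in> I \<Longrightarrow> g \<in> I \<Longrightarrow> f + g \<in> I"
  using additive_subgroup.a_closed[OF ideal.axioms(1)[OF ideal_I]] by simp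

lemma I_mult: "f \<in> I \<Longrightarrow> g \<in> carrier R \<Longrightarrow> g * f \<in> I"
  using ideal.I_l_closed[OF ideal_I] by simp

lemma I_zero: "0 \<in> I"
  using additive_subgroup.zero_closed[OF ideal.axioms(1)[OF ideal_I]] by simp

lemma covering_I:
  assumes "covering m n D A" shows "N A \<in> I"
proof -
  obtain B g where "minimal_covering m n D B \<and> g \<in> carrier R \<and> N A = g * N B"
    using covering_poly_minimal[OF assms, of \<theta>] by (elim exE)
  then have B: "minimal_covering m n D B" "g \<in> carrier R" "N A = g * N B" by simp_all
  have "N B \<in> I" using B(1) ring.genideal_self[OF ring_poly_ring generators_carrier] by (auto simp: generators_def)
  then show ?thesis using I_mult B by simp
qed

section \<open>Segments that do not cover and the lines attached to them\<close>

lemma finite_segments: "finite segments"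
  unfolding segments_def by (rule finite_subset[of _ "PiE {1..m} (\<lambda>i. Pow {1..n i})"]) (auto intro!: finite_PiE)

lemma segments_subset: "A \<in> segments \<Longrightarrow> i \<in> {1..m} \<Longrightarrow> A i \<subseteq> {1..n i}"
  by (auto simp: segments_def PiE_iff)

text \<open>Failure to cover gives a member of \<open>D\<close> that avoids \<open>A\<close>.
  Replacing each of its coordinates by the greatest index outside \<open>A i\<close> only raises it,
  so the result stays in \<open>D\<close> by \<open>upper\<close>.\<close>

lemma free_segment_top:
  assumes A: "A \<in> free_segments"
  shows "\<exists>J\<in>D. (\<forall>i\<in>{1..m}. J i \<notin> A i \<and> (\<forall>j\<in>{1..n i} - A i. r i j \<le> r i (J i)))"
proof -
  obtain J where J: "J \<in> D" "\<And>i. i \<in> {1..m} \<Longrightarrow> J i \<notin> A i"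
  proof -
    have "\<not> D \<subseteq> (\<Union>i\<in>{1..m}. {J \<in> index_set m n. J i \<in> A i})"
      using A segments_subset[of A] by (auto simp: free_segments_def covering_def)
    then obtain J where "J \<in> D" "J \<notin> (\<Union>i\<in>{1..m}. {J \<in> index_set m n. J i \<in> A i})" by blast
    then show thesis using that[of J] D by blast
  qed
  have Ji: "J i \<in> {1..n i} - A i" if "i \<in> {1..m}" for i using J D_range that by blast
  have "\<exists>j\<in>{1..n i} - A i. \<forall>j'\<in>{1..n i} - A i. r i j' \<le> r i j" if "i \<in> {1..m}" for i
  proof -
    let ?S = "r i ` ({1..n i} - A i)"
    have "finite ?S" "?S \<noteq> {}" using Ji[OF that] by auto
    from Max_in[OF this] obtain j where "j \<in> {1..n i} - A i" "Max ?S = r i j" by blast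
    then show ?thesis using Max_ge[OF \<open>finite ?S\<close>] by (metis imageI)
  qed
  then obtain T where T: "\<And>i. i \<in> {1..m} \<Longrightarrow> T i \<in> {1..n i} - A i"
     "\<And>i j. i \<in> {1..m} \<Longrightarrow> j \<in> {1..n i} - A i \<Longrightarrow> r i j \<le> r i (T i)" by metis
  have "restrict T {1..m} \<in> index_set m n" using T(1) by (auto simp: index_set_def)
  then have "restrict T {1..m} \<in> D" using T(2) Ji by (intro upper[OF J(1)]) auto
  then show ?thesis using T by (intro bexI[of _ "restrict T {1..m}"]) auto
qed

definition top :: "(nat \<Rightarrow> nat set) \<Rightarrow> nat \<Rightarrow> nat"
  where "top A = (SOME J. J \<in> D \<and> (\<forall>i\<in>{1..m}. J i \<notin> A i \<and> (\<forall>j\<in>{1..n i} - A i. r i j \<le> r i (J i))))"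

lemma top:
  assumes "A \<in> free_segments"
  shows "top A \<in> D" "i \<in> {1..m} \<Longrightarrow> top A i \<notin> A i" "i \<in> {1..m} \<Longrightarrow> j \<in> {1..n i} - A i \<Longrightarrow> r i j \<le> r i (top A i)"
    "i \<in> {1..m} \<Longrightarrow> top A i \<in> {1..n i}"
proof -
  have *: "top A \<in> D \<and> (\<forall>i\<in>{1..m}. top A i \<notin> A i \<and> (\<forall>j\<in>{1..n i} - A i. r i j \<le> r i (top A i)))"
    unfolding top_def using free_segment_top[OF assms] unfolding Bex_def by (rule someI_ex)
  then show "top A \<in> D" "i \<in> {1..m} \<Longrightarrow> top A i \<notin> A i" "i \<in> {1..m} \<Longrightarrow> j \<in> {1..n i} - A i \<Longrightarrow> r i j \<le> r i (top A i)"
    by blast+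
  show "i \<in> {1..m} \<Longrightarrow> top A i \<in> {1..n i}" using * D_range by blast
qed

section \<open>Newton expansion of every polynomial modulo the ideal\<close>

definition newton :: "mpolynomial set"
  where "newton = {f. \<exists>g\<in>I. \<exists>q. f = g + (\<Sum>A\<in>free_segments. tpoly (q A) * N A)}"

lemma newtonE:
  assumes "f \<in> newton"
  obtains g q where "g \<in> I" "f = g + (\<Sum>A\<in>free_segments. tpoly (q A) * N A)"
  using assms[unfolded newton_def mem_Collect_eq] that by (elim bexE exE)

lemma newtonI: "g \<in> I \<Longrightarrow> f = g + (\<Sum>A\<in>free_segments. tpoly (q A) * N A) \<Longrightarrow> f \<in> newton"
  unfolding newton_def mem_Collect_eq by (intro bexI exI)

lemma finite_free_segments: "finite free_segments"
  using finite_segments finite_subset[of free_segments segments] by (auto simp: free_segments_def)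

lemma newton_add:
  assumes "f \<in> newton" "f' \<in> newton" shows "f + f' \<in> newton"
proof -
  obtain g q where f: "g \<in> I" "f = g + (\<Sum>A\<in>free_segments. tpoly (q A) * N A)"
    by (rule newtonE[OF assms(1)])
  obtain g' q' where f': "g' \<in> I" "f' = g' + (\<Sum>A\<in>free_segments. tpoly (q' A) * N A)"
    by (rule newtonE[OF assms(2)])
  show ?thesis
    by (rule newtonI[of "g + g'" _ "\<lambda>A. q A + q' A"])
      (simp_all add: f f' I_add tpoly_add distrib_right sum.distrib)
qed

lemma newton_I: "g \<in> I \<Longrightarrow> g \<in> newton"
  by (rule newtonI[of g _ "\<lambda>_. 0"]) (simp_all add: tpoly_0)

lemma newton_basis:
  assumes A: "A \<in> segments" shows "tpoly q * N A \<in> newton"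
proof (cases "A \<in> free_segments")
  case True
  have "(\<Sum>B\<in>free_segments. tpoly ((if B = A then q else 0)) * N B) = (\<Sum>B\<in>free_segments. if B = A then tpoly q * N A else 0)"
    by (intro sum.cong) (auto simp: tpoly_0)
  also have "\<dots> = tpoly q * N A" using True finite_free_segments by simp
  finally show ?thesis
    by (intro newtonI[of 0 _ "\<lambda>B. if B = A then q else 0"]) (simp_all add: I_zero)
next
  case False
  then have "covering m n D A" using A by (simp add: free_segments_def)
  then show ?thesis by (intro newton_I I_mult covering_I tpoly_carrier)
qed

lemma newton_sum: "(\<And>a. a \<in> X \<Longrightarrow> f a \<in> newton) \<Longrightarrow> (\<Sum>a\<in>X. f a) \<in> newton"
  by (induction X rule: infinite_finite_induct) (auto intro: newton_add newton_I I_zero)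

text \<open>Adding the greatest missing index to an upper set keeps it an upper set; injectivity of
  \<open>r i\<close> excludes a second missing index of the same height.\<close>

lemma segment_insert_top:
  assumes A: "A \<in> free_segments" and i: "i \<in> {1..m}"
  shows "A(i := insert (top A i) (A i)) \<in> segments"
proof -
  have s: "A \<in> segments" using A by (simp add: free_segments_def)
  have "j' \<in> insert (top A i) (A i)" if "r i (top A i) \<le> r i j'" "j' \<in> {1..n i}" for j'
  proof (rule ccontr)
    assume *: "j' \<notin> insert (top A i) (A i)"
    then have "r i j' = r i (top A i)" using top(3)[OF A i, of j'] that by simp
    then show False using inj_onD[OF inj_r[OF i]] that(2) top(4)[OF A i] * by blast
  qed
  then show ?thesis
    using s i top(4)[OF A i] by (auto simp: segments_def PiE_iff extensional_def)
qed

lemma newton_mult: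
  assumes c: "c \<in> carrier R" and basis: "\<And>A q. A \<in> free_segments \<Longrightarrow> c * (tpoly q * N A) \<in> newton" and f: "f \<in> newton"
  shows "c * f \<in> newton"
proof -
  obtain g q where f: "g \<in> I" "f = g + (\<Sum>A\<in>free_segments. tpoly (q A) * N A)"
    by (rule newtonE[OF f])
  have "c * g + (\<Sum>A\<in>free_segments. c * (tpoly (q A) * N A)) \<in> newton"
    by (intro newton_add newton_I I_mult f(1) c newton_sum basis)
  then show ?thesis using f(2) by (simp add: distrib_left sum_distrib_left)
qed

lemma free_segments_segments: "A \<in> free_segments \<Longrightarrow> A \<in> segments"
  by (simp add: free_segments_def)

lemma newton_mconst: "f \<in> newton \<Longrightarrow> mconst c * f \<in> newton"
proof (rule newton_mult[OF poly_ring_mconst])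
  fix A q assume "A \<in> free_segments"
  then have "tpoly (Polynomial.smult c q) * N A \<in> newton" by (intro newton_basis free_segments_segments)
  then show "mconst c * (tpoly q * N A) \<in> newton" by (simp add: tpoly_smult mult.assoc)
qed

lemma newton_mvar_0: "f \<in> newton \<Longrightarrow> mvar 0 * f \<in> newton"
proof (rule newton_mult[OF poly_ring_mvar])
  fix A q assume "A \<in> free_segments"
  then have "tpoly (pCons 0 q) * N A \<in> newton" by (intro newton_basis free_segments_segments)
  then show "mvar 0 * (tpoly q * N A) \<in> newton" by (simp add: tpoly_pCons mconst_def mult.assoc)
qed simp_all

text \<open>Newton's relation: x_i N_A equals N_B + \<theta> t N_A, where B is A with
  \<open>top A i\<close> adjoined in coordinate i. If B is a covering, then N_B lies in the ideal,
  which \<open>newton_basis\<close> has absorbed.\<close>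

lemma newton_mvar:
  assumes "i \<le> m" "f \<in> newton" shows "mvar i * f \<in> newton"
proof (cases "i = 0")
  case True
  then show ?thesis using newton_mvar_0 assms by simp
next
  case False
  then have i: "i \<in> {1..m}" using assms by simp
  show ?thesis
  proof (rule newton_mult[OF poly_ring_mvar[OF assms(1)] _ assms(2)])
    fix A q assume A: "A \<in> free_segments"
    let ?j = "top A i" and ?B = "A(i := insert (top A i) (A i))"
    have "finite (A i)" using segments_subset[OF free_segments_segments[OF A] i] finite_subset by blast
    then have B: "N ?B = (mvar i - mconst (of_real (\<theta> i ?j)) * mvar 0) * N A"
      by (rule covering_poly_insert[where A = A, OF i _ top(2)[OF A i]])
    have "tpoly q * N ?B + mconst (of_real (\<theta> i ?j)) * (mvar 0 * (tpoly q * N A)) \<in> newton"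
      by (intro newton_add newton_mconst newton_mvar_0 newton_basis segment_insert_top[OF A i] free_segments_segments[OF A])
    then show "mvar i * (tpoly q * N A) \<in> newton" unfolding B by (simp add: algebra_simps)
  qed
qed

lemma newton_one: "1 \<in> newton"
proof -
  \<comment> \<open>The tuple of empty segments has the empty product 1 as its polynomial.\<close>
  have "(\<lambda>i\<in>{1..m}. {}) \<in> segments" by (auto simp: segments_def)
  from newton_basis[OF this, of 1] show ?thesis
    by (simp add: covering_poly_def one_pCons tpoly_pCons tpoly_0 mconst_def)
qed

text \<open>\<open>newton\<close> contains 1 and is closed under sums, scalars and the variables,
  hence contains all monomials and then all polynomials.\<close>

lemma newton_carrier:
  assumes "f \<in> carrier R" shows "f \<in> newton"
proof -
  have pow: "Poly_Mapping.single (Poly_Mapping.single i b + e) 1 \<in> newton"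
    if "i \<le> m" "Poly_Mapping.single e 1 \<in> newton" for i b and e :: "nat \<Rightarrow>\<^sub>0 nat"
  proof (induction b)
    case (Suc b)
    have "mvar i * Poly_Mapping.single (Poly_Mapping.single i b + e) 1 = Poly_Mapping.single (Poly_Mapping.single i (Suc b) + e) (1 :: complex)"
      by (simp add: mvar_def mult_single add.assoc[symmetric] flip: single_add)
    then show ?case using newton_mvar[OF that(1) Suc] by simp
  qed (use that in simp)
  have mono: "Poly_Mapping.keys e \<subseteq> {0..m} \<longrightarrow> Poly_Mapping.single e 1 \<in> newton" for e :: "nat \<Rightarrow>\<^sub>0 nat"
  proof (induction e rule: mpolynomial_induct)
    case zero
    then show ?case using newton_one by simp
  next
    case (add i b e)
    have "Poly_Mapping.keys (Poly_Mapping.single i b + e) = insert i (Poly_Mapping.keys e)"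
      using add(1,2) by (auto simp: in_keys_iff lookup_add lookup_single when_def split: if_splits)
    then show ?case using add(3) pow[of i e b] by auto
  qed
  have "f \<in> carrier R \<longrightarrow> f \<in> newton"
  proof (induction f rule: mpolynomial_induct)
    case zero
    then show ?case using newton_I[OF I_zero] by simp
  next
    case (add e c f)
    have "Poly_Mapping.keys (Poly_Mapping.single e c + f) = insert e (Poly_Mapping.keys f)"
      using add(1,2) by (auto simp: in_keys_iff lookup_add lookup_single when_def split: if_splits)
    moreover have "mconst c * Poly_Mapping.single e 1 = Poly_Mapping.single e c" by (simp add: mconst_def mult_single)
    ultimately show ?case
      using add(3) newton_add[of "Poly_Mapping.single e c" f] newton_mconst[of "Poly_Mapping.single e 1" c] mono[of e]
      by (auto simp: poly_ring_carrier)
  qed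
  then show ?thesis using assms by blast
qed

text \<open>The triangularity. If \<open>B i\<close> has an element outside \<open>A i\<close>, then
  \<open>top A i\<close> is at least as high and belongs to the upper set \<open>B i\<close>, so a
  factor of N_B vanishes on the line \<open>top A\<close>. If \<open>B\<close> is contained in
  \<open>A\<close>, then \<open>top A\<close> avoids \<open>B\<close>.\<close>

lemma line_ev_free_segment:
  assumes A: "A \<in> free_segments" and B: "B \<in> segments"
  shows "line_ev m \<theta> (top A) (N B) = 0 \<longleftrightarrow> \<not> (\<forall>i\<in>{1..m}. B i \<subseteq> A i)"
proof -
  have "(\<exists>i\<in>{1..m}. top A i \<in> B i) \<longleftrightarrow> \<not> (\<forall>i\<in>{1..m}. B i \<subseteq> A i)"
  proof
    assume "\<exists>i\<in>{1..m}. top A i \<in> B i"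
    then show "\<not> (\<forall>i\<in>{1..m}. B i \<subseteq> A i)" using top(2)[OF A] by blast
  next
    assume "\<not> (\<forall>i\<in>{1..m}. B i \<subseteq> A i)"
    then obtain i j where i: "i \<in> {1..m}" "j \<in> B i" "j \<notin> A i" by blast
    then have "j \<in> {1..n i} - A i" using segments_subset[OF B] by blast
    then have "top A i \<in> B i" using B i top(3,4)[OF A i(1)] unfolding segments_def by blast
    then show "\<exists>i\<in>{1..m}. top A i \<in> B i" using i by blast
  qed
  moreover have "line_ev m \<theta> (top A) (N B) = 0 \<longleftrightarrow> (\<exists>i\<in>{1..m}. top A i \<in> B i)"
    by (rule line_ev_covering_poly_eq_0_iff[OF inj segments_subset[OF B]]) (use top(1)[OF A] D in auto)
  ultimately show ?thesis by blast
qed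

text \<open>Subtracting the part in the ideal leaves a C[t]-combination of free Newton polynomials
  that still vanishes on all lines of \<open>D\<close>. Evaluation on the lines \<open>top A\<close>
  shows that its coefficients are zero.\<close>

lemma vanishing_I:
  assumes f: "f \<in> vanishing" shows "f \<in> I"
proof -
  have fc: "f \<in> carrier R" using f by (simp add: vanishing_def)
  obtain g q where g: "g \<in> I" and fg: "f = g + (\<Sum>A\<in>free_segments. tpoly (q A) * N A)"
    by (rule newtonE[OF newton_carrier[OF fc]])
  have z: "(\<Sum>A\<in>free_segments. q A * line_ev m \<theta> J (N A)) = 0" if "J \<in> D" for J
  proof -
    have "line_ev m \<theta> J f = 0" "line_ev m \<theta> J g = 0" using f g I_vanishing that by (auto simp: vanishing_def)
    moreover have "line_ev m \<theta> J f = line_ev m \<theta> J g + (\<Sum>A\<in>free_segments. line_ev m \<theta> J (tpoly (q A)) * line_ev m \<theta> J (N A))"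
      unfolding fg line_ev_def by (simp add: mpoly_ev_add mpoly_ev_sum mpoly_ev_mult)
    ultimately show ?thesis by (simp add: line_ev_tpoly)
  qed
  have "q A = 0" if "A \<in> free_segments" for A
    using that
  \<comment> \<open>On the line \<open>top A\<close>, a tuple not contained in \<open>A\<close>
    contributes 0 by triangularity, and a properly contained one is smaller and has coefficient 0 by
    induction. What remains is the coefficient of \<open>A\<close> times a nonzero polynomial in
    C[t].\<close>
  proof (induction "\<Sum>i\<in>{1..m}. card (A i)" arbitrary: A rule: less_induct)
    case less
    have "q B * line_ev m \<theta> (top A) (N B) = 0" if B: "B \<in> free_segments" "B \<noteq> A" for B
    proof (cases "\<forall>i\<in>{1..m}. B i \<subseteq> A i")
      case True
      have ext: "A \<in> extensional {1..m}" "B \<in> extensional {1..m}"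
        using B(1) less.prems by (auto simp: free_segments_def segments_def PiE_iff)
      then obtain i where i: "i \<in> {1..m}" "B i \<noteq> A i" using B(2) extensionalityI by blast
      have fin: "finite (A i)" if "i \<in> {1..m}" for i
        using segments_subset[OF free_segments_segments[OF less.prems] that] finite_subset by blast
      have "(\<Sum>i\<in>{1..m}. card (B i)) < (\<Sum>i\<in>{1..m}. card (A i))"
      proof (rule sum_strict_mono_ex1)
        show "\<forall>i\<in>{1..m}. card (B i) \<le> card (A i)" using True fin by (intro ballI card_mono) blast+
        show "\<exists>i\<in>{1..m}. card (B i) < card (A i)" using True fin i by (intro bexI[of _ i] psubset_card_mono) auto
      qed simp
      then show ?thesis using less.hyps[OF _ B(1)] by simp
    next
      case False
      then show ?thesis using line_ev_free_segment[OF less.prems free_segments_segments[OF B(1)]] by simp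
    qed
    then have "(\<Sum>B\<in>free_segments - {A}. q B * line_ev m \<theta> (top A) (N B)) = 0" by (intro sum.neutral) auto
    then have "q A * line_ev m \<theta> (top A) (N A) = 0"
      using z[OF top(1)[OF less.prems]] sum.remove[OF finite_free_segments less.prems, of "\<lambda>B. q B * line_ev m \<theta> (top A) (N B)"] by simp
    moreover have "line_ev m \<theta> (top A) (N A) \<noteq> 0"
      using line_ev_free_segment[OF less.prems free_segments_segments[OF less.prems]] by simp
    ultimately show ?case by simp
  qed
  then have "f = g" unfolding fg by (simp add: tpoly_0)
  then show ?thesis using g by simp
qed

theorem generated: "generators \<subseteq> vanishing" "Idl\<^bsub>R\<^esub> generators = vanishing"
  using generators_vanishing I_vanishing vanishing_I by auto

end

section \<open>From fixed points of the product to index tuples\<close>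

lemma fixed_point_index:
  assumes "\<And>i. i \<in> {1..m} \<Longrightarrow> bij_betw (\<theta> i) {1..n i} (\<mu> i ` F i)"
  shows "p \<in> PiE {1..m} F \<Longrightarrow> \<exists>J\<in>index_set m n. \<forall>i\<in>{1..m}. \<theta> i (J i) = \<mu> i (p i)"
    and "J \<in> index_set m n \<Longrightarrow> \<exists>p\<in>PiE {1..m} F. \<forall>i\<in>{1..m}. \<theta> i (J i) = \<mu> i (p i)"
proof -
  have im: "\<theta> i ` {1..n i} = \<mu> i ` F i" if "i \<in> {1..m}" for i
    using bij_betw_imp_surj_on[OF assms[OF that]] .
  show "\<exists>J\<in>index_set m n. \<forall>i\<in>{1..m}. \<theta> i (J i) = \<mu> i (p i)" if p: "p \<in> PiE {1..m} F"
  proof -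
    have "\<exists>j\<in>{1..n i}. \<theta> i j = \<mu> i (p i)" if "i \<in> {1..m}" for i
    proof -
      have "\<mu> i (p i) \<in> \<theta> i ` {1..n i}" unfolding im[OF that] using PiE_mem[OF p that] by (rule imageI)
      then show ?thesis by force
    qed
    then obtain J where J: "\<And>i. i \<in> {1..m} \<Longrightarrow> J i \<in> {1..n i} \<and> \<theta> i (J i) = \<mu> i (p i)" by metis
    then have "restrict J {1..m} \<in> index_set m n" unfolding index_set_def by (intro restrict_PiE_iff[THEN iffD2]) blast
    then show ?thesis using J by (intro bexI[of _ "restrict J {1..m}"]) simp_all
  qed
  show "\<exists>p\<in>PiE {1..m} F. \<forall>i\<in>{1..m}. \<theta> i (J i) = \<mu> i (p i)" if J: "J \<in> index_set m n"
  proof -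
    have "\<exists>x\<in>F i. \<theta> i (J i) = \<mu> i x" if "i \<in> {1..m}" for i
    proof -
      have "\<theta> i (J i) \<in> \<mu> i ` F i" unfolding im[OF that, symmetric] using PiE_mem[OF J[unfolded index_set_def] that] by (rule imageI)
      then show ?thesis by force
    qed
    then obtain p where p: "\<And>i. i \<in> {1..m} \<Longrightarrow> p i \<in> F i \<and> \<theta> i (J i) = \<mu> i (p i)" by metis
    then have "restrict p {1..m} \<in> PiE {1..m} F" by (intro restrict_PiE_iff[THEN iffD2]) blast
    then show ?thesis using p by (intro bexI[of _ "restrict p {1..m}"]) simp_all
  qed
qed

lemma (in circle_family) homogeneous_form_pullback_proj:
  "homogeneous_form r \<omega> \<Longrightarrow> homogeneous_form r (pullback P (M i) (\<lambda>p. p i) \<omega>)"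
  by (simp add: homogeneous_form_def pullback_def)

theorem theorem2:
  fixes m :: nat
    and M :: "nat \<Rightarrow> ('a, 'k) manifold"
    and a :: "nat \<Rightarrow> complex \<Rightarrow> 'a \<Rightarrow> 'a"
    and x :: "nat \<Rightarrow> 'a form"
    and \<mu> :: "nat \<Rightarrow> 'a \<Rightarrow> real"
    and n :: "nat \<Rightarrow> nat"
    and \<theta> :: "nat \<Rightarrow> nat \<Rightarrow> real"
  defines "P \<equiv> mfd_prod {1..m} M"
    and "aP \<equiv> diagonal_action {1..m} a"
    and "xP \<equiv> \<lambda>i. pullback (mfd_prod {1..m} M) (M i) (\<lambda>p. p i) (x i)"
    and "\<mu>P \<equiv> \<lambda>i p. \<mu> i (p i)"
    and "\<mu>sum \<equiv> \<lambda>p. \<Sum>i\<in>{1..m}. \<mu> i (p i)"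
  assumes manifold: "\<And>i. i \<in> {1..m} \<Longrightarrow>
        smooth_manifold (M i) \<and> compact_space (mtop (M i)) \<and> connected_space (mtop (M i))"
    and action: "\<And>i. i \<in> {1..m} \<Longrightarrow> circle_action (M i) (a i)"
    and isolated: "\<And>i. i \<in> {1..m} \<Longrightarrow> isolated_fixed_points (M i) (a i)"
    and two_form: "\<And>i. i \<in> {1..m} \<Longrightarrow>
        x i \<in> invariant_forms (M i) (a i) \<and> homogeneous_form 2 (x i) \<and> real_form (x i)"
    and closed: "\<And>i. i \<in> {1..m} \<Longrightarrow> has_ext_deriv (M i) (x i) (\<lambda>_ _. 0)"
    and generates: "\<And>i. i \<in> {1..m} \<Longrightarrow> cohomology_generated_by (M i) (x i)"
    and moment: "\<And>i. i \<in> {1..m} \<Longrightarrow> moment_map (M i) (a i) (x i) (\<mu> i)"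
    and formally_hamiltonian:
      "morse_bott P \<mu>sum" "critical_points P \<mu>sum = fixed_points P aP"
    and regular: "regular_value P \<mu>sum 0"
    and fixed_values: "\<And>i. i \<in> {1..m} \<Longrightarrow>
        bij_betw (\<theta> i) {1..n i} (\<mu> i ` fixed_points (M i) (a i))"
  defines "K_plus \<equiv> vanishing_ideal P aP {p. \<mu>sum p > 0}"
    and "K_minus \<equiv> vanishing_ideal P aP {p. \<mu>sum p < 0}"
  defines "Kbar_plus \<equiv> {f \<in> carrier (poly_ring m). eta P aP xP \<mu>P m f \<in> K_plus}"
    and "Kbar_minus \<equiv> {f \<in> carrier (poly_ring m). eta P aP xP \<mu>P m f \<in> K_minus}"
  shows
    "(covering_poly m \<theta> ` {A. minimal_covering m n (large_set m n \<theta>) A} \<subseteq> Kbar_plus \<and>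
      Idl\<^bsub>poly_ring m\<^esub> (covering_poly m \<theta> ` {A. minimal_covering m n (large_set m n \<theta>) A})
        = Kbar_plus) \<and>
     (covering_poly m \<theta> ` {A. minimal_covering m n (small_set m n \<theta>) A} \<subseteq> Kbar_minus \<and>
      Idl\<^bsub>poly_ring m\<^esub> (covering_poly m \<theta> ` {A. minimal_covering m n (small_set m n \<theta>) A})
        = Kbar_minus)"
proof -
  interpret F: circle_family "{1..m}" M a
    by unfold_locales (use manifold action in auto)
  interpret C: cartan_model "mfd_prod {1..m} M" "diagonal_action {1..m} a"
    by unfold_locales (rule F.charted_P, rule F.diagonal_action_points)
  have data: "xP i \<in> invariant_forms P aP \<and> zero_form P (\<lambda>p. of_real (\<mu>P i p)) \<in> invariant_forms P aP \<and>
     has_ext_deriv P (xP i) (\<lambda>_ _. 0) \<and>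
     has_ext_deriv P (zero_form P (\<lambda>p. of_real (\<mu>P i p))) (interior (generating_field P aP) (xP i)) \<and>
     homogeneous_form 2 (xP i)" if i: "i \<in> {1..m}" for i
  proof -
    have x: "x i \<in> invariant_forms (M i) (a i)" and h: "homogeneous_form 2 (x i)" using two_form[OF i] by simp_all
    show ?thesis
      unfolding P_def aP_def xP_def \<mu>P_def
      using F.moment_form_diagonal[OF i x closed[OF i] moment[OF i]] F.homogeneous_form_pullback_proj[OF h] by blast
  qed
  have carrier: "eta P aP xP \<mu>P m f \<in> carrier (equiv_cohomology P aP)" for f
    unfolding P_def aP_def by (rule C.eta_restrict(1)) (rule data[unfolded P_def aP_def])
  have restr: "restrict_class p (eta P aP xP \<mu>P m f) =
      mpoly_ev (\<lambda>i. if i = 0 then Polynomial.monom 1 1 else Polynomial.monom (of_real (\<mu> i (p i))) 1) m f"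
    if "p \<in> fixed_points P aP" for p f
    using C.eta_restrict(2)[of m xP \<mu>P p f, OF data[unfolded P_def aP_def] that[unfolded P_def aP_def]]
    unfolding P_def aP_def \<mu>P_def .
  have fixed: "fixed_points P aP = PiE {1..m} (\<lambda>i. fixed_points (M i) (a i))"
    unfolding P_def aP_def by (rule F.fixed_points_diagonal)
  \<comment> \<open>A general condition \<open>Q\<close> on the value of the moment map serves both
    signs. Each fixed point restricts \<open>eta f\<close> to the value on the line of its index
    tuple, and every index tuple comes from some fixed point, so the two vanishing conditions
    agree.\<close>
  have key: "{f \<in> carrier (poly_ring m). eta P aP xP \<mu>P m f \<in> vanishing_ideal P aP {p. Q (\<mu>sum p)}} =
     {f \<in> carrier (poly_ring m). \<forall>J\<in>{J \<in> index_set m n. Q (\<Sum>i\<in>{1..m}. \<theta> i (J i))}. line_ev m \<theta> J f = 0}" for Q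
  proof -
    have ev: "restrict_class p (eta P aP xP \<mu>P m f) = line_ev m \<theta> J f" "\<mu>sum p = (\<Sum>i\<in>{1..m}. \<theta> i (J i))"
      if p: "p \<in> fixed_points P aP" and J: "\<forall>i\<in>{1..m}. \<theta> i (J i) = \<mu> i (p i)" for p J f
    proof -
      show "\<mu>sum p = (\<Sum>i\<in>{1..m}. \<theta> i (J i))" unfolding \<mu>sum_def using J by simp
      show "restrict_class p (eta P aP xP \<mu>P m f) = line_ev m \<theta> J f"
        unfolding restr[OF p] line_ev_def using J by (intro mpoly_ev_cong) simp
    qed
    have "(\<forall>p\<in>fixed_points P aP \<inter> {p. Q (\<mu>sum p)}. restrict_class p (eta P aP xP \<mu>P m f) = 0) \<longleftrightarrow>
      (\<forall>J\<in>{J \<in> index_set m n. Q (\<Sum>i\<in>{1..m}. \<theta> i (J i))}. line_ev m \<theta> J f = 0)" (is "?l \<longleftrightarrow> ?r") for f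
    proof
      assume l: ?l
      show ?r
      proof
        fix J assume J: "J \<in> {J \<in> index_set m n. Q (\<Sum>i\<in>{1..m}. \<theta> i (J i))}"
        then have "J \<in> index_set m n" by simp
        from fixed_point_index(2)[OF fixed_values this] obtain p where p: "p \<in> fixed_points P aP" "\<forall>i\<in>{1..m}. \<theta> i (J i) = \<mu> i (p i)"
          unfolding fixed by blast
        show "line_ev m \<theta> J f = 0" using ev(1)[OF p, of f] ev(2)[OF p] l J p(1) by simp
      qed
    next
      assume r: ?r
      show ?l
      proof
        fix p assume p: "p \<in> fixed_points P aP \<inter> {p. Q (\<mu>sum p)}"
        then have pf: "p \<in> fixed_points P aP" by simp
        from fixed_point_index(1)[OF fixed_values pf[unfolded fixed]] obtain J where J: "J \<in> index_set m n" "\<forall>i\<in>{1..m}. \<theta> i (J i) = \<mu> i (p i)"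
          by blast
        show "restrict_class p (eta P aP xP \<mu>P m f) = 0" using ev(1)[OF pf J(2), of f] ev(2)[OF pf J(2)] r J(1) p by simp
      qed
    qed
    then show ?thesis using carrier unfolding vanishing_ideal_def by simp
  qed
  have inj: "inj_on (\<theta> i) {1..n i}" if "i \<in> {1..m}" for i
    using bij_betw_imp_inj_on[OF fixed_values[OF that]] .
  interpret L: upper_set m n \<theta> \<theta> "large_set m n \<theta>"
  proof
    fix J J' assume J: "J \<in> large_set m n \<theta>" and J': "J' \<in> index_set m n"
      and le: "\<And>i. i \<in> {1..m} \<Longrightarrow> \<theta> i (J i) \<le> \<theta> i (J' i)"
    have "(\<Sum>i\<in>{1..m}. \<theta> i (J i)) \<le> (\<Sum>i\<in>{1..m}. \<theta> i (J' i))" by (rule sum_mono[OF le])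
    then show "J' \<in> large_set m n \<theta>" using J J' by (simp add: large_set_def)
  qed (rule inj, assumption, auto simp: large_set_def)
  \<comment> \<open>Negative sums are preserved when the \<theta> values decrease, so the order is
    reversed while the lines remain those of \<theta>.\<close>
  interpret S: upper_set m n \<theta> "\<lambda>i j. - \<theta> i j" "small_set m n \<theta>"
  proof
    fix J J' assume J: "J \<in> small_set m n \<theta>" and J': "J' \<in> index_set m n"
      and le: "\<And>i. i \<in> {1..m} \<Longrightarrow> - \<theta> i (J i) \<le> - \<theta> i (J' i)"
    have "(\<Sum>i\<in>{1..m}. \<theta> i (J' i)) \<le> (\<Sum>i\<in>{1..m}. \<theta> i (J i))" using le by (intro sum_mono) simp
    then show "J' \<in> small_set m n \<theta>" using J J' by (simp add: small_set_def)
  next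
    show "inj_on (\<lambda>j. - \<theta> i j) {1..n i}" if "i \<in> {1..m}" for i
    proof (rule inj_onI)
      fix j j' assume "j \<in> {1..n i}" "j' \<in> {1..n i}" "- \<theta> i j = - \<theta> i j'"
      then show "j = j'" using inj_onD[OF inj[OF that], of j j'] by (simp only: neg_equal_iff_equal)
    qed
  qed (rule inj, assumption, auto simp: small_set_def)
  have plus: "Kbar_plus = L.vanishing"
    unfolding Kbar_plus_def K_plus_def L.vanishing_def by (rule key[of "\<lambda>s. s > 0", folded large_set_def])
  have minus: "Kbar_minus = S.vanishing"
    unfolding Kbar_minus_def K_minus_def S.vanishing_def by (rule key[of "\<lambda>s. s < 0", folded small_set_def])
  show ?thesis
    unfolding plus minus
    by (intro conjI L.generated[unfolded L.generators_def] S.generated[unfolded S.generators_def])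
qed

end
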